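(* Let $d\ge1$ and let $\psi:\mathbb R^d\to[0,\infty)$ be a radially increasing function. Put $$I=\int_{\|\xi\|\ge 1}\frac{\psi(\xi)}{\|\xi\|^{d+1}}\,d\xi .$$ (a) Let $f\in L^p(\mathbb R^d)$ for some $p\in[1,2]$, and suppose that either $$\int_{\mathbb R^d}\frac{|\widehat f(\xi)|^q\,e^{q\psi(\xi)}}{(1+\|\xi\|)^N}\,d\xi<\infty$$ for some $q\in[1,\infty)$ and some $N\ge0$, or $$|\widehat f(\xi)|\le C\,|P(\xi)|\,e^{-\psi(\xi)}\quad\text{for almost every }\xi\in\mathbb R^d,$$ where $C>0$ is a constant and $P$ is a polynomial. If $f$ vanishes (almost everywhere) on a nonempty open subset of $\mathbb R^d$ and $I=\infty$, then $f=0$ almost everywhere on $\mathbb R^d$. (b) If $I<\infty$, then for $q\in[1,\infty)$ and $N\ge0$ there exists a nonzero $f\in C_c^\infty(\mathbb R^d)$ satisfying $\int_{\mathbb R^d}\frac{|\widehat f(\xi)|^q e^{q\psi(\xi)}}{(1+\|\xi\|)^N}\,d\xi<\infty$, and (in the case $q=\infty$) there exists a nonzero $f\in C_c^\infty(\mathbb R^d)$ satisfying $|\widehat f(\xi)|\le C|P(\xi)|e^{-\psi(\xi)}$ for almost every $\xi$, for some constant $C$ and polynomial $P$.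
   Context: The Fourier transform of $f\in L^1(\mathbb R^d)$ is $\widehat f(\xi)=\int_{\mathbb R^d}f(x)e^{-2\pi i x\cdot\xi}\,dx$, extended to $L^p(\mathbb R^d)$, $1<p\le 2$, in the usual way. A function $\psi$ on $\mathbb R^d$ is radially increasing if it is radial and $\psi(x)\ge\psi(y)$ whenever $\|x\|\ge\|y\|$; $\|\cdot\|$ is the Euclidean norm. *)

theory Defs
  imports "HOL-Analysis.Analysis"
begin

definition fourier :: "('a::euclidean_space \<Rightarrow> complex) \<Rightarrow> 'a \<Rightarrow> complex" where
  "fourier f \<xi> = (\<integral>x. f x * cis (- 2 * pi * (x \<bullet> \<xi>)) \<partial>lborel)"

definition in_Lp :: "real \<Rightarrow> ('a::euclidean_space \<Rightarrow> complex) \<Rightarrow> bool" where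
  "in_Lp p f \<longleftrightarrow> f \<in> borel_measurable lborel \<and> integrable lborel (\<lambda>x. norm (f x) powr p)"

text \<open>\<open>g\<close> is (a representative of) the Fourier transform of \<open>f \<in> L^p\<close>, \<open>1 \<le> p \<le> 2\<close>.
  For \<open>p = 1\<close> it is the integral.  For \<open>1 < p \<le> 2\<close> it is the usual extension
  (Hausdorff--Young): the \<open>L^{p'}\<close>-limit of the Fourier transforms of the
  \<open>L^1 \<inter> L^p\<close> truncations \<open>f \<cdot> 1_{ball 0 n}\<close>, where \<open>p' = p/(p-1)\<close>.\<close>
definition is_fourier_transform :: "real \<Rightarrow> ('a::euclidean_space \<Rightarrow> complex) \<Rightarrow> ('a \<Rightarrow> complex) \<Rightarrow> bool" where
  "is_fourier_transform p f g \<longleftrightarrow>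
     (if p = 1 then (\<forall>\<xi>. g \<xi> = fourier f \<xi>)
      else g \<in> borel_measurable lborel \<and>
        ((\<lambda>n::nat. \<integral>\<^sup>+ \<xi>. ennreal (norm (fourier (\<lambda>x. indicator (ball 0 (real n)) x * f x) \<xi> - g \<xi>)
                                  powr (p / (p - 1))) \<partial>lborel) \<longlonglongrightarrow> 0))"

definition radially_increasing :: "('a::euclidean_space \<Rightarrow> real) \<Rightarrow> bool" where
  "radially_increasing \<psi> \<longleftrightarrow>
     (\<forall>x y. norm x = norm y \<longrightarrow> \<psi> x = \<psi> y) \<and> (\<forall>x y. norm x \<ge> norm y \<longrightarrow> \<psi> x \<ge> \<psi> y)"

definition I_int :: "('a::euclidean_space \<Rightarrow> real) \<Rightarrow> ennreal" where
  "I_int \<psi> = (\<integral>\<^sup>+ \<xi>. indicator {\<xi>. norm \<xi> \<ge> 1} \<xi> * ennreal (\<psi> \<xi> / norm \<xi> ^ (DIM('a) + 1)) \<partial>lborel)"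

definition weighted_cond :: "real \<Rightarrow> real \<Rightarrow> ('a::euclidean_space \<Rightarrow> real) \<Rightarrow> ('a \<Rightarrow> complex) \<Rightarrow> bool" where
  "weighted_cond q N \<psi> g \<longleftrightarrow>
     (\<integral>\<^sup>+ \<xi>. ennreal (norm (g \<xi>) powr q * exp (q * \<psi> \<xi>) / (1 + norm \<xi>) powr N) \<partial>lborel) < \<infinity>"

definition poly_bound :: "real \<Rightarrow> ('a::euclidean_space \<Rightarrow> complex) \<Rightarrow> ('a \<Rightarrow> real) \<Rightarrow> ('a \<Rightarrow> complex) \<Rightarrow> bool" where
  "poly_bound C P \<psi> g \<longleftrightarrow>
     polynomial_function P \<and> (AE \<xi> in lborel. norm (g \<xi>) \<le> C * norm (P \<xi>) * exp (- \<psi> \<xi>))"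

fun Ck :: "nat \<Rightarrow> ('a::euclidean_space \<Rightarrow> complex) \<Rightarrow> bool" where
  "Ck 0 f \<longleftrightarrow> continuous_on UNIV f"
| "Ck (Suc k) f \<longleftrightarrow> f differentiable_on UNIV \<and> (\<forall>v. Ck k (\<lambda>x. frechet_derivative f (at x) v))"

definition smooth_compact_support :: "('a::euclidean_space \<Rightarrow> complex) \<Rightarrow> bool" where
  "smooth_compact_support f \<longleftrightarrow> (\<forall>k. Ck k f) \<and> compact (closure {x. f x \<noteq> 0})"

end

theory Submission
  imports Defs "HOL-Probability.Characteristic_Functions" "HOL-Probability.Sinc_Integral"
begin

text \<open>
  The integral \<open>I\<close> is infinite iff \<open>\<Sum> \<psi>(2\<^sup>n) / 2\<^sup>n = \<infinity>\<close>.  Convolving a bump on a small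
  ball with the normalized indicators of \<open>k\<^sub>j\<close> cubes of side \<open>w\<^sub>j\<close>, where \<open>\<Sum> k\<^sub>j w\<^sub>j < \<infinity>\<close>, gives a
  mollifier \<open>\<phi>\<close> of small support whose Fourier transform is at most \<open>C (w\<^sub>j \<bar>\<xi>\<bar>) powr (- k\<^sub>j)\<close> for every
  \<open>j\<close>.  If \<open>I < \<infinity>\<close>, taking \<open>k\<^sub>n\<close> about \<open>\<psi>(2\<^sup>n\<^sup>+\<^sup>1)\<close> and \<open>w\<^sub>n = e / 2\<^sup>n\<close> makes \<open>\<phi>\<close> the function wanted in (b).

  If \<open>I = \<infinity>\<close>, the weight \<open>e\<^sup>\<psi>\<close> alone need not put \<open>f\<close> into a quasi-analytic class, because \<open>\<psi>\<close> may be
  constant on very long intervals.  A mollifier repairs this: there are \<open>k\<^sub>n\<close> with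
  \<open>\<Sum> k\<^sub>n / 2\<^sup>n = \<infinity>\<close> such that the transform \<open>G\<close> of \<open>f * \<phi>\<close> satisfies
  \<open>\<integral> \<bar>\<xi>\<bar>\<^sup>k \<bar>G\<bar> \<le> C 2\<^sup>n\<^sup>k\<close> for \<open>k \<le> k\<^sub>n\<close>.  A variant of Bang's argument
  for the Denjoy--Carleman theorem, applied on lines, shows that \<open>f * \<phi>\<close>, which vanishes on a ball,
  vanishes everywhere; letting the support of \<open>\<phi>\<close> shrink yields \<open>f = 0\<close>.
\<close>

section \<open>Gaussians and Fourier inversion\<close>

text \<open>Beyond the radius 2^n the weight guarantees no more than the constant factor exp (-
  \<psi>(2^n)), whereas bounding a moment of order k by a multiple of 2^(nk) needs the decay
  (|\<xi>| / 2^n)^(-k) there. A mollifier supplies it: with w_n = exp (- a_n) / 2^n, its decay (w_n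
  |\<xi>|)^(-k_n) is (|\<xi>| / 2^n)^(-k_n) times the constant exp (a_n k_n), and the weight pays
  for that constant as long as a_n k_n \<le> \<psi>(2^n). Large a_n keep the support small but
  endanger the divergence of the sum of k_n / 2^n; the Abel-Dini theorem shows that both demands can
  be met. The bounds obtained hold at each scale 2^n only up to the order k_n, and these orders need
  not be monotone in n. Hence quasi-analyticity is stated scale by scale rather than for one
  sequence of constants M_k. Infinite convolutions are never formed: finite products of transforms
  converge, and Fourier inversion carries the limit back to functions.\<close>

lemma
  fixes f :: "'a::euclidean_space \<Rightarrow> 'b::{banach, second_countable_topology}"
  assumes f[measurable]: "f \<in> borel_measurable borel" and c: "c \<noteq> 0"
  shows integrable_lborel_affine: "integrable lborel (\<lambda>x. f (t + c *\<^sub>R x)) \<longleftrightarrow> integrable lborel f"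
    and integral_lborel_affine:
      "integral\<^sup>L lborel f = \<bar>c\<bar> ^ DIM('a) *\<^sub>R (\<integral>x. f (t + c *\<^sub>R x) \<partial>lborel)"
proof -
  let ?D = "density (distr lborel borel (\<lambda>x::'a. t + c *\<^sub>R x)) (\<lambda>_. ennreal (\<bar>c\<bar> ^ DIM('a)))"
  have D: "lborel = ?D"
    using lborel_affine[OF c, of t] by (simp add: ennreal_power)
  have "integrable lborel f \<longleftrightarrow> integrable ?D f"
    using D by simp
  also have "\<dots> \<longleftrightarrow> integrable lborel (\<lambda>x. f (t + c *\<^sub>R x))"
    using c integrable_scaleR_right[of "1 / \<bar>c\<bar> ^ DIM('a)" lborel
        "\<lambda>x. \<bar>c\<bar> ^ DIM('a) *\<^sub>R f (t + c *\<^sub>R x)"]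
    by (subst integrable_density) (auto simp: integrable_distr_eq)
  finally show "integrable lborel (\<lambda>x. f (t + c *\<^sub>R x)) \<longleftrightarrow> integrable lborel f"
    by simp
  have "integral\<^sup>L lborel f = integral\<^sup>L ?D f"
    using D by simp
  also have "\<dots> = \<bar>c\<bar> ^ DIM('a) *\<^sub>R (\<integral>x. f (t + c *\<^sub>R x) \<partial>lborel)"
    by (subst integral_density) (auto simp: integral_distr)
  finally show "integral\<^sup>L lborel f = \<bar>c\<bar> ^ DIM('a) *\<^sub>R (\<integral>x. f (t + c *\<^sub>R x) \<partial>lborel)" .
qed

lemma
  fixes F :: "'a::euclidean_space \<Rightarrow> real \<Rightarrow> 'b::{real_normed_field, banach, second_countable_topology}"
  assumes F: "\<And>b. b \<in> Basis \<Longrightarrow> integrable lborel (F b)"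
  shows integrable_lborel_prod: "integrable lborel (\<lambda>x::'a. \<Prod>b\<in>Basis. F b (x \<bullet> b))"
    and integral_lborel_prod:
      "(\<integral>x. (\<Prod>b\<in>Basis. F b ((x::'a) \<bullet> b)) \<partial>lborel) = (\<Prod>b\<in>Basis. integral\<^sup>L lborel (F b))"
proof -
  interpret product_sigma_finite "\<lambda>_::'a. lborel :: real measure" ..
  have [measurable]: "F b \<in> borel_measurable borel" if "b \<in> Basis" for b
    using borel_measurable_integrable[OF F[OF that]] by simp
  show "integrable lborel (\<lambda>x::'a. \<Prod>b\<in>Basis. F b (x \<bullet> b))"
    unfolding lborel_eq[where 'a='a]
    by (subst integrable_distr_eq) (auto intro!: product_integrable_prod F)
  show "(\<integral>x. (\<Prod>b\<in>Basis. F b ((x::'a) \<bullet> b)) \<partial>lborel) = (\<Prod>b\<in>Basis. integral\<^sup>L lborel (F b))"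
    unfolding lborel_eq[where 'a='a]
    by (subst integral_distr) (auto simp: product_integral_prod F)
qed

definition gaussian :: "'a::euclidean_space \<Rightarrow> real" where
  "gaussian x = (\<Prod>b\<in>Basis. std_normal_density (x \<bullet> b))"

lemma gaussian_eq:
  "gaussian (x::'a::euclidean_space) = (1 / sqrt (2 * pi)) ^ DIM('a) * exp (- (norm x)\<^sup>2 / 2)"
proof -
  have "(\<Sum>b\<in>Basis. - (x \<bullet> b)\<^sup>2 / 2) = - (norm x)\<^sup>2 / 2"
    unfolding norm_eq_sqrt_inner
    by (subst euclidean_inner) (simp add: sum_nonneg power2_eq_square sum_negf sum_divide_distrib)
  then have "(\<Prod>b\<in>Basis. exp (- (x \<bullet> b)\<^sup>2 / 2)) = exp (- (norm x)\<^sup>2 / 2)"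
    by (simp flip: exp_sum)
  then show ?thesis
    by (simp only: gaussian_def std_normal_density_def prod.distrib prod_constant)
qed

lemma gaussian_pos: "gaussian x > 0"
  by (simp add: gaussian_eq)

lemma gaussian_le: "gaussian (x::'a::euclidean_space) \<le> gaussian (0::'a)"
  by (simp add: gaussian_eq)

lemma gaussian_measurable [measurable]: "gaussian \<in> borel_measurable borel"
  unfolding gaussian_eq by measurable

lemma cis_sum: "finite A \<Longrightarrow> cis (sum f A) = (\<Prod>a\<in>A. cis (f a))"
  by (induction A rule: finite_induct) (auto simp flip: cis_mult)

lemma cis_measurable [measurable]: "cis \<in> borel_measurable borel"
  by (intro borel_measurable_continuous_onI continuous_intros)

text \<open>Both the Gaussian and the character factor over the coordinates, which reduces the
  transform to the characteristic function of the standard normal distribution.\<close>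

lemma
  fixes s :: "'a::euclidean_space"
  shows integrable_gaussian: "integrable lborel (gaussian :: 'a \<Rightarrow> real)"
    and integral_gaussian: "(\<integral>x. gaussian (x::'a) \<partial>lborel) = 1"
    and integral_gaussian_cis:
      "(\<integral>x. complex_of_real (gaussian x) * cis (s \<bullet> x) \<partial>lborel) = of_real (exp (- (norm s)\<^sup>2 / 2))"
proof -
  have 1: "integrable lborel std_normal_density"
    by simp
  show "integrable lborel (gaussian :: 'a \<Rightarrow> real)" "(\<integral>x. gaussian (x::'a) \<partial>lborel) = 1"
    unfolding gaussian_def using integrable_lborel_prod[of "\<lambda>_. std_normal_density", OF 1]
      integral_lborel_prod[of "\<lambda>_. std_normal_density", OF 1] by simp_all
  have 2: "integrable lborel (\<lambda>x. complex_of_real (std_normal_density x) * cis (t * x))" for t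
    by (rule Bochner_Integration.integrable_bound[OF 1])
      (auto simp: norm_mult)
  have 3: "(\<integral>x. complex_of_real (std_normal_density x) * cis (t * x) \<partial>lborel) = exp (- (t\<^sup>2) / 2)" for t
    using fun_cong[OF char_std_normal_distribution, of t] unfolding char_def
    by (subst (asm) integral_density) (auto simp: scaleR_conv_of_real cis_conv_exp normal_density_nonneg)
  have "(\<integral>x. complex_of_real (gaussian x) * cis (s \<bullet> x) \<partial>lborel) =
      (\<integral>x. (\<Prod>b\<in>Basis. complex_of_real (std_normal_density (x \<bullet> b)) * cis ((s \<bullet> b) * (x \<bullet> b))) \<partial>lborel)"
  proof (rule Bochner_Integration.integral_cong)
    fix x :: 'a
    have "cis (s \<bullet> x) = cis (\<Sum>b\<in>Basis. (s \<bullet> b) * (x \<bullet> b))"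
      by (rule arg_cong[OF euclidean_inner])
    then show "complex_of_real (gaussian x) * cis (s \<bullet> x) =
        (\<Prod>b\<in>Basis. complex_of_real (std_normal_density (x \<bullet> b)) * cis ((s \<bullet> b) * (x \<bullet> b)))"
      by (simp add: gaussian_def prod.distrib cis_sum)
  qed simp
  also have "\<dots> = (\<Prod>b\<in>Basis. complex_of_real (exp (- ((s \<bullet> b)\<^sup>2) / 2)))"
    by (subst integral_lborel_prod) (use 2 3 in auto)
  also have "\<dots> = of_real (exp (\<Sum>b\<in>Basis. - (s \<bullet> b)\<^sup>2 / 2))"
    by (simp add: exp_sum)
  also have "(\<Sum>b\<in>Basis. - (s \<bullet> b)\<^sup>2 / 2) = - (norm s)\<^sup>2 / 2"
    unfolding norm_eq_sqrt_inner
    by (subst euclidean_inner) (simp add: sum_nonneg power2_eq_square sum_negf sum_divide_distrib)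
  finally show "(\<integral>x. complex_of_real (gaussian x) * cis (s \<bullet> x) \<partial>lborel) = of_real (exp (- (norm s)\<^sup>2 / 2))" .
qed

lemma
  fixes f :: "'a::euclidean_space \<Rightarrow> complex"
  assumes "integrable lborel f"
  shows integrable_mult_cis: "g \<in> borel_measurable borel \<Longrightarrow> integrable lborel (\<lambda>x. f x * cis (g x))"
    and norm_fourier_le: "norm (fourier f \<xi>) \<le> (\<integral>x. norm (f x) \<partial>lborel)"
proof -
  have [measurable]: "f \<in> borel_measurable borel"
    using borel_measurable_integrable[OF assms] by simp
  show "g \<in> borel_measurable borel \<Longrightarrow> integrable lborel (\<lambda>x. f x * cis (g x))"
    by (rule Bochner_Integration.integrable_bound[OF assms]) (auto simp: norm_mult)
  show "norm (fourier f \<xi>) \<le> (\<integral>x. norm (f x) \<partial>lborel)"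
    unfolding fourier_def
    using integral_norm_bound[of lborel "\<lambda>x. f x * cis (- 2 * pi * (x \<bullet> \<xi>))"]
    by (simp add: norm_mult)
qed

lemma fourier_measurable [measurable]:
  fixes f :: "'a::euclidean_space \<Rightarrow> complex"
  assumes [measurable]: "f \<in> borel_measurable borel"
  shows "fourier f \<in> borel_measurable borel"
  unfolding fourier_def[abs_def] by measurable

text \<open>The bound on \<open>k\<close> yields the integrable product majorant B |f(x)| |g(y)|.
  The exchanges in the inversion theorem, the multiplication formula and the test against boxes all
  have this form.\<close>

lemma fubini_mult:
  fixes f :: "'a::euclidean_space \<Rightarrow> complex" and g :: "'b::euclidean_space \<Rightarrow> complex"
  assumes f: "integrable lborel f" and g: "integrable lborel g"
    and k[measurable]: "(\<lambda>(x, y). k x y) \<in> borel_measurable (borel \<Otimes>\<^sub>M borel)"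
    and kB: "\<And>x y. norm (k x y :: complex) \<le> B"
  shows "(\<integral>x. f x * (\<integral>y. g y * k x y \<partial>lborel) \<partial>lborel) = (\<integral>y. g y * (\<integral>x. f x * k x y \<partial>lborel) \<partial>lborel)"
proof -
  have [measurable]: "f \<in> borel_measurable borel" "g \<in> borel_measurable borel"
    using borel_measurable_integrable[OF f] borel_measurable_integrable[OF g] by simp_all
  have kx: "(\<lambda>y. k x y) \<in> borel_measurable borel" for x
    using measurable_compose[OF measurable_Pair1' k, of x] by simp
  have ky: "(\<lambda>x. k x y) \<in> borel_measurable borel" for y
    using measurable_compose[OF measurable_Pair2' k, of y] by simp
  have bound: "norm (f x * (g y * k x y)) \<le> norm (B * norm (f x) * norm (g y))" for x y
    using mult_left_mono[OF kB[of x y], of "norm (f x) * norm (g y)"] order_trans[OF norm_ge_zero kB]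
    by (simp add: norm_mult mult_ac)
  have "integrable (lborel \<Otimes>\<^sub>M lborel) (\<lambda>(x, y). B * norm (f x) * norm (g y))"
    by (rule lborel_pair.Fubini_integrable) (use f g in \<open>auto simp: abs_mult\<close>)
  then have "integrable (lborel \<Otimes>\<^sub>M lborel) (\<lambda>(x, y). f x * (g y * k x y))"
    by (rule Bochner_Integration.integrable_bound) (use bound in auto)
  from lborel_pair.Fubini_integral[OF this]
  have "(\<integral>y. \<integral>x. f x * (g y * k x y) \<partial>lborel \<partial>lborel) = (\<integral>x. \<integral>y. f x * (g y * k x y) \<partial>lborel \<partial>lborel)" .
  then show ?thesis
    by (simp add: mult.left_commute[of "f _" "g _"] flip: integral_mult_right_zero)
qed

text \<open>Gaussian summability: with a Gaussian cutoff of width r inserted, the inversion integral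
  \<open>J\<close> becomes, after an exchange of integrals, an average of \<open>\<phi>\<close> over
  a Gaussian of width proportional to 1/r around x. As r tends to infinity both forms converge, one
  dominated through the boundedness of \<open>\<phi>\<close>, the other through the integrability of
  its transform; comparing the limits gives the formula.\<close>

theorem fourier_inversion:
  fixes \<phi> :: "'a::euclidean_space \<Rightarrow> complex"
  assumes int: "integrable lborel \<phi>" and cont: "continuous_on UNIV \<phi>"
    and bdd: "\<And>x. norm (\<phi> x) \<le> B" and inth: "integrable lborel (fourier \<phi>)"
  shows "\<phi> x = fourier (fourier \<phi>) (- x)"
proof -
  have [measurable]: "\<phi> \<in> borel_measurable borel"
    using borel_measurable_continuous_onI[OF cont] .
  \<comment> \<open>The unnormalized Gaussian is \<open>gaussian\<close> divided by
    \<open>c\<close>, and c^2 = (2 pi)^(-d) is the identity by which the constants of the two limits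
    cancel at the end.\<close>
  define c where "c = gaussian (0::'a)"
  have c: "c > 0" "c\<^sup>2 = (1 / (2 * pi)) ^ DIM('a)"
    by (auto simp: c_def gaussian_pos) (simp add: gaussian_eq power2_eq_square flip: power_mult_distrib)
  have exp_gaussian: "exp (- (norm y)\<^sup>2 / 2) = gaussian y / c" for y :: 'a
    by (simp add: c_def gaussian_eq)
  define r where "r n = real (Suc n)" for n
  have r: "r n > 0" for n by (simp add: r_def)
  have r_lim: "(\<lambda>n. inverse (r n)) \<longlonglongrightarrow> 0"
    unfolding r_def by (rule LIMSEQ_inverse_real_of_nat)
  define J where "J n = (\<integral>\<xi>. fourier \<phi> \<xi> * (gaussian (\<xi> /\<^sub>R r n) * cis (2 * pi * (x \<bullet> \<xi>))) \<partial>lborel)" for n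

  have gint: "integrable lborel (\<lambda>\<xi>::'a. complex_of_real (gaussian (\<xi> /\<^sub>R r n)))" for n
    using integrable_lborel_affine[of "\<lambda>\<xi>. complex_of_real (gaussian (\<xi>::'a))" "inverse (r n)" 0]
      integrable_gaussian[where 'a='a] r[of n] by auto
  have inner: "(\<integral>\<xi>. gaussian (\<xi> /\<^sub>R r n) * cis (2 * pi * ((x - y) \<bullet> \<xi>)) \<partial>lborel)
      = r n ^ DIM('a) * gaussian ((2 * pi * r n) *\<^sub>R (x - y)) / c" for n y
  proof -
    have "(\<integral>\<xi>. gaussian (\<xi> /\<^sub>R r n) * cis (2 * pi * ((x - y) \<bullet> \<xi>)) \<partial>lborel) =
        r n ^ DIM('a) *\<^sub>R (\<integral>\<xi>. gaussian \<xi> * cis (((2 * pi * r n) *\<^sub>R (x - y)) \<bullet> \<xi>) \<partial>lborel)"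
      using r[of n] by (subst integral_lborel_affine[where c="r n" and t=0]) (auto simp: mult_ac)
    then show ?thesis
      unfolding integral_gaussian_cis exp_gaussian by (simp add: scaleR_conv_of_real)
  qed

  have J1: "J n = (1 / (2 * pi)) ^ DIM('a) / c * (\<integral>z. \<phi> (x - z /\<^sub>R (2 * pi * r n)) * gaussian z \<partial>lborel)" for n
  proof -
    define k where "k = 2 * pi * r n"
    have k: "k > 0"
      using r[of n] by (simp add: k_def)
    have "J n = (\<integral>\<xi>. complex_of_real (gaussian (\<xi> /\<^sub>R r n)) *
        (\<integral>y. \<phi> y * (cis (2 * pi * ((x - y) \<bullet> \<xi>))) \<partial>lborel) \<partial>lborel)"
      unfolding J_def fourier_def
      by (simp add: inner_diff_left right_diff_distrib cis_mult algebra_simps flip: integral_mult_left_zero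
          integral_mult_right_zero)
    also have "\<dots> = (\<integral>y. \<phi> y * (\<integral>\<xi>. gaussian (\<xi> /\<^sub>R r n) * cis (2 * pi * ((x - y) \<bullet> \<xi>)) \<partial>lborel) \<partial>lborel)"
      by (rule fubini_mult[where B=1]) (use gint int in auto)
    also have "\<dots> = (\<integral>y. \<phi> y * (r n ^ DIM('a) * gaussian ((2 * pi * r n) *\<^sub>R (x - y)) / c) \<partial>lborel)"
      by (simp only: inner)
    also have "\<dots> = (1 / k) ^ DIM('a) *\<^sub>R (\<integral>z. \<phi> (x + (- (1 / k)) *\<^sub>R z) *
        (r n ^ DIM('a) * gaussian (k *\<^sub>R (x - (x + (- (1 / k)) *\<^sub>R z))) / c) \<partial>lborel)"
      unfolding k_def[symmetric]
      by (subst integral_lborel_affine[where c="- (1 / k)" and t=x]) (use k in auto)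
    also have "\<dots> = (1 / k) ^ DIM('a) *\<^sub>R (\<integral>z. (r n ^ DIM('a) / c) * (\<phi> (x - z /\<^sub>R k) * gaussian z) \<partial>lborel)"
      using k by (simp add: field_simps)
    also have "\<dots> = ((1 / k) ^ DIM('a) * (r n ^ DIM('a) / c)) * (\<integral>z. \<phi> (x - z /\<^sub>R k) * gaussian z \<partial>lborel)"
      by (simp add: scaleR_conv_of_real)
    also have "(1 / k) ^ DIM('a) * (r n ^ DIM('a) / c) = (1 / (2 * pi)) ^ DIM('a) / c"
      using r[of n] by (simp add: k_def power_mult_distrib power_divide)
    finally show ?thesis
      by (simp add: k_def)
  qed
  have "(\<lambda>n. \<integral>z. \<phi> (x - z /\<^sub>R (2 * pi * r n)) * gaussian z \<partial>lborel) \<longlonglongrightarrow> (\<integral>z. \<phi> x * gaussian (z::'a) \<partial>lborel)"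
  proof (rule integral_dominated_convergence[where w="\<lambda>z. B * gaussian z"])
    show "AE z in lborel. (\<lambda>n. \<phi> (x - z /\<^sub>R (2 * pi * r n)) * gaussian z) \<longlonglongrightarrow> \<phi> x * gaussian z"
    proof (intro AE_I2 tendsto_mult tendsto_const)
      fix z
      have "(\<lambda>n. x - (inverse (2 * pi) * inverse (r n)) *\<^sub>R z) \<longlonglongrightarrow> x - (inverse (2 * pi) * 0) *\<^sub>R z"
        by (intro tendsto_intros r_lim)
      then show "(\<lambda>n. \<phi> (x - z /\<^sub>R (2 * pi * r n))) \<longlonglongrightarrow> \<phi> x"
        by (intro continuous_on_tendsto_compose[OF cont]) simp_all
    qed
    show "AE z in lborel. norm (\<phi> (x - z /\<^sub>R (2 * pi * r n)) * gaussian z) \<le> B * gaussian z" for n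
      by (intro AE_I2) (auto simp: norm_mult gaussian_pos less_imp_le intro!: mult_mono bdd order_trans[OF norm_ge_zero bdd])
  qed (use integrable_gaussian in auto)
  also have "(\<integral>z. \<phi> x * gaussian (z::'a) \<partial>lborel) = \<phi> x"
    using integral_gaussian[where 'a='a] by simp
  finally have J_lim1: "J \<longlonglongrightarrow> (1 / (2 * pi)) ^ DIM('a) / c * \<phi> x"
    unfolding J1 by (intro tendsto_intros)

  have "J \<longlonglongrightarrow> (\<integral>\<xi>. fourier \<phi> \<xi> * (c * cis (2 * pi * (x \<bullet> \<xi>))) \<partial>lborel)"
    unfolding J_def
  proof (rule integral_dominated_convergence[where w="\<lambda>\<xi>. c * norm (fourier \<phi> \<xi>)"])
    show "AE \<xi> in lborel. (\<lambda>n. fourier \<phi> \<xi> * (gaussian (\<xi> /\<^sub>R r n) * cis (2 * pi * (x \<bullet> \<xi>)))) \<longlonglongrightarrow>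
        fourier \<phi> \<xi> * (c * cis (2 * pi * (x \<bullet> \<xi>)))"
    proof (intro AE_I2 tendsto_mult tendsto_const tendsto_of_real)
      fix \<xi> :: 'a
      have "(\<lambda>n. gaussian (inverse (r n) *\<^sub>R \<xi>)) \<longlonglongrightarrow> (1 / sqrt (2 * pi)) ^ DIM('a) * exp (- (norm (0 *\<^sub>R \<xi>))\<^sup>2 / 2)"
        unfolding gaussian_eq by (intro tendsto_intros r_lim) auto
      then show "(\<lambda>n. gaussian (\<xi> /\<^sub>R r n)) \<longlonglongrightarrow> c"
        by (simp add: c_def gaussian_eq)
    qed
    show "AE \<xi> in lborel. norm (fourier \<phi> \<xi> * (gaussian (\<xi> /\<^sub>R r n) * cis (2 * pi * (x \<bullet> \<xi>)))) \<le> c * norm (fourier \<phi> \<xi>)" for n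
      unfolding c_def
      by (intro AE_I2) (auto simp: norm_mult gaussian_pos abs_of_pos mult.commute[of "gaussian 0"]
          intro!: mult_left_mono gaussian_le)
  qed (use inth in auto)
  also have "(\<integral>\<xi>. fourier \<phi> \<xi> * (c * cis (2 * pi * (x \<bullet> \<xi>))) \<partial>lborel) = c * fourier (fourier \<phi>) (- x)"
    by (simp add: fourier_def[of "fourier \<phi>"] inner_commute mult.left_commute flip: integral_mult_right_zero)
  finally have "(1 / (2 * pi)) ^ DIM('a) / c * \<phi> x = c * fourier (fourier \<phi>) (- x)"
    by (rule LIMSEQ_unique[OF J_lim1])
  moreover have "complex_of_real ((1 / (2 * pi)) ^ DIM('a) / c) = complex_of_real c"
    using c by (simp add: power2_eq_square flip: c(2))
  ultimately have "complex_of_real c * \<phi> x = complex_of_real c * fourier (fourier \<phi>) (- x)"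
    by (metis of_real_divide of_real_power)
  then show ?thesis
    using c by simp
qed

section \<open>Quasi-analyticity\<close>

text \<open>Downward induction on k, starting from the uniform bound at order K. The bound for
  \<open>u (Suc k)\<close> is integrated along the path: from k to k+1 the prefactor C e^(k-K) R^k
  gains the factor e R, exactly the rate at which exp (e R t) grows. So the increment is at most c
  (exp (e R \<tau>) - 1), and \<open>init\<close> supplies the remaining c.\<close>

lemma bang_step:
  fixes u :: "nat \<Rightarrow> real \<Rightarrow> complex" and K :: nat
  assumes der: "\<And>k t. (u k has_vector_derivative u (Suc k) t) (at t)"
    and "C \<ge> 0" "R \<ge> 0"
    and top: "\<And>t. norm (u K t) \<le> C * R ^ K"
    and init: "\<And>k. k \<le> K \<Longrightarrow> norm (u k x) \<le> C * exp (real k - real K) * R ^ k"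
    and "k \<le> K" "\<tau> \<ge> 0"
  shows "norm (u k (x + \<tau>)) \<le> C * exp (real k - real K) * R ^ k * exp (exp 1 * R * \<tau>)"
  using \<open>k \<le> K\<close> \<open>\<tau> \<ge> 0\<close>
proof (induction k arbitrary: \<tau> rule: inc_induct)
  case base
  have "C * R ^ K * 1 \<le> C * R ^ K * exp (exp 1 * R * \<tau>)"
    by (rule mult_left_mono) (use assms base in auto)
  then show ?case
    using top[of "x + \<tau>"] by simp
next
  case (step k)
  define c where "c = C * exp (real k - real K) * R ^ k"
  have c: "c \<ge> 0"
    using assms by (simp add: c_def)
  show ?case
  proof (cases "\<tau> = 0")
    case True
    then show ?thesis
      using init[of k] step.hyps by simp
  next
    case False
    then have "0 < \<tau>"
      using step.prems by simp
    then have "norm (u k (x + \<tau>) - u k (x + 0)) \<le> c * exp (exp 1 * R * \<tau>) - c * exp (exp 1 * R * 0)"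
    proof (rule differentiable_bound_general)
      show "((\<lambda>t. u k (x + t)) has_vector_derivative u (Suc k) (x + t)) (at t)" for t
      proof -
        have "((\<lambda>t. x + t) has_vector_derivative 1) (at t)"
          by (auto intro!: derivative_eq_intros)
        from vector_diff_chain_at[OF this der[of k "x + t"]] show ?thesis
          by (simp add: o_def)
      qed
      then show "continuous_on {0..\<tau>} (\<lambda>t. u k (x + t))"
        by (intro continuous_at_imp_continuous_on ballI has_vector_derivative_continuous)
      show "((\<lambda>t. c * exp (exp 1 * R * t)) has_vector_derivative c * (exp 1 * R * exp (exp 1 * R * t))) (at t)" for t
        by (auto intro!: derivative_eq_intros simp flip: has_real_derivative_iff_has_vector_derivative)
      show "norm (u (Suc k) (x + t)) \<le> c * (exp 1 * R * exp (exp 1 * R * t))" if "0 < t" for t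
      proof -
        have "exp (real (Suc k) - real K) = exp (real k - real K) * exp 1"
          by (simp add: field_simps flip: exp_add)
        then show ?thesis
          using step.IH[of t] that by (simp add: c_def mult_ac)
      qed
    qed (intro continuous_intros)
    then have "norm (u k (x + \<tau>)) \<le> norm (u k x) + (c * exp (exp 1 * R * \<tau>) - c)"
      using norm_triangle_sub[of "u k (x + \<tau>)" "u k x"] by simp
    also have "\<dots> \<le> c * exp (exp 1 * R * \<tau>)"
      using init[of k] step.hyps by (simp add: c_def)
    finally show ?thesis
      by (simp add: c_def)
  qed
qed

text \<open>This is the maximum of \<beta>^(n-j) K j over j \<le> n, in other words the least
  majorant L of K with \<beta> L n \<le> L (Suc n). The recursive form makes the difference of these
  two sides visibly nonnegative.\<close>

primrec geom_max :: "real \<Rightarrow> (nat \<Rightarrow> nat) \<Rightarrow> nat \<Rightarrow> real" where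
  "geom_max \<beta> K 0 = K 0"
| "geom_max \<beta> K (Suc n) = max (K (Suc n)) (\<beta> * geom_max \<beta> K n)"

lemma geom_max_attained:
  assumes "\<beta> \<ge> 0"
  shows "\<exists>j\<le>n. geom_max \<beta> K n = \<beta> ^ (n - j) * K j"
proof (induction n)
  case (Suc n)
  then obtain j where j: "j \<le> n" "geom_max \<beta> K n = \<beta> ^ (n - j) * K j"
    by blast
  show ?case
  proof (cases "\<beta> * geom_max \<beta> K n \<le> K (Suc n)")
    case True
    then show ?thesis
      by (intro exI[of _ "Suc n"]) simp
  next
    case False
    then show ?thesis
      using j by (intro exI[of _ j]) (simp add: Suc_diff_le)
  qed
qed simp

lemma geom_max_ge:
  assumes "\<beta> \<ge> 0" "j \<le> n"
  shows "\<beta> ^ (n - j) * K j \<le> geom_max \<beta> K n"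
  using assms(2)
proof (induction n)
  case (Suc n)
  show ?case
  proof (cases "j = Suc n")
    case False
    then have "\<beta> * (\<beta> ^ (n - j) * K j) \<le> \<beta> * geom_max \<beta> K n"
      using Suc assms by (intro mult_left_mono) auto
    then show ?thesis
      using False Suc.prems by (simp add: Suc_diff_le mult.assoc)
  qed simp
qed simp

text \<open>A function all of whose derivatives vanish at a point stays below \<open>C e\<^sup>-\<^sup>K\<close> for a while when it is
  followed away from that point: at scale \<open>2 ^ n\<close> one can travel a distance comparable to the drop of the
  exponent divided by \<open>2 ^ n\<close>.  Passing from scale \<open>2 ^ n\<close> to \<open>2 ^ i\<close> multiplies the admissible
  exponent by at most \<open>1 + (n - i) ln 2 \<le> (1 + ln 2) ^ (n - i)\<close>, which is beaten by \<open>2 ^ (n - i)\<close>.\<close>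

theorem quasi_analytic:
  fixes u :: "nat \<Rightarrow> real \<Rightarrow> complex" and K :: "nat \<Rightarrow> nat"
  assumes der: "\<And>k t. (u k has_vector_derivative u (Suc k) t) (at t)"
    and C: "C \<ge> 0" and B: "B > 0"
    and bound: "\<And>n k t. k \<le> K n \<Longrightarrow> norm (u k t) \<le> C * (B * 2 ^ n) ^ k"
    and zero: "\<And>k. u k 0 = 0"
    and div: "\<not> summable (\<lambda>n. real (K n) / 2 ^ n)"
    and t: "t \<ge> 0"
  shows "u 0 t = 0"
proof -
  define \<beta> :: real where "\<beta> = 1 + ln 2"
  have \<beta>: "1 < \<beta>" "\<beta> < 2"
    using ln_2_less_1 by (auto simp: \<beta>_def)
  define L where "L = geom_max \<beta> K"
  have L_att: "\<exists>j\<le>n. L n = \<beta> ^ (n - j) * K j" and L_ge: "j \<le> n \<Longrightarrow> \<beta> ^ (n - j) * K j \<le> L n" for j n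
    using geom_max_attained geom_max_ge \<beta> by (auto simp: L_def)
  have KL: "real (K n) \<le> L n" for n
    using L_ge[of n n] by simp
  \<comment> \<open>The estimates use a scale j that realizes the maximum \<open>L n\<close>, not
    the scale n itself: only for such a j is \<open>K j\<close> known to be large, namely at least L
    n / \<beta>^n.\<close>
  define state where "state n x \<longleftrightarrow> (\<exists>j\<le>n. L n = \<beta> ^ (n - j) * K j \<and>
    (\<forall>k\<le>K j. norm (u k x) \<le> C * exp (real k - real (K j)) * (B * 2 ^ j) ^ k))" for n x
  \<comment> \<open>At scale n+1, \<open>bang_step\<close> multiplies the bounds by exp (e B 2^(n+1)
    \<tau>). The distance \<open>d n\<close> is the one that spends exactly the surplus
    \<open>L (Suc n) - \<beta> * L n\<close> of the exponent.\<close>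
  define d where "d n = (L (Suc n) - \<beta> * L n) / (exp 1 * B * 2 ^ Suc n)" for n
  have d_nonneg: "d n \<ge> 0" for n
    using B by (auto simp: d_def L_def)

  have step: "state n (x + \<tau>)" if st: "state (Suc n) x" and \<tau>: "0 \<le> \<tau>" "\<tau> \<le> d n" for n x \<tau>
  proof -
    obtain j where j: "j \<le> Suc n" "L (Suc n) = \<beta> ^ (Suc n - j) * K j"
      and bj: "\<And>k. k \<le> K j \<Longrightarrow> norm (u k x) \<le> C * exp (real k - real (K j)) * (B * 2 ^ j) ^ k"
      using st unfolding state_def by blast
    show ?thesis
    proof (cases "j = Suc n")
      \<comment> \<open>Here the maximum at n+1 is inherited from n, so \<open>d n\<close> is 0:
        nothing moves, and the same j serves for n.\<close>
      case False
      then have "j \<le> n"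
        using j by simp
      then have "L (Suc n) \<le> \<beta> * L n"
        using L_ge[of j n] \<beta> j by (simp add: Suc_diff_le mult.assoc)
      then have "L (Suc n) = \<beta> * L n"
        by (auto simp: L_def)
      then have "L n = \<beta> ^ (n - j) * K j"
        using j \<open>j \<le> n\<close> \<beta> by (auto simp: Suc_diff_le)
      moreover have "\<tau> = 0"
        using \<tau> \<open>L (Suc n) = \<beta> * L n\<close> by (simp add: d_def)
      ultimately show ?thesis
        using bj \<open>j \<le> n\<close> unfolding state_def by auto
    next
      \<comment> \<open>Now \<open>L (Suc n)\<close> is \<open>K j\<close> itself. The bounds are
        moved by \<tau> at scale j and then rewritten at the scale i where \<open>L n\<close> is
        attained; the change of base from 2^j to 2^i costs k (j-i) ln 2 in the exponent.\<close>
      case True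
      obtain i where i: "i \<le> n" "L n = \<beta> ^ (n - i) * K i"
        using L_att by blast
      have KL': "\<beta> * L n \<le> K j" and Lj: "L (Suc n) = K j"
        using j True by (auto simp: L_def)
      have "1 * L n \<le> \<beta> * L n"
        using \<beta> KL[of n] by (intro mult_right_mono) auto
      have \<beta>i: "\<beta> * L n = \<beta> ^ (j - i) * K i"
        using i True by (simp add: Suc_diff_le)
      have bern: "1 + real (j - i) * ln 2 \<le> \<beta> ^ (j - i)"
        unfolding \<beta>_def by (rule Bernoulli_inequality) (use ln_gt_zero[of "2::real"] in linarith)
      then have "(1 + real (j - i) * ln 2) * real (K i) \<le> \<beta> * L n"
        unfolding \<beta>i by (rule mult_right_mono) simp
      moreover have "real (K i) * 1 \<le> real (K i) * (1 + real (j - i) * ln 2)"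
        by (rule mult_left_mono) auto
      ultimately have Kij: "K i \<le> K j"
        using KL' by (simp add: mult.commute)
      have "norm (u k (x + \<tau>)) \<le> C * exp (real k - real (K i)) * (B * 2 ^ i) ^ k" if k: "k \<le> K i" for k
      proof -
        have "norm (u k (x + \<tau>)) \<le>
            C * exp (real k - real (K j)) * (B * 2 ^ j) ^ k * exp (exp 1 * (B * 2 ^ j) * \<tau>)"
          by (rule bang_step[where u=u]) (use der C B bound bj k Kij \<tau> in auto)
        also have "(B * 2 ^ j) ^ k = (B * 2 ^ i) ^ k * exp (real k * (real (j - i) * ln 2))"
        proof -
          have "(2::real) ^ j = 2 ^ i * 2 ^ (j - i)"
            using i True by (simp flip: power_add)
          also have "(2::real) ^ (j - i) = exp (real (j - i) * ln 2)"
            by (simp add: exp_of_nat_mult)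
          finally show ?thesis
            by (simp add: power_mult_distrib exp_of_nat_mult mult.assoc)
        qed
        also have "C * exp (real k - real (K j)) * ((B * 2 ^ i) ^ k * exp (real k * (real (j - i) * ln 2))) *
            exp (exp 1 * (B * 2 ^ j) * \<tau>) =
            C * (B * 2 ^ i) ^ k * exp (real k - real (K j) + real k * (real (j - i) * ln 2) + exp 1 * (B * 2 ^ j) * \<tau>)"
          by (simp add: exp_add)
        also have "\<dots> \<le> C * (B * 2 ^ i) ^ k * exp (real k - real (K i))"
        proof -
          have "exp 1 * (B * 2 ^ j) * \<tau> \<le> K j - \<beta> * L n"
            using \<tau>(2) B unfolding d_def Lj by (simp add: True field_simps)
          moreover have "real k * (real (j - i) * ln 2) \<le> real (K i) * (real (j - i) * ln 2)"
            using k by (intro mult_right_mono) auto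
          moreover have "real (K i) * (real (j - i) * ln 2) + real (K i) \<le> \<beta> * L n"
            using bern \<open>(1 + real (j - i) * ln 2) * real (K i) \<le> \<beta> * L n\<close> by (simp add: algebra_simps)
          ultimately have "real k - real (K j) + real k * (real (j - i) * ln 2) + exp 1 * (B * 2 ^ j) * \<tau> \<le>
              real k - real (K i)"
            by linarith
          then show ?thesis
            using B C by (intro mult_left_mono) auto
        qed
        finally show ?thesis
          by (simp add: mult_ac)
      qed
      then show ?thesis
        unfolding state_def using i by blast
    qed
  qed

  have walk: "state n (x + t)" if "state (n + m) x" "0 \<le> t" "t \<le> (\<Sum>i<m. d (n + i))" for n m x t
    using that
  proof (induction m arbitrary: x t)
    case (Suc m)
    \<comment> \<open>The finest available scale is used up first; the distance that is left is
      covered at coarser scales.\<close>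
    define \<tau> where "\<tau> = min t (d (n + m))"
    have "state (n + m) (x + \<tau>)"
      by (rule step) (use Suc.prems d_nonneg in \<open>auto simp: \<tau>_def\<close>)
    moreover have "t - \<tau> \<le> (\<Sum>i<m. d (n + i))"
      using Suc.prems sum_nonneg[of "{..<m}" "\<lambda>i. d (n + i)"] d_nonneg by (auto simp: \<tau>_def min_def)
    ultimately have "state n (x + \<tau> + (t - \<tau>))"
      using Suc.prems by (intro Suc.IH) (auto simp: \<tau>_def)
    then show ?case
      by simp
  qed simp

  \<comment> \<open>\<open>e n\<close> is a constant multiple of \<open>d n\<close>, and its partial
    sums telescope up to the term with coefficient 1 - \<beta>/2, positive because \<beta> < 2.
    Convergence of \<open>d\<close> would therefore bound the partial sums of L n / 2^n, hence those
    of K n / 2^n.\<close>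
  have d_div: "\<not> summable d"
  proof
    assume "summable d"
    define a where "a n = L n / 2 ^ n" for n
    define e where "e n = a (Suc n) - \<beta> / 2 * a n" for n
    have "summable (\<lambda>n. exp 1 * B * d n)"
      using \<open>summable d\<close> by (rule summable_mult)
    moreover have "exp 1 * B * d n = e n" for n
      using B by (simp add: d_def e_def a_def field_simps)
    ultimately have "summable e"
      by simp
    have e: "(\<Sum>i<m. e i) = a m - a 0 + (1 - \<beta> / 2) * (\<Sum>i<m. a i)" for m
      by (induction m) (auto simp: e_def algebra_simps)
    have "e n \<ge> 0" for n
      using B d_nonneg[of n] \<open>\<And>n. exp 1 * B * d n = e n\<close>[of n, symmetric] by simp
    then have le: "(\<Sum>i<m. e i) \<le> suminf e" for m
      using \<open>summable e\<close> by (intro sum_le_suminf) auto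
    have a: "a m \<ge> 0" for m
      using KL[of m] by (simp add: a_def)
    have "(1 - \<beta> / 2) * (\<Sum>i<m. a i) \<le> suminf e + a 0" for m
      using le[of m] a[of m] unfolding e by linarith
    then have "(\<Sum>i<m. a i) \<le> (suminf e + a 0) / (1 - \<beta> / 2)" for m
      using \<beta> by (simp add: field_simps)
    moreover have "(\<Sum>i<m. real (K i) / 2 ^ i) \<le> (\<Sum>i<m. a i)" for m
      unfolding a_def by (intro sum_mono divide_right_mono KL) auto
    ultimately have "summable (\<lambda>n. real (K n) / 2 ^ n)"
      by (intro summableI_nonneg_bounded) (auto intro: order_trans)
    then show False
      using div by simp
  qed
  \<comment> \<open>At 0 all derivatives vanish, so \<open>state\<close> holds there at every scale.
    As the tails of \<open>d\<close> diverge, some starting scale n + m leaves enough distance to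
    reach t and still arrive at scale n.\<close>
  have state_t: "state n t" for n
  proof -
    have "\<exists>m. t \<le> (\<Sum>i<m. d (n + i))"
    proof (rule ccontr)
      assume "\<nexists>m. t \<le> (\<Sum>i<m. d (n + i))"
      then have "summable (\<lambda>i. d (n + i))"
        using d_nonneg by (intro summableI_nonneg_bounded[of _ t]) (auto simp: not_le less_imp_le)
      then show False
        using d_div by (simp add: add.commute[of n])
    qed
    then obtain m where "t \<le> (\<Sum>i<m. d (n + i))"
      by blast
    moreover have "state (n + m) 0"
      unfolding state_def using L_att[of "n + m"] B C zero by auto
    ultimately show ?thesis
      using walk[of n m 0 t] t by simp
  qed
  \<comment> \<open>L n / \<beta>^n is unbounded: a bound X would give K n \<le> X \<beta>^n, and
    \<beta> < 2 would dominate K n / 2^n by a convergent geometric series.\<close>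
  have small: "norm (u 0 t) \<le> C * exp (- X)" for X
  proof -
    have "\<exists>n. X \<le> L n / \<beta> ^ n"
    proof (rule ccontr)
      assume "\<nexists>n. X \<le> L n / \<beta> ^ n"
      then have "L n \<le> X * \<beta> ^ n" for n
        using \<beta> by (auto simp: not_le field_simps less_imp_le)
      then have le: "norm (real (K n) / 2 ^ n) \<le> X * (\<beta> / 2) ^ n" for n
        using order_trans[OF KL[of n]] by (simp add: power_divide divide_right_mono)
      have "summable (\<lambda>n. X * (\<beta> / 2) ^ n)"
        using \<beta> by (intro summable_mult summable_geometric) auto
      then have "summable (\<lambda>n. real (K n) / 2 ^ n)"
        by (rule summable_comparison_test') (rule le)
      then show False
        using div by simp
    qed
    then obtain n where n: "X \<le> L n / \<beta> ^ n"
      by blast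
    obtain j where j: "j \<le> n" "L n = \<beta> ^ (n - j) * K j" "norm (u 0 t) \<le> C * exp (- real (K j))"
      using state_t[of n] unfolding state_def by fastforce
    have "\<beta> ^ (n - j) * real (K j) \<le> \<beta> ^ n * K j"
      using \<beta> by (intro mult_right_mono power_increasing) auto
    then have "L n / \<beta> ^ n \<le> K j"
      using j(2) \<beta> by (simp add: pos_divide_le_eq mult.commute)
    then have "X \<le> K j"
      using n by linarith
    then have "C * exp (- real (K j)) \<le> C * exp (- X)"
      using C by (intro mult_left_mono) auto
    then show ?thesis
      using j by linarith
  qed
  have "((\<lambda>X. C * exp (- X)) \<longlongrightarrow> C * 0) at_top"
    by (intro tendsto_intros filterlim_compose[OF exp_at_bot filterlim_uminus_at_bot_at_top])
  then have "norm (u 0 t) \<le> C * 0"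
    by (rule tendsto_lowerbound) (use small in auto)
  then show ?thesis
    by simp
qed

text \<open>Divergence: over a block from N to n with S n \<ge> 2 S N + 1 the terms add up to at
  least (S n - S N) / (1 + S n) \<ge> 1/2, against Cauchy's criterion. Convergence: (1 + s n) exp (-
  S n) \<le> exp (- S (n-1)), so the terms are dominated by the differences of exp (- S n), which
  telescope.\<close>

lemma abel_dini:
  fixes s :: "nat \<Rightarrow> real"
  assumes nonneg: "\<And>n. s n \<ge> 0" and div: "\<not> summable s"
  defines "S \<equiv> \<lambda>n. \<Sum>i\<le>n. s i"
  shows "\<not> summable (\<lambda>n. s n / (1 + S n))" and "summable (\<lambda>n. s n * exp (- S n))"
proof -
  have S_nonneg: "S n \<ge> 0" for n
    by (auto simp: S_def nonneg sum_nonneg)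
  have S_mono: "m \<le> n \<Longrightarrow> S m \<le> S n" for m n
    unfolding S_def by (intro sum_mono2) (auto simp: nonneg)
  have S_unbdd: "\<exists>n. X \<le> S n" for X
  proof (rule ccontr)
    assume "\<nexists>n. X \<le> S n"
    then have "summable s"
      unfolding S_def by (intro bounded_imp_summable[of s X] nonneg) (auto simp: not_le less_imp_le)
    then show False
      using div by simp
  qed
  show "\<not> summable (\<lambda>n. s n / (1 + S n))"
  proof
    assume "summable (\<lambda>n. s n / (1 + S n))"
    then obtain N where N: "\<And>m n. m \<ge> N \<Longrightarrow> norm (sum (\<lambda>n. s n / (1 + S n)) {m..<n}) < 1 / 2"
      by (metis summable_Cauchy half_gt_zero zero_less_one)
    obtain n where n: "2 * S N + 1 \<le> S n"
      using S_unbdd by blast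
    then have "N < n"
      using S_mono[of n N] S_nonneg[of N] by (smt (verit) not_less)
    have "S n - S N = (\<Sum>i\<in>{Suc N..<Suc n}. s i)"
    proof -
      have "{..n} - {..N} = {Suc N..<Suc n}"
        by auto
      then show ?thesis
        using \<open>N < n\<close> sum_diff[of "{..n}" "{..N}" s] by (simp add: S_def)
    qed
    then have "(S n - S N) / (1 + S n) = (\<Sum>i\<in>{Suc N..<Suc n}. s i / (1 + S n))"
      by (simp only: sum_divide_distrib)
    also have "\<dots> \<le> (\<Sum>i\<in>{Suc N..<Suc n}. s i / (1 + S i))"
      using S_mono S_nonneg nonneg by (intro sum_mono divide_left_mono mult_pos_pos) (auto simp: add_pos_nonneg)
    also have "\<dots> < 1 / 2"
      using N[of "Suc N" "Suc n"] by simp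
    finally show False
      using n S_nonneg[of n] by (simp add: field_simps)
  qed
  have "(\<Sum>i\<le>n. s i * exp (- S i)) \<le> 1 - exp (- S n)" for n
  proof (induction n)
    case 0
    have "(1 + s 0) * exp (- s 0) \<le> exp (s 0) * exp (- s 0)"
      by (intro mult_right_mono exp_ge_add_one_self) auto
    then show ?case
      by (simp add: S_def algebra_simps flip: exp_add)
  next
    case (Suc n)
    have S: "S (Suc n) = S n + s (Suc n)"
      by (simp add: S_def)
    have "(1 + s (Suc n)) * exp (- S (Suc n)) \<le> exp (s (Suc n)) * exp (- S (Suc n))"
      by (intro mult_right_mono exp_ge_add_one_self) auto
    also have "\<dots> = exp (- S n)"
      by (simp add: S flip: exp_add)
    finally show ?case
      using Suc by (simp add: algebra_simps)
  qed
  then have "(\<Sum>i\<le>n. s i * exp (- S i)) \<le> 1" for n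
    by (smt (verit) exp_gt_zero)
  then show "summable (\<lambda>n. s n * exp (- S n))"
    by (intro bounded_imp_summable[of _ 1]) (auto simp: nonneg)
qed

section \<open>Convolution with cubes\<close>

text \<open>The uniform distribution on [-w, w] has the transform
  \<open>sincf (2 * pi * w * \<xi>)\<close>.\<close>

definition sincf :: "real \<Rightarrow> real" where
  "sincf x = (if x = 0 then 1 else sin x / x)"

lemma abs_sincf_le_1: "\<bar>sincf x\<bar> \<le> 1"
  using abs_sin_x_le_abs_x[of x] by (simp add: sincf_def)

lemma abs_sincf_mult_le: "\<bar>sincf x\<bar> * \<bar>x\<bar> \<le> 1"
  by (simp add: sincf_def)

lemma sincf_nonneg: "\<bar>x\<bar> \<le> pi \<Longrightarrow> 0 \<le> sincf x"
  using sin_ge_zero[of x] sin_ge_zero[of "- x"] by (cases "x \<ge> 0") (auto simp: sincf_def divide_nonpos_neg)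

lemma sincf_measurable [measurable]: "sincf \<in> borel_measurable borel"
  unfolding sincf_def by measurable

lemma integral_cis_Icc:
  assumes "w > 0"
  shows "(\<integral>s. indicator {-w..w} s *\<^sub>R cis (a * s) \<partial>lborel) = 2 * w * sincf (a * w)"
proof (cases "a = 0")
  case True
  then show ?thesis
    using assms by (simp add: sincf_def scaleR_conv_of_real)
next
  case False
  have "(\<integral>s. indicator {-w..w} s *\<^sub>R cis (a * s) \<partial>lborel) =
      cis (a * w) / (\<i> * a) - cis (a * (- w)) / (\<i> * a)"
  proof (rule integral_FTC_Icc)
    show "((\<lambda>s. cis (a * s) / (\<i> * a)) has_vector_derivative cis (a * s)) (at s within {- w..w})" for s
    proof -
      have "((\<lambda>z. exp (\<i> * a * z) / (\<i> * a)) has_field_derivative exp (\<i> * a * complex_of_real s)) (at (of_real s))"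
        using False by (auto intro!: derivative_eq_intros)
      from has_vector_derivative_real_field[OF this] show ?thesis
        by (simp add: cis_conv_exp mult.assoc)
    qed
  qed (use assms in \<open>auto intro!: continuous_intros\<close>)
  also have "\<dots> = 2 * w * sincf (a * w)"
    using False assms by (simp add: sincf_def complex_eq_iff Re_divide Im_divide power2_eq_square field_simps)
  finally show ?thesis .
qed

text \<open>Only continuity is asked: the smoothness of the final mollifier comes from the decay of
  its transform, not from its approximants.\<close>

definition bump :: "real \<Rightarrow> ('a::euclidean_space \<Rightarrow> real) \<Rightarrow> bool" where
  "bump r \<phi> \<longleftrightarrow> continuous_on UNIV \<phi> \<and> (\<forall>x. 0 \<le> \<phi> x) \<and> (\<forall>x. norm x > r \<longrightarrow> \<phi> x = 0)"

lemma bump_measurable: "bump r \<phi> \<Longrightarrow> \<phi> \<in> borel_measurable borel"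
  unfolding bump_def by (intro borel_measurable_continuous_onI) auto

lemma bump_bounded: assumes "bump r \<phi>" obtains B where "\<And>x. norm (\<phi> x) \<le> B"
proof -
  have "compact (\<phi> ` cball 0 r)"
    using assms by (intro compact_continuous_image) (auto simp: bump_def intro: continuous_on_subset)
  then obtain B where B: "\<And>x. norm x \<le> r \<Longrightarrow> norm (\<phi> x) \<le> B"
    by (metis bounded_iff compact_imp_bounded imageI mem_cball_0)
  have "norm (\<phi> x) \<le> max B 0" for x
    using B[of x] assms by (cases "norm x \<le> r") (auto simp: bump_def)
  then show ?thesis
    by (rule that)
qed

lemma integrable_cball_bounded:
  fixes f :: "'a::euclidean_space \<Rightarrow> 'b::{banach, second_countable_topology}"
  assumes "f \<in> borel_measurable borel" "\<And>x. norm (f x) \<le> B" "\<And>x. norm x > r \<Longrightarrow> f x = 0"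
  shows "integrable lborel f"
proof (rule Bochner_Integration.integrable_bound)
  show "integrable lborel (\<lambda>x. B * indicator (cball (0::'a) r) x)"
    by (intro integrable_mult_right integrable_real_indicator emeasure_lborel_cball_finite) auto
  show "AE x in lborel. norm (f x) \<le> norm (B * indicator (cball 0 r) x :: real)"
    using assms(2,3) order_trans[OF norm_ge_zero assms(2)]
    by (intro AE_I2) (auto simp: indicator_def not_le)
qed (use assms in simp)

lemma bump_integrable: assumes "bump r \<phi>" shows "integrable lborel \<phi>"
proof -
  obtain B where "\<And>x. norm (\<phi> x) \<le> B"
    using bump_bounded[OF assms] by blast
  then show ?thesis
    using assms bump_measurable[OF assms] by (intro integrable_cball_bounded[of _ B r]) (auto simp: bump_def)
qed

definition cfourier :: "('a::euclidean_space \<Rightarrow> real) \<Rightarrow> 'a \<Rightarrow> complex" where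
  "cfourier \<phi> = fourier (\<lambda>x. complex_of_real (\<phi> x))"

text \<open>\<open>\<phi>'\<close> is the convolution of \<open>\<phi>\<close> with the uniform
  distribution on the segment from -w b to w b, which enlarges the support by w and contributes its
  own transform as a factor. As \<open>\<phi>\<close> is nonnegative, absolute convergence of the
  double integral amounts to the integrability of \<open>\<phi>'\<close>.\<close>

lemma bump_average:
  fixes \<phi> :: "'a::euclidean_space \<Rightarrow> real"
  assumes \<phi>: "bump r \<phi>" and w: "w > 0" and b: "b \<in> Basis"
  shows "\<exists>\<phi>'. bump (r + w) \<phi>' \<and> (\<forall>\<xi>. cfourier \<phi>' \<xi> = cfourier \<phi> \<xi> * sincf (2 * pi * w * (\<xi> \<bullet> b)))"
proof -
  obtain B where B: "\<And>x. norm (\<phi> x) \<le> B"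
    using bump_bounded[OF \<phi>] by blast
  have [measurable]: "\<phi> \<in> borel_measurable borel"
    using bump_measurable[OF \<phi>] .
  have nonneg: "\<phi> x \<ge> 0" and supp: "norm x > r \<Longrightarrow> \<phi> x = 0" for x
    using \<phi> by (auto simp: bump_def)
  have cont: "continuous_on UNIV \<phi>"
    using \<phi> by (auto simp: bump_def)
  define \<phi>' where "\<phi>' x = (\<integral>s. indicator {-w..w} s * \<phi> (x + s *\<^sub>R b) \<partial>lborel) / (2 * w)" for x
  have intB: "integrable lborel (\<lambda>s. indicator {-w..w} s * B)"
    by (intro integrable_mult_left integrable_real_indicator) (auto simp: emeasure_lborel_Icc_eq)
  have bnd: "norm (indicator {-w..w} s * \<phi> (x + s *\<^sub>R b)) \<le> indicator {-w..w} s * B" for s x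
    using B[of "x + s *\<^sub>R b"] by (auto simp: indicator_def)
  have ints: "integrable lborel (\<lambda>s. indicator {-w..w} s * \<phi> (x + s *\<^sub>R b))" for x
  proof (rule Bochner_Integration.integrable_bound[OF intB])
    show "AE s in lborel. norm (indicator {-w..w} s * \<phi> (x + s *\<^sub>R b)) \<le> norm (indicator {-w..w} s * B)"
      using bnd[of _ x] by (intro AE_I2) (metis norm_ge_zero order_trans real_norm_def abs_of_nonneg)
  qed simp
  have "bump (r + w) \<phi>'"
    unfolding bump_def
  proof (intro conjI allI impI)
    show "continuous_on UNIV \<phi>'"
      unfolding continuous_on_sequentially
    proof (intro ballI allI impI)
      fix X :: "nat \<Rightarrow> 'a" and x
      assume "(\<forall>n. X n \<in> UNIV) \<and> X \<longlonglongrightarrow> x"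
      then have X: "X \<longlonglongrightarrow> x"
        by simp
      have "(\<lambda>n. \<integral>s. indicator {-w..w} s * \<phi> (X n + s *\<^sub>R b) \<partial>lborel) \<longlonglongrightarrow>
          (\<integral>s. indicator {-w..w} s * \<phi> (x + s *\<^sub>R b) \<partial>lborel)"
      proof (rule integral_dominated_convergence[OF _ _ intB])
        show "AE s in lborel. (\<lambda>n. indicator {-w..w} s * \<phi> (X n + s *\<^sub>R b)) \<longlonglongrightarrow> indicator {-w..w} s * \<phi> (x + s *\<^sub>R b)"
          by (intro AE_I2 tendsto_mult tendsto_const continuous_on_tendsto_compose[OF cont] tendsto_add X) auto
        show "AE s in lborel. norm (indicator {-w..w} s * \<phi> (X n + s *\<^sub>R b)) \<le> indicator {-w..w} s * B" for n
          by (intro AE_I2 bnd)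
      qed auto
      then show "(\<phi>' \<circ> X) \<longlonglongrightarrow> \<phi>' x"
        unfolding \<phi>'_def o_def using w by (intro tendsto_divide) auto
    qed
    show "0 \<le> \<phi>' x" for x
      using w nonneg by (simp add: \<phi>'_def)
    show "\<phi>' x = 0" if "norm x > r + w" for x
    proof -
      have *: "indicator {-w..w} s * \<phi> (x + s *\<^sub>R b) = 0" for s
      proof (cases "s \<in> {-w..w}")
        case True
        then have "norm (x + s *\<^sub>R b) > r"
          using that norm_triangle_ineq4[of "x + s *\<^sub>R b" "s *\<^sub>R b"] b by auto
        then show ?thesis
          by (simp add: supp)
      qed simp
      show ?thesis
        unfolding \<phi>'_def * by simp
    qed
  qed
  moreover have "cfourier \<phi>' \<xi> = cfourier \<phi> \<xi> * sincf (2 * pi * w * (\<xi> \<bullet> b))" for \<xi>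
  proof -
    let ?f = "\<lambda>x s. complex_of_real (indicator {-w..w} s * \<phi> (x + s *\<^sub>R b)) * cis (- 2 * pi * (x \<bullet> \<xi>))"
    have norm_f: "norm (?f x s) = indicator {-w..w} s * \<phi> (x + s *\<^sub>R b)" for x s
      using nonneg by (simp add: norm_mult)
    have int_f: "integrable (lborel \<Otimes>\<^sub>M lborel) (\<lambda>(x, s). ?f x s)"
    proof (rule lborel_pair.Fubini_integrable)
      show "(\<lambda>(x, s). ?f x s) \<in> borel_measurable (lborel \<Otimes>\<^sub>M lborel)"
        by measurable
      show "integrable lborel (\<lambda>x. \<integral>s. norm (case (x, s) of (x, s) \<Rightarrow> ?f x s) \<partial>lborel)"
        using integrable_mult_left[OF bump_integrable[OF \<open>bump (r + w) \<phi>'\<close>], of "2 * w"] w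
        unfolding prod.case norm_f by (simp add: \<phi>'_def)
      show "AE x in lborel. integrable lborel (\<lambda>s. case (x, s) of (x, s) \<Rightarrow> ?f x s)"
      proof (intro AE_I2)
        fix x
        show "integrable lborel (\<lambda>s. case (x, s) of (x, s) \<Rightarrow> ?f x s)"
          unfolding prod.case
          by (rule Bochner_Integration.integrable_bound[OF ints[of x]]) (auto simp: norm_mult)
      qed
    qed
    have "2 * w * cfourier \<phi>' \<xi> = (\<integral>x. complex_of_real (\<integral>s. indicator {-w..w} s * \<phi> (x + s *\<^sub>R b) \<partial>lborel) *
        cis (- 2 * pi * (x \<bullet> \<xi>)) \<partial>lborel)"
      using w by (simp add: cfourier_def fourier_def \<phi>'_def)
    also have "\<dots> = (\<integral>x. \<integral>s. ?f x s \<partial>lborel \<partial>lborel)"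
      by (simp only: integral_mult_left_zero integral_complex_of_real)
    also have "\<dots> = (\<integral>s. \<integral>x. ?f x s \<partial>lborel \<partial>lborel)"
      by (rule lborel_pair.Fubini_integral[OF int_f, symmetric])
    also have "\<dots> = (\<integral>s. cfourier \<phi> \<xi> * (indicator {-w..w} s *\<^sub>R cis ((2 * pi * (\<xi> \<bullet> b)) * s)) \<partial>lborel)"
    proof (rule Bochner_Integration.integral_cong)
      fix s :: real
      have "cfourier \<phi> \<xi> = (\<integral>x. \<phi> (s *\<^sub>R b + x) * cis (- 2 * pi * ((s *\<^sub>R b + x) \<bullet> \<xi>)) \<partial>lborel)"
        unfolding cfourier_def fourier_def by (subst integral_lborel_affine[where c=1 and t="s *\<^sub>R b"]) auto
      also have "\<dots> = cis (- 2 * pi * (s * (b \<bullet> \<xi>))) * (\<integral>x. \<phi> (x + s *\<^sub>R b) * cis (- 2 * pi * (x \<bullet> \<xi>)) \<partial>lborel)"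
        by (subst integral_mult_right_zero[symmetric])
          (auto intro!: Bochner_Integration.integral_cong simp: cis_mult inner_add_left algebra_simps)
      finally have "cfourier \<phi> \<xi> * cis ((2 * pi * (\<xi> \<bullet> b)) * s) =
          (cis ((2 * pi * (\<xi> \<bullet> b)) * s) * cis (- 2 * pi * (s * (b \<bullet> \<xi>)))) *
          (\<integral>x. \<phi> (x + s *\<^sub>R b) * cis (- 2 * pi * (x \<bullet> \<xi>)) \<partial>lborel)"
        by (simp only: mult_ac)
      also have "cis ((2 * pi * (\<xi> \<bullet> b)) * s) * cis (- 2 * pi * (s * (b \<bullet> \<xi>))) = 1"
        by (simp add: cis_mult inner_commute mult_ac)
      finally show "(\<integral>x. ?f x s \<partial>lborel) = cfourier \<phi> \<xi> * (indicator {-w..w} s *\<^sub>R cis ((2 * pi * (\<xi> \<bullet> b)) * s))"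
        by (auto simp: indicator_def)
    qed simp
    also have "\<dots> = cfourier \<phi> \<xi> * (2 * w * sincf (2 * pi * (\<xi> \<bullet> b) * w))"
      by (simp only: integral_mult_right_zero integral_cis_Icc[OF w])
    finally show ?thesis
      using w by (simp add: mult_ac)
  qed
  ultimately show ?thesis
    by blast
qed

text \<open>The transform of the uniform distribution on the cube [-w, w]^d.\<close>

definition sincs :: "real \<Rightarrow> 'a::euclidean_space \<Rightarrow> real" where
  "sincs w \<xi> = (\<Prod>b\<in>Basis. sincf (2 * pi * w * (\<xi> \<bullet> b)))"

lemma abs_sincs_le_1: "\<bar>sincs w \<xi>\<bar> \<le> 1"
  unfolding sincs_def abs_prod by (intro prod_le_1) (auto simp: abs_sincf_le_1)

lemma sincs_0 [simp]: "sincs w 0 = 1"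
  by (simp add: sincs_def sincf_def)

lemma sincs_measurable [measurable]: "sincs w \<in> borel_measurable borel"
  unfolding sincs_def[abs_def] by measurable

text \<open>Keeping only the factor of one coordinate b bounds the product by 1 / (2 pi d w |\<xi> .
  b|), and |\<xi>| is at most the sum of the d absolute coordinates. The width d w in place of w
  absorbs that sum.\<close>

lemma abs_sincs_mult_le:
  fixes \<xi> :: "'a::euclidean_space" and w :: real
  assumes "w \<ge> 0"
  shows "\<bar>sincs (DIM('a) * w) \<xi>\<bar> * (w * norm \<xi>) \<le> 1"
proof -
  let ?s = "\<lambda>b. \<bar>sincf (2 * pi * (DIM('a) * w) * (\<xi> \<bullet> b))\<bar>"
  have *: "\<bar>sincs (DIM('a) * w) \<xi>\<bar> * \<bar>\<xi> \<bullet> b\<bar> * w \<le> 1 / DIM('a)" if b: "b \<in> Basis" for b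
  proof -
    have "\<bar>sincs (DIM('a) * w) \<xi>\<bar> = ?s b * (\<Prod>b'\<in>Basis - {b}. ?s b')"
      unfolding sincs_def abs_prod using b by (subst prod.remove[of _ b]) auto
    also have "\<dots> \<le> ?s b"
      by (intro mult_left_le prod_le_1) (auto simp: abs_sincf_le_1)
    finally have "\<bar>sincs (DIM('a) * w) \<xi>\<bar> * \<bar>\<xi> \<bullet> b\<bar> * w \<le> ?s b * \<bar>\<xi> \<bullet> b\<bar> * w"
      using assms by (intro mult_right_mono) auto
    also have "\<dots> = (?s b * \<bar>2 * pi * (DIM('a) * w) * (\<xi> \<bullet> b)\<bar>) / (2 * pi * DIM('a))"
      using assms by (simp add: abs_mult)
    also have "\<dots> \<le> 1 / (2 * pi * DIM('a))"
      by (intro divide_right_mono abs_sincf_mult_le) auto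
    also have "\<dots> \<le> 1 / DIM('a)"
      using pi_ge_two by (intro divide_left_mono) (auto simp: mult_le_cancel_right1 intro: order_trans)
    finally show ?thesis .
  qed
  have "\<bar>sincs (DIM('a) * w) \<xi>\<bar> * (w * norm \<xi>) \<le> \<bar>sincs (DIM('a) * w) \<xi>\<bar> * (w * (\<Sum>b\<in>Basis. \<bar>\<xi> \<bullet> b\<bar>))"
    using assms by (intro mult_left_mono norm_le_l1) auto
  also have "\<dots> = (\<Sum>b\<in>Basis. \<bar>sincs (DIM('a) * w) \<xi>\<bar> * \<bar>\<xi> \<bullet> b\<bar> * w)"
    by (simp add: sum_distrib_left mult_ac)
  also have "\<dots> \<le> (\<Sum>b\<in>(Basis::'a set). 1 / DIM('a))"
    by (intro sum_mono *)
  also have "\<dots> = 1"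
    by simp
  finally show ?thesis .
qed

lemma bump_cube:
  fixes \<phi> :: "'a::euclidean_space \<Rightarrow> real" and w :: real
  assumes "bump r \<phi>" "w > 0"
  shows "\<exists>\<phi>'. bump (r + DIM('a) * w) \<phi>' \<and> (\<forall>\<xi>. cfourier \<phi>' \<xi> = cfourier \<phi> \<xi> * sincs w \<xi>)"
proof -
  have "\<exists>\<phi>'. bump (r + card A * w) \<phi>' \<and>
      (\<forall>\<xi>. cfourier \<phi>' \<xi> = cfourier \<phi> \<xi> * (\<Prod>b\<in>A. sincf (2 * pi * w * (\<xi> \<bullet> b))))"
    if "finite A" "A \<subseteq> Basis" for A :: "'a set"
    using that
  proof (induction A rule: finite_induct)
    case empty
    then show ?case
      using assms by auto
  next
    case (insert b A)
    then obtain \<phi>' where 1: "bump (r + card A * w) \<phi>'"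
      "\<And>\<xi>. cfourier \<phi>' \<xi> = cfourier \<phi> \<xi> * (\<Prod>b\<in>A. sincf (2 * pi * w * (\<xi> \<bullet> b)))"
      by auto
    obtain \<phi>'' where 2: "bump (r + card A * w + w) \<phi>''"
      "\<And>\<xi>. cfourier \<phi>'' \<xi> = cfourier \<phi>' \<xi> * sincf (2 * pi * w * (\<xi> \<bullet> b))"
      using bump_average[OF 1(1) assms(2), of b] insert.prems by auto
    have r: "r + card (insert b A) * w = r + card A * w + w"
      using insert.hyps by (simp add: algebra_simps)
    show ?case
      unfolding r using 1 2 insert.hyps by (intro exI[of _ \<phi>'']) (simp add: mult_ac)
  qed
  from this[OF finite_Basis subset_refl] show ?thesis
    by (simp add: sincs_def)
qed

lemma bump_cube_power:
  fixes \<phi> :: "'a::euclidean_space \<Rightarrow> real" and w :: real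
  assumes "bump r \<phi>" "w > 0"
  shows "\<exists>\<phi>'. bump (r + DIM('a) * (real k * w)) \<phi>' \<and> (\<forall>\<xi>. cfourier \<phi>' \<xi> = cfourier \<phi> \<xi> * sincs w \<xi> ^ k)"
proof (induction k)
  case 0
  then show ?case
    using assms by auto
next
  case (Suc k)
  then obtain \<phi>' where 1: "bump (r + DIM('a) * (real k * w)) \<phi>'"
    "\<And>\<xi>. cfourier \<phi>' \<xi> = cfourier \<phi> \<xi> * sincs w \<xi> ^ k"
    by auto
  obtain \<phi>'' where 2: "bump (r + DIM('a) * (real k * w) + DIM('a) * w) \<phi>''"
    "\<And>\<xi>. cfourier \<phi>'' \<xi> = cfourier \<phi>' \<xi> * sincs w \<xi>"
    using bump_cube[OF 1(1) assms(2)] by auto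
  have r: "r + DIM('a) * (real (Suc k) * w) = r + DIM('a) * (real k * w) + DIM('a) * w"
    by (simp add: algebra_simps)
  show ?case
    unfolding r using 1 2 by (intro exI[of _ \<phi>'']) (simp add: mult_ac)
qed

text \<open>The two families have different tasks: single cubes of width \<open>v j\<close> give
  decay of every polynomial order whatever the multiplicities are, while the \<open>k j\<close>
  cubes of width \<open>w j\<close> give the prescribed powers.\<close>

lemma bump_cube_seq:
  fixes \<phi> :: "'a::euclidean_space \<Rightarrow> real" and v w :: "nat \<Rightarrow> real" and k :: "nat \<Rightarrow> nat"
  assumes "bump r \<phi>" "\<And>j. v j > 0" "\<And>j. w j > 0"
  shows "\<exists>\<phi>'. bump (r + DIM('a) * (\<Sum>j<n. v j + real (k j) * w j)) \<phi>' \<and>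
    (\<forall>\<xi>. cfourier \<phi>' \<xi> = cfourier \<phi> \<xi> * (\<Prod>j<n. sincs (v j) \<xi> * sincs (w j) \<xi> ^ k j))"
proof (induction n)
  case 0
  then show ?case
    using assms by auto
next
  case (Suc n)
  let ?r = "r + DIM('a) * (\<Sum>j<n. v j + real (k j) * w j)"
  obtain \<phi>1 where 1: "bump ?r \<phi>1"
    "\<And>\<xi>. cfourier \<phi>1 \<xi> = cfourier \<phi> \<xi> * (\<Prod>j<n. sincs (v j) \<xi> * sincs (w j) \<xi> ^ k j)"
    using Suc by auto
  obtain \<phi>2 where 2: "bump (?r + DIM('a) * v n) \<phi>2" "\<And>\<xi>. cfourier \<phi>2 \<xi> = cfourier \<phi>1 \<xi> * sincs (v n) \<xi>"
    using bump_cube[OF 1(1) assms(2)[of n]] by auto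
  obtain \<phi>3 where 3: "bump (?r + DIM('a) * v n + DIM('a) * (real (k n) * w n)) \<phi>3"
    "\<And>\<xi>. cfourier \<phi>3 \<xi> = cfourier \<phi>2 \<xi> * sincs (w n) \<xi> ^ k n"
    using bump_cube_power[OF 2(1) assms(3)[of n]] by auto
  have r: "r + DIM('a) * (\<Sum>j<Suc n. v j + real (k j) * w j) = ?r + DIM('a) * v n + DIM('a) * (real (k n) * w n)"
    by (simp add: algebra_simps)
  show ?case
    unfolding r using 1 2 3 by (intro exI[of _ \<phi>3]) (simp add: mult_ac)
qed

section \<open>Derivatives of Fourier transforms\<close>

lemma norm_integral_le_integral:
  fixes f :: "'a \<Rightarrow> 'b::{banach, second_countable_topology}"
  assumes "integrable M f" "integrable M g" "\<And>x. norm (f x) \<le> g x"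
  shows "norm (integral\<^sup>L M f) \<le> integral\<^sup>L M g"
  using assms by (intro order_trans[OF integral_norm_bound integral_mono]) auto

text \<open>The inequality |exp (i \<theta>) - 1 - i \<theta>| \<le> \<theta>^2 / 2, used under the
  integral, gives a remainder of at most C |z - x|^2 with C a multiple of the second moment. This is
  where the moments up to order 2 come from.\<close>

lemma fourier_has_derivative:
  fixes G :: "'a::euclidean_space \<Rightarrow> complex"
  assumes [measurable]: "G \<in> borel_measurable borel"
    and int: "\<And>k. k \<le> 2 \<Longrightarrow> integrable lborel (\<lambda>y. norm y ^ k * norm (G y))"
  shows "(fourier G has_derivative (\<lambda>h. fourier (\<lambda>y. G y * (- 2 * pi * \<i> * (y \<bullet> h))) x)) (at x)"
proof -
  let ?D = "\<lambda>h. fourier (\<lambda>y. G y * (- 2 * pi * \<i> * (y \<bullet> h))) x"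
  define e where "e y = cis (- 2 * pi * (y \<bullet> x))" for y
  have [measurable]: "e \<in> borel_measurable borel"
    unfolding e_def[abs_def] by measurable
  have e: "norm (e y) = 1" for y
    by (simp add: e_def)
  have intG: "integrable lborel G"
    using int[of 0] by (simp add: integrable_norm_iff)
  have intD: "integrable lborel (\<lambda>y. G y * (- 2 * pi * \<i> * (y \<bullet> h)) * e y)" for h
  proof (rule Bochner_Integration.integrable_bound[of _ "\<lambda>y. 2 * pi * norm h * (norm y ^ 1 * norm (G y))"])
    show "integrable lborel (\<lambda>y. 2 * pi * norm h * (norm y ^ 1 * norm (G y)))"
      by (intro integrable_mult_right int) simp
    have "norm (G y) * \<bar>y \<bullet> h\<bar> \<le> norm (G y) * (norm y * norm h)" for y
      by (intro mult_left_mono Cauchy_Schwarz_ineq2) simp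
    then show "AE y in lborel. norm (G y * (- 2 * pi * \<i> * (y \<bullet> h)) * e y) \<le> norm (2 * pi * norm h * (norm y ^ 1 * norm (G y)))"
      by (auto simp: norm_mult e mult_ac)
  qed measurable
  have D: "?D h = (\<integral>y. G y * (- 2 * pi * \<i> * (y \<bullet> h)) * e y \<partial>lborel)" for h
    by (simp add: fourier_def e_def)
  define C where "C = (\<integral>y. 2 * pi\<^sup>2 * (norm y ^ 2 * norm (G y)) \<partial>lborel)"
  have main: "norm ((fourier G z - fourier G x) - ?D (z - x)) \<le> C * norm (z - x) ^ 2" for z
  proof -
    define h where "h = z - x"
    define \<theta> where "\<theta> y = - 2 * pi * (y \<bullet> h)" for y
    have \<theta>[measurable]: "\<theta> \<in> borel_measurable borel"
      unfolding \<theta>_def[abs_def] by measurable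
    have ez: "cis (- 2 * pi * (y \<bullet> z)) = e y * cis (\<theta> y)" for y
      by (simp add: e_def \<theta>_def h_def cis_mult algebra_simps)
    have i1: "integrable lborel (\<lambda>y. G y * (e y * cis (\<theta> y)))"
      unfolding ez[symmetric] by (intro integrable_mult_cis intG) measurable
    have i2: "integrable lborel (\<lambda>y. G y * e y)"
      unfolding e_def by (intro integrable_mult_cis intG) measurable
    have "(fourier G z - fourier G x) - ?D h = (\<integral>y. G y * (e y * cis (\<theta> y)) - G y * e y - G y * (- 2 * pi * \<i> * (y \<bullet> h)) * e y \<partial>lborel)"
      unfolding D fourier_def ez e_def[symmetric]
      by (subst Bochner_Integration.integral_diff[OF Bochner_Integration.integrable_diff[OF i1 i2] intD])
        (subst Bochner_Integration.integral_diff[OF i1 i2], rule refl)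
    also have "norm \<dots> \<le> (\<integral>y. 2 * pi\<^sup>2 * (norm y ^ 2 * norm (G y)) * (norm h)\<^sup>2 \<partial>lborel)"
    proof (rule norm_integral_le_integral)
      show "integrable lborel (\<lambda>y. G y * (e y * cis (\<theta> y)) - G y * e y - G y * (- 2 * pi * \<i> * (y \<bullet> h)) * e y)"
        by (intro Bochner_Integration.integrable_diff intD i1 i2)
      show "integrable lborel (\<lambda>y. 2 * pi\<^sup>2 * (norm y ^ 2 * norm (G y)) * (norm h)\<^sup>2)"
        by (intro integrable_mult_left integrable_mult_right int) simp
      show "norm (G y * (e y * cis (\<theta> y)) - G y * e y - G y * (- 2 * pi * \<i> * (y \<bullet> h)) * e y) \<le>
          2 * pi\<^sup>2 * (norm y ^ 2 * norm (G y)) * (norm h)\<^sup>2" for y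
      proof -
        have "G y * (e y * cis (\<theta> y)) - G y * e y - G y * (- 2 * pi * \<i> * (y \<bullet> h)) * e y =
            (G y * e y) * (cis (\<theta> y) - (1 + \<i> * \<theta> y))"
          by (simp add: \<theta>_def algebra_simps)
        then have "norm (G y * (e y * cis (\<theta> y)) - G y * e y - G y * (- 2 * pi * \<i> * (y \<bullet> h)) * e y) =
            norm (G y) * norm (cis (\<theta> y) - (1 + \<i> * \<theta> y))"
          by (simp add: norm_mult e)
        also have "\<dots> \<le> norm (G y) * (\<bar>\<theta> y\<bar>\<^sup>2 / 2)"
          using iexp_approx1[of "\<theta> y" 1]
          by (intro mult_left_mono) (simp_all add: cis_conv_exp numeral_2_eq_2)
        also have "\<dots> \<le> norm (G y) * ((2 * pi * (norm y * norm h))\<^sup>2 / 2)"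
          unfolding \<theta>_def
          by (intro mult_left_mono divide_right_mono power_mono)
            (auto simp: abs_mult intro!: mult_left_mono Cauchy_Schwarz_ineq2)
        finally show ?thesis
          by (simp add: power_mult_distrib mult_ac)
      qed
    qed
    also have "\<dots> = C * (norm h)\<^sup>2"
      by (simp add: C_def)
    finally show ?thesis
      by (simp add: h_def)
  qed
  have add: "?D (h1 + h2) = ?D h1 + ?D h2" for h1 h2
    unfolding D by (subst Bochner_Integration.integral_add[OF intD intD, symmetric])
      (simp add: inner_add_right algebra_simps)
  have scale: "?D (r *\<^sub>R h) = r *\<^sub>R ?D h" for r h
    unfolding D integral_scaleR_right[symmetric] by (simp add: scaleR_conv_of_real mult_ac)
  have "bounded_linear ?D"
  proof (rule bounded_linear_intro)
    have "norm (?D h) \<le> (\<integral>y. (2 * pi * (norm y ^ 1 * norm (G y))) * norm h \<partial>lborel)" for h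
      unfolding D
    proof (rule norm_integral_le_integral[OF intD])
      show "integrable lborel (\<lambda>y. (2 * pi * (norm y ^ 1 * norm (G y))) * norm h)"
        by (intro integrable_mult_left integrable_mult_right int) simp
      show "norm (G y * (- 2 * pi * \<i> * (y \<bullet> h)) * e y) \<le> (2 * pi * (norm y ^ 1 * norm (G y))) * norm h" for y
      proof -
        have "norm (G y * (- 2 * pi * \<i> * (y \<bullet> h)) * e y) = (2 * pi * norm (G y)) * \<bar>y \<bullet> h\<bar>"
          by (simp add: norm_mult e)
        also have "\<dots> \<le> (2 * pi * norm (G y)) * (norm y * norm h)"
          by (intro mult_left_mono Cauchy_Schwarz_ineq2) simp
        finally show ?thesis
          by (simp only: power_one_right mult_ac)
      qed
    qed
    then show "norm (?D h) \<le> norm h * (\<integral>y. (2 * pi * (norm y ^ 1 * norm (G y))) \<partial>lborel)" for h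
      by (simp add: mult.commute)
  qed (use add scale in auto)
  then show ?thesis
  proof (rule has_derivativeI_sandwich[OF zero_less_one])
    show "norm (fourier G z - fourier G x - ?D (z - x)) / norm (z - x) \<le> C * norm (z - x)" if "z \<noteq> x" for z
      using main[of z] that by (simp add: divide_le_eq power2_eq_square mult.assoc)
    have "((\<lambda>z. C * norm (z - x)) \<longlongrightarrow> C * norm (x - x)) (at x)"
      by (intro tendsto_intros)
    then show "((\<lambda>z. C * norm (z - x)) \<longlongrightarrow> 0) (at x)"
      by simp
  qed
qed

section \<open>Finite moments of all orders and smoothness of the transform\<close>

definition rapid :: "('a::euclidean_space \<Rightarrow> complex) \<Rightarrow> bool" where
  "rapid G \<longleftrightarrow> G \<in> borel_measurable borel \<and> (\<forall>k. integrable lborel (\<lambda>y. norm y ^ k * norm (G y)))"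

lemma rapid_integrable:
  assumes "rapid G"
  shows "integrable lborel G"
proof -
  have "integrable lborel (\<lambda>y. norm y ^ 0 * norm (G y))" "G \<in> borel_measurable borel"
    using assms unfolding rapid_def by blast+
  then show ?thesis
    using integrable_norm_iff[of G lborel] by simp
qed

lemma rapid_mult_inner:
  assumes "rapid G"
  shows "rapid (\<lambda>y. G y * (c * of_real (y \<bullet> h)))"
proof -
  have [measurable]: "G \<in> borel_measurable borel"
    using assms by (simp add: rapid_def)
  have "integrable lborel (\<lambda>y. norm y ^ k * norm (G y * (c * of_real (y \<bullet> h))))" for k
  proof (rule Bochner_Integration.integrable_bound[of _ "\<lambda>y. norm c * norm h * (norm y ^ Suc k * norm (G y))"])
    show "integrable lborel (\<lambda>y. norm c * norm h * (norm y ^ Suc k * norm (G y)))"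
      using assms by (intro integrable_mult_right) (simp only: rapid_def)
    have "(norm c * norm y ^ k * norm (G y)) * \<bar>y \<bullet> h\<bar> \<le> (norm c * norm y ^ k * norm (G y)) * (norm y * norm h)" for y
      by (intro mult_left_mono Cauchy_Schwarz_ineq2) simp
    then show "AE y in lborel. norm (norm y ^ k * norm (G y * (c * of_real (y \<bullet> h)))) \<le>
        norm (norm c * norm h * (norm y ^ Suc k * norm (G y)))"
      by (auto simp: norm_mult mult_ac)
  qed measurable
  then show ?thesis
    by (simp add: rapid_def)
qed

lemma rapid_fourier_has_derivative:
  "rapid G \<Longrightarrow> (fourier G has_derivative (\<lambda>h. fourier (\<lambda>y. G y * (- 2 * pi * \<i> * (y \<bullet> h))) x)) (at x)"
  by (rule fourier_has_derivative) (simp_all add: rapid_def)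

text \<open>A directional derivative of the transform is the transform of \<open>G\<close> times a
  linear form, which is again \<open>rapid\<close>; the induction therefore runs over all
  \<open>G\<close> at once.\<close>

lemma Ck_fourier: "rapid G \<Longrightarrow> Ck k (fourier G)"
proof (induction k arbitrary: G)
  case 0
  then show ?case
    by (auto intro!: differentiable_imp_continuous_on differentiable_at_imp_differentiable_on
        differentiableI rapid_fourier_has_derivative)
next
  case (Suc k)
  have "frechet_derivative (fourier G) (at x) v = fourier (\<lambda>y. G y * (- 2 * pi * \<i> * (y \<bullet> v))) x" for x v
    using frechet_derivative_at[OF rapid_fourier_has_derivative[OF Suc.prems, of x]] by metis
  then have "(\<lambda>x. frechet_derivative (fourier G) (at x) v) = fourier (\<lambda>y. G y * (- 2 * pi * \<i> * (y \<bullet> v)))" for v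
    by blast
  moreover have "fourier G differentiable_on UNIV"
    by (auto intro!: differentiable_at_imp_differentiable_on differentiableI
        rapid_fourier_has_derivative[OF Suc.prems])
  ultimately show ?case
    using Suc.IH[OF rapid_mult_inner[OF Suc.prems, of "- 2 * pi * \<i>"]] by (simp del: mult_minus_left)
qed

lemma fourier_minus:
  fixes G :: "'a::euclidean_space \<Rightarrow> complex"
  assumes [measurable]: "G \<in> borel_measurable borel"
  shows "fourier G (- x) = fourier (\<lambda>y. G (- y)) x"
  unfolding fourier_def by (subst integral_lborel_affine[where c="-1" and t=0]) auto

lemma rapid_minus:
  fixes G :: "'a::euclidean_space \<Rightarrow> complex"
  assumes "rapid G"
  shows "rapid (\<lambda>y. G (- y))"
proof -
  have [measurable]: "G \<in> borel_measurable borel"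
    using assms by (simp add: rapid_def)
  have "integrable lborel (\<lambda>y. norm y ^ k * norm (G (- y)))" for k
    using integrable_lborel_affine[of "\<lambda>y. norm y ^ k * norm (G y)" "-1" 0] assms
    by (simp add: rapid_def)
  then show ?thesis
    by (simp add: rapid_def)
qed

text \<open>From 1 + (x . b)^2 \<le> (1 + |x|)^2 for each of the d coordinates, the product of the
  one-dimensional Cauchy kernels is a majorant. This is the origin of the exponent 2 d in the
  weights below.\<close>

lemma integrable_inverse_weight:
  assumes "2 * DIM('a) \<le> M"
  shows "integrable lborel (\<lambda>x::'a::euclidean_space. 1 / (1 + norm x) ^ M)"
proof (rule Bochner_Integration.integrable_bound)
  have "integrable lborel (\<lambda>t::real. inverse (1 + t\<^sup>2))"
    using integrable_inverse_1_plus_square by (simp add: set_integrable_def)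
  then show "integrable lborel (\<lambda>x::'a. \<Prod>b\<in>Basis. inverse (1 + (x \<bullet> b)\<^sup>2))"
    by (rule integrable_lborel_prod)
  have "1 / (1 + norm x) ^ M \<le> (\<Prod>b\<in>Basis. inverse (1 + (x \<bullet> b)\<^sup>2))" for x :: 'a
  proof -
    have "(\<Prod>b\<in>Basis. 1 + (x \<bullet> b)\<^sup>2) \<le> (\<Prod>b\<in>(Basis::'a set). (1 + norm x)\<^sup>2)"
    proof (intro prod_mono conjI)
      fix b :: 'a assume "b \<in> Basis"
      then have "(x \<bullet> b)\<^sup>2 \<le> (norm x)\<^sup>2"
        using Basis_le_norm[of b x] by (metis abs_norm_cancel abs_le_square_iff)
      then show "1 + (x \<bullet> b)\<^sup>2 \<le> (1 + norm x)\<^sup>2"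
        by (simp add: power2_sum add_increasing2)
    qed simp
    also have "\<dots> = (1 + norm x) ^ (2 * DIM('a))"
      by (simp add: power_mult)
    also have "\<dots> \<le> (1 + norm x) ^ M"
      using assms by (intro power_increasing) auto
    finally have "inverse ((1 + norm x) ^ M) \<le> inverse (\<Prod>b\<in>Basis. 1 + (x \<bullet> b)\<^sup>2)"
      by (rule le_imp_inverse_le) (auto intro!: prod_pos add_pos_nonneg)
    then show ?thesis
      using prod_inversef[of "\<lambda>b. 1 + (x \<bullet> b)\<^sup>2" Basis] by (simp add: o_def inverse_eq_divide)
  qed
  then show "AE x in lborel. norm (1 / (1 + norm (x::'a)) ^ M) \<le> norm (\<Prod>b\<in>Basis. inverse (1 + (x \<bullet> b)\<^sup>2))"
    by (intro AE_I2) (auto simp: abs_prod)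
qed measurable

section \<open>Mollifiers\<close>

lemma prod_le_prod_subset:
  fixes f :: "'a \<Rightarrow> real"
  assumes "finite A" "B \<subseteq> A" "\<And>a. a \<in> A \<Longrightarrow> 0 \<le> f a \<and> f a \<le> 1"
  shows "prod f A \<le> prod f B"
proof -
  have "prod f A = prod f (A - B) * prod f B"
    using assms by (intro prod.subset_diff) auto
  also have "\<dots> \<le> 1 * prod f B"
    using assms by (intro mult_right_mono prod_le_1 prod_nonneg) auto
  finally show ?thesis
    by simp
qed

text \<open>From some index on the factors lie in [0, 1] and the products decrease; the earlier
  factors contribute a constant. The limit may be 0, so only the sequence of partial products is
  claimed to converge.\<close>

lemma convergent_prod_unit_interval:
  fixes f :: "nat \<Rightarrow> real"
  assumes le: "\<And>j. \<bar>f j\<bar> \<le> 1" and nonneg: "eventually (\<lambda>j. 0 \<le> f j) sequentially"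
  shows "convergent (\<lambda>n. \<Prod>j<n. f j)"
proof -
  obtain N where N: "\<And>j. j \<ge> N \<Longrightarrow> 0 \<le> f j"
    using nonneg by (auto simp: eventually_sequentially)
  have eq: "(\<Prod>j<n + N. f j) = (\<Prod>j<N. f j) * (\<Prod>j<n. f (N + j))" for n
    by (induction n) (simp_all add: mult_ac add.commute[of N])
  have "decseq (\<lambda>n. \<Prod>j<n. f (N + j))"
    unfolding decseq_Suc_iff
    using le N by (auto intro!: mult_left_le prod_nonneg simp: abs_le_iff)
  then have "convergent (\<lambda>n. \<Prod>j<n. f (N + j))"
    by (rule decseq_convergent[of _ 0]) (auto intro!: prod_nonneg N simp: convergent_def)
  then have "convergent (\<lambda>n. \<Prod>j<n + N. f j)"
    unfolding eq by (intro convergent_mult convergent_const)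
  then show ?thesis
    using convergent_ignore_initial_segment[of "\<lambda>n. \<Prod>j<n. f j" N] by simp
qed

lemma sincs_nonneg:
  fixes \<xi> :: "'a::euclidean_space"
  assumes "0 \<le> w" "w * norm \<xi> \<le> 1 / 2"
  shows "0 \<le> sincs w \<xi>"
  unfolding sincs_def
proof (intro prod_nonneg sincf_nonneg)
  fix b :: 'a assume "b \<in> Basis"
  then have "w * \<bar>\<xi> \<bullet> b\<bar> \<le> w * norm \<xi>"
    using assms by (intro mult_left_mono Basis_le_norm) auto
  then have "(2 * pi) * (w * \<bar>\<xi> \<bullet> b\<bar>) \<le> (2 * pi) * (1 / 2)"
    using assms by (intro mult_left_mono) auto
  then show "\<bar>2 * pi * w * (\<xi> \<bullet> b)\<bar> \<le> pi"
    using assms by (simp add: abs_mult mult_ac)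
qed

text \<open>The tent of height r divided by its mass. The mass is positive because a continuous
  function that vanishes almost everywhere vanishes everywhere, in particular at 0.\<close>

lemma exists_normalized_bump:
  assumes "r > 0"
  obtains \<phi> :: "'a::euclidean_space \<Rightarrow> real" where "bump r \<phi>" "(\<integral>x. \<phi> x \<partial>lborel) = 1"
proof -
  define t where "t x = max 0 (r - norm x)" for x :: 'a
  have t: "bump r t"
    by (auto simp: bump_def t_def intro!: continuous_intros)
  have "(\<integral>x. t x \<partial>lborel) \<noteq> 0"
  proof
    assume "(\<integral>x. t x \<partial>lborel) = 0"
    then have "AE x in lborel. t x = 0"
      using integral_nonneg_eq_0_iff_AE[OF bump_integrable[OF t]] t by (auto simp: bump_def)
    then have "AE x in lebesgue. x \<in> {x. t x = 0}"
      by (simp add: AE_completion)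
    moreover have "closed {x. t x = 0}"
      using t by (intro closed_Collect_eq) (auto simp: bump_def)
    ultimately have "(0::'a) \<in> {x. t x = 0}"
      by (intro mem_closed_if_AE_lebesgue)
    then show False
      using assms by (simp add: t_def)
  qed
  moreover have "(\<integral>x. t x \<partial>lborel) \<ge> 0"
    using t by (intro integral_nonneg_AE) (auto simp: bump_def)
  ultimately have pos: "(\<integral>x. t x \<partial>lborel) > 0"
    by simp
  show ?thesis
  proof (rule that)
    show "bump r (\<lambda>x. t x / (\<integral>x. t x \<partial>lborel))"
      using t pos by (auto simp: bump_def intro!: continuous_intros)
    show "(\<integral>x. t x / (\<integral>x. t x \<partial>lborel) \<partial>lborel) = 1"
      using pos by simp
  qed
qed

lemma cfourier_0: "cfourier \<phi> 0 = of_real (\<integral>x. \<phi> x \<partial>lborel)"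
  by (simp add: cfourier_def fourier_def)

lemma norm_cfourier_le: "bump r \<phi> \<Longrightarrow> norm (cfourier \<phi> \<xi>) \<le> (\<integral>x. \<phi> x \<partial>lborel)"
  using norm_fourier_le[of "\<lambda>x. complex_of_real (\<phi> x)" \<xi>] bump_integrable[of r \<phi>]
  by (simp add: cfourier_def bump_def)

lemma cfourier_measurable [measurable]: "bump r \<phi> \<Longrightarrow> cfourier \<phi> \<in> borel_measurable borel"
  unfolding cfourier_def using bump_measurable[of r \<phi>] by measurable

text \<open>The finite products \<open>\<Theta> n\<close> are transforms of genuine bumps
  \<open>\<phi>s n\<close>, with decay uniform in n once enough factors of the \<open>v\<close>
  family are present. Inversion for \<open>\<phi>s n\<close> passes to the limit by dominated
  convergence; the limit inherits support and sign from the approximants, and its smoothness is read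
  off from the decay of \<open>T\<close>.\<close>

theorem mollifier:
  fixes k :: "nat \<Rightarrow> nat" and w :: "nat \<Rightarrow> real"
  assumes w: "\<And>j. w j > 0" and sum: "summable (\<lambda>j. real (k j) * w j)" and \<delta>: "\<delta> > 0"
  obtains \<phi> :: "'a::euclidean_space \<Rightarrow> real"
  where "bump \<delta> \<phi>" "smooth_compact_support (\<lambda>x. complex_of_real (\<phi> x))"
    "(\<integral>x. \<phi> x \<partial>lborel) = 1"
    "\<And>x. complex_of_real (\<phi> x) = fourier (cfourier \<phi>) (- x)"
    "\<And>M. \<exists>C. \<forall>\<xi>. norm (cfourier \<phi> \<xi>) * (1 + norm \<xi>) ^ M \<le> C"
    "\<And>M. \<exists>C. \<forall>\<xi> j. norm (cfourier \<phi> \<xi>) * (1 + norm \<xi>) ^ M * (w j * norm \<xi>) ^ k j \<le> C"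
proof -
  define d where "d = real DIM('a)"
  have d: "d > 0" by (simp add: d_def)
  \<comment> \<open>One factor d is the growth of the radius by d times the width of a cube, the
    other comes from the width d w that \<open>abs_sincs_mult_le\<close> asks for.\<close>
  define D where "D = d * d"
  have D: "D > 0" using d by (simp add: D_def)
  obtain J where J: "norm (\<Sum>i. real (k (i + J)) * w (i + J)) < \<delta> / (3 * D)"
    using suminf_exist_split[OF _ sum, of "\<delta> / (3 * D)"] \<delta> D by auto
  \<comment> \<open>Only the cubes with index at least \<open>J\<close> fit into the support; the finitely many powers lost
    in this way are recovered from the rapid decay supplied by the extra widths \<open>v j\<close>.\<close>
  define \<epsilon> where "\<epsilon> = \<delta> / (6 * D)"
  have \<epsilon>: "\<epsilon> > 0" using \<delta> D by (simp add: \<epsilon>_def)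
  define v where "v j = d * (\<epsilon> / 2 ^ j)" for j :: nat
  define w' where "w' j = d * w (j + J)" for j
  define k' where "k' j = k (j + J)" for j
  have v_pos: "v j > 0" and w'_pos: "w' j > 0" for j
    using d \<epsilon> w by (auto simp: v_def w'_def)
  \<comment> \<open>The radius is shared in thirds: \<delta>/3 for the initial bump, at most 2 D
    \<epsilon> = \<delta>/3 for the \<open>v\<close> cubes, and at most \<delta>/3 for the
    \<open>w'\<close> cubes.\<close>
  have radius: "\<delta> / 3 + d * (\<Sum>j<n. v j + real (k' j) * w' j) \<le> \<delta>" for n
  proof -
    have "(\<Sum>j<n. (1/2::real) ^ j) \<le> 2"
      using sum_le_suminf[of "\<lambda>j. (1/2::real) ^ j" "{..<n}"] suminf_geometric[of "1/2::real"]
      by (auto simp: summable_geometric)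
    then have "\<epsilon> * (\<Sum>j<n. (1/2::real) ^ j) \<le> \<epsilon> * 2"
      using \<epsilon> by (intro mult_left_mono) auto
    moreover have "summable (\<lambda>i. real (k (i + J)) * w (i + J))"
      using sum by (rule summable_ignore_initial_segment)
    then have "(\<Sum>j<n. real (k (j + J)) * w (j + J)) \<le> (\<Sum>i. real (k (i + J)) * w (i + J))"
      using w by (intro sum_le_suminf) (auto simp: less_imp_le)
    ultimately have "\<epsilon> * (\<Sum>j<n. (1/2::real) ^ j) + (\<Sum>j<n. real (k (j + J)) * w (j + J)) \<le> \<epsilon> * 2 + \<delta> / (3 * D)"
      using J by simp
    then have "D * (\<epsilon> * (\<Sum>j<n. (1/2::real) ^ j) + (\<Sum>j<n. real (k (j + J)) * w (j + J))) \<le> D * (\<epsilon> * 2 + \<delta> / (3 * D))"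
      using D by (intro mult_left_mono) auto
    also have "\<dots> = 2 * \<delta> / 3"
      using D by (simp add: \<epsilon>_def field_simps)
    also have "D * (\<epsilon> * (\<Sum>j<n. (1/2::real) ^ j) + (\<Sum>j<n. real (k (j + J)) * w (j + J))) =
        d * (\<Sum>j<n. v j + real (k' j) * w' j)"
      by (simp add: D_def v_def w'_def k'_def sum_distrib_left sum.distrib power_divide distrib_left mult_ac)
    finally show ?thesis
      by simp
  qed

  obtain \<phi>0 :: "'a \<Rightarrow> real" where \<phi>0: "bump (\<delta> / 3) \<phi>0" "(\<integral>x. \<phi>0 x \<partial>lborel) = 1"
    using exists_normalized_bump[of "\<delta> / 3"] \<delta> by auto
  define f where "f j \<xi> = sincs (v j) \<xi> * sincs (w' j) \<xi> ^ k' j" for j and \<xi> :: 'a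
  define P where "P n \<xi> = (\<Prod>j<n. f j \<xi>)" for n \<xi>
  define \<Theta> where "\<Theta> n \<xi> = cfourier \<phi>0 \<xi> * P n \<xi>" for n \<xi>
  have abs_f: "\<bar>f j \<xi>\<bar> \<le> 1" for j \<xi>
    unfolding f_def abs_mult power_abs by (intro mult_le_one power_le_one abs_sincs_le_1) auto

  have "\<exists>\<phi>. bump \<delta> \<phi> \<and> cfourier \<phi> = \<Theta> n" for n
  proof -
    obtain \<phi> where 1: "bump (\<delta> / 3 + d * (\<Sum>j<n. v j + real (k' j) * w' j)) \<phi>" "\<And>\<xi>. cfourier \<phi> \<xi> = \<Theta> n \<xi>"
      using bump_cube_seq[where v=v and w=w' and k=k' and n=n, OF \<phi>0(1) v_pos w'_pos]
      unfolding \<Theta>_def P_def f_def d_def by auto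
    then have "bump \<delta> \<phi>"
      using radius[of n] by (auto simp: bump_def)
    then show ?thesis
      using 1(2) by auto
  qed
  then obtain \<phi>s where \<phi>s: "\<And>n. bump \<delta> (\<phi>s n)" "\<And>n. cfourier (\<phi>s n) = \<Theta> n"
    by metis

  \<comment> \<open>All factors are at most 1 in absolute value, so any of them may be dropped: M of
    the \<open>v\<close> factors pay for a polynomial weight, those in \<open>A\<close> for a
    prescribed power.\<close>
  have P_le: "\<bar>P n \<xi>\<bar> \<le> (\<Prod>j<M. \<bar>sincs (v j) \<xi>\<bar>) * (\<Prod>j\<in>A. \<bar>sincs (w' j) \<xi>\<bar> ^ k' j)"
    if "M \<le> n" "A \<subseteq> {..<n}" for M n A \<xi>
  proof -
    have "\<bar>P n \<xi>\<bar> = (\<Prod>j<n. \<bar>sincs (v j) \<xi>\<bar>) * (\<Prod>j<n. \<bar>sincs (w' j) \<xi>\<bar> ^ k' j)"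
      by (simp add: P_def f_def abs_prod abs_mult power_abs prod.distrib)
    also have "\<dots> \<le> (\<Prod>j<M. \<bar>sincs (v j) \<xi>\<bar>) * (\<Prod>j\<in>A. \<bar>sincs (w' j) \<xi>\<bar> ^ k' j)"
      using that by (intro mult_mono prod_le_prod_subset prod_nonneg)
        (auto simp: abs_sincs_le_1 power_le_one)
    finally show ?thesis .
  qed
  define a where "a j = 1 + 2 ^ j / \<epsilon>" for j :: nat
  have s_le: "\<bar>sincs (v j) \<xi>\<bar> * (1 + norm \<xi>) \<le> a j" for j and \<xi> :: 'a
  proof -
    have "\<bar>sincs (v j) \<xi>\<bar> * (\<epsilon> / 2 ^ j * norm \<xi>) \<le> 1"
      using abs_sincs_mult_le[of "\<epsilon> / 2 ^ j" \<xi>] \<epsilon> by (simp add: v_def d_def)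
    then have "\<bar>sincs (v j) \<xi>\<bar> * norm \<xi> \<le> 2 ^ j / \<epsilon>"
      using \<epsilon> by (simp add: field_simps)
    then show ?thesis
      using abs_sincs_le_1[of "v j" \<xi>] by (simp add: a_def distrib_left)
  qed
  have prod_s_le: "(\<Prod>j<M. \<bar>sincs (v j) \<xi>\<bar>) * (1 + norm \<xi>) ^ M \<le> (\<Prod>j<M. a j)" for M and \<xi> :: 'a
  proof -
    have "(\<Prod>j<M. \<bar>sincs (v j) \<xi>\<bar>) * (1 + norm \<xi>) ^ M = (\<Prod>j<M. \<bar>sincs (v j) \<xi>\<bar> * (1 + norm \<xi>))"
      by (simp add: prod.distrib)
    also have "\<dots> \<le> (\<Prod>j<M. a j)"
      by (intro prod_mono conjI s_le) simp
    finally show ?thesis .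
  qed
  have \<phi>0_le: "norm (cfourier \<phi>0 \<xi>) \<le> 1" for \<xi>
    using norm_cfourier_le[OF \<phi>0(1), of \<xi>] \<phi>0(2) by simp
  have \<Theta>_decay: "norm (\<Theta> n \<xi>) * (1 + norm \<xi>) ^ M \<le> (\<Prod>j<M. a j)" if "M \<le> n" for M n \<xi>
  proof -
    have "norm (\<Theta> n \<xi>) * (1 + norm \<xi>) ^ M = norm (cfourier \<phi>0 \<xi>) * (\<bar>P n \<xi>\<bar> * (1 + norm \<xi>) ^ M)"
      by (simp add: \<Theta>_def norm_mult)
    also have "\<dots> \<le> 1 * ((\<Prod>j<M. \<bar>sincs (v j) \<xi>\<bar>) * (1 + norm \<xi>) ^ M)"
      using P_le[OF that, of "{}" \<xi>] \<phi>0_le[of \<xi>] by (intro mult_mono) auto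
    also have "\<dots> \<le> (\<Prod>j<M. a j)"
      using prod_s_le[where M=M] by simp
    finally show ?thesis .
  qed
  have \<Theta>_decay_w: "norm (\<Theta> n \<xi>) * (1 + norm \<xi>) ^ M * (w (i + J) * norm \<xi>) ^ k (i + J) \<le> (\<Prod>j<M. a j)"
    if "M \<le> n" "i < n" for M n i \<xi>
  proof -
    define s where "s = \<bar>sincs (w' i) \<xi>\<bar>"
    have s: "s * (w (i + J) * norm \<xi>) \<le> 1" "s \<ge> 0"
      using abs_sincs_mult_le[of "w (i + J)" \<xi>] w[of "i + J"] by (auto simp: s_def w'_def d_def)
    have "norm (\<Theta> n \<xi>) * (1 + norm \<xi>) ^ M * (w (i + J) * norm \<xi>) ^ k (i + J) =
        norm (cfourier \<phi>0 \<xi>) * (\<bar>P n \<xi>\<bar> * ((1 + norm \<xi>) ^ M * (w (i + J) * norm \<xi>) ^ k (i + J)))"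
      by (simp add: \<Theta>_def norm_mult)
    also have "\<dots> \<le> 1 * (((\<Prod>j<M. \<bar>sincs (v j) \<xi>\<bar>) * s ^ k' i) * ((1 + norm \<xi>) ^ M * (w (i + J) * norm \<xi>) ^ k (i + J)))"
      using P_le[OF that(1), of "{i}" \<xi>] \<phi>0_le[of \<xi>] that(2) w[of "i + J"]
      by (intro mult_mono) (auto simp: s_def)
    also have "\<dots> = ((\<Prod>j<M. \<bar>sincs (v j) \<xi>\<bar>) * (1 + norm \<xi>) ^ M) * (s * (w (i + J) * norm \<xi>)) ^ k (i + J)"
      by (simp add: k'_def power_mult_distrib mult_ac)
    also have "\<dots> \<le> (\<Prod>j<M. a j) * 1"
      using prod_s_le[where M=M and \<xi>=\<xi>] s w[of "i + J"]
      by (intro mult_mono power_le_one mult_nonneg_nonneg zero_le_power prod_nonneg) (auto simp: less_imp_le a_def \<epsilon>)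
    finally show ?thesis
      by simp
  qed

  have "convergent (\<lambda>n. P n \<xi>)" for \<xi>
    unfolding P_def
  proof (rule convergent_prod_unit_interval[OF abs_f])
    have "(\<lambda>j. (1/2::real) ^ j) \<longlonglongrightarrow> 0"
      by (rule LIMSEQ_power_zero) simp
    from tendsto_mult_left[OF this, of "d * \<epsilon> * norm \<xi>"]
    have 1: "(\<lambda>j. v j * norm \<xi>) \<longlonglongrightarrow> 0"
      by (simp add: v_def power_divide mult_ac)
    have "(\<lambda>j. real (k (j + J)) * w (j + J)) \<longlonglongrightarrow> 0"
      using sum by (intro LIMSEQ_ignore_initial_segment summable_LIMSEQ_zero)
    from tendsto_mult_left[OF this, of "d * norm \<xi>"]
    have 2: "(\<lambda>j. real (k' j) * w' j * norm \<xi>) \<longlonglongrightarrow> 0"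
      by (simp add: k'_def w'_def mult_ac)
    have "eventually (\<lambda>j. v j * norm \<xi> < 1 / 2) sequentially"
      "eventually (\<lambda>j. real (k' j) * w' j * norm \<xi> < 1 / 2) sequentially"
      by (rule order_tendstoD(2)[OF 1] order_tendstoD(2)[OF 2]; simp)+
    then show "eventually (\<lambda>j. 0 \<le> f j \<xi>) sequentially"
    proof eventually_elim
      case (elim j)
      \<comment> \<open>The widths \<open>w' j\<close> alone need not tend to 0. Only the products
        \<open>k' j * w' j\<close> do, so where the width is not small \<open>k' j\<close> must be 0
        and the factor is 1.\<close>
      have "0 \<le> sincs (w' j) \<xi> ^ k' j"
      proof (cases "k' j = 0")
        case False
        then have "1 * (w' j * norm \<xi>) \<le> real (k' j) * (w' j * norm \<xi>)"
          using w'_pos[of j] by (intro mult_right_mono) auto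
        then have "w' j * norm \<xi> \<le> 1 / 2"
          using elim(2) unfolding mult.assoc by linarith
        then show ?thesis
          using w'_pos[of j] by (intro zero_le_power sincs_nonneg) auto
      qed simp
      then show ?case
        unfolding f_def using elim v_pos[of j] by (intro mult_nonneg_nonneg sincs_nonneg) auto
    qed
  qed
  then obtain Pinf where Pinf: "\<And>\<xi>. (\<lambda>n. P n \<xi>) \<longlonglongrightarrow> Pinf \<xi>"
    unfolding convergent_def by metis
  define T where "T \<xi> = cfourier \<phi>0 \<xi> * Pinf \<xi>" for \<xi>
  have \<Theta>_lim: "(\<lambda>n. \<Theta> n \<xi>) \<longlonglongrightarrow> T \<xi>" for \<xi>
    unfolding \<Theta>_def T_def by (intro tendsto_intros Pinf)
  have \<Theta>_meas [measurable]: "\<Theta> n \<in> borel_measurable borel" for n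
    using cfourier_measurable[OF \<phi>s(1), of n] \<phi>s(2)[of n] by simp
  have T_meas [measurable]: "T \<in> borel_measurable borel"
    by (rule borel_measurable_LIMSEQ_metric[OF \<Theta>_meas \<Theta>_lim])
  have T_decay: "norm (T \<xi>) * (1 + norm \<xi>) ^ M \<le> (\<Prod>j<M. a j)" for M \<xi>
    by (rule tendsto_upperbound[of "\<lambda>n. norm (\<Theta> n \<xi>) * (1 + norm \<xi>) ^ M" _ sequentially])
      (auto intro!: tendsto_intros \<Theta>_lim eventually_sequentiallyI[of M] \<Theta>_decay)
  have T_decay_w: "norm (T \<xi>) * (1 + norm \<xi>) ^ M * (w (i + J) * norm \<xi>) ^ k (i + J) \<le> (\<Prod>j<M. a j)" for M i \<xi>
    by (rule tendsto_upperbound[of "\<lambda>n. norm (\<Theta> n \<xi>) * (1 + norm \<xi>) ^ M * (w (i + J) * norm \<xi>) ^ k (i + J)" _ sequentially])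
      (auto intro!: tendsto_intros \<Theta>_lim eventually_sequentiallyI[of "max M (Suc i)"] \<Theta>_decay_w)
  have a_prod: "(\<Prod>j<M. a j) \<ge> 0" for M
    using \<epsilon> by (intro prod_nonneg) (auto simp: a_def)

  \<comment> \<open>Decay of order 2 d makes \<open>W\<close> integrable; from index m on, all the
    \<open>\<Theta>\<close> have that decay with the same constant.\<close>
  define m where "m = 2 * DIM('a)"
  define W where "W \<xi> = (\<Prod>j<m. a j) * (1 / (1 + norm \<xi>) ^ m)" for \<xi> :: 'a
  have W_int: "integrable lborel W"
    unfolding W_def by (intro integrable_mult_right integrable_inverse_weight) (simp add: m_def)
  have le_W: "norm (\<Theta> (n + m) \<xi>) \<le> W \<xi>" for n \<xi>
    using \<Theta>_decay[of m "n + m" \<xi>] by (simp add: W_def field_simps add_pos_nonneg)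
  have \<Theta>_int: "integrable lborel (\<Theta> (n + m))" for n
    by (rule Bochner_Integration.integrable_bound[OF W_int]) (auto intro!: order_trans[OF le_W])
  have T_rapid: "rapid T"
    unfolding rapid_def
  proof (intro conjI allI T_meas)
    fix n
    show "integrable lborel (\<lambda>y. norm y ^ n * norm (T y))"
    proof (rule Bochner_Integration.integrable_bound)
      show "integrable lborel (\<lambda>y::'a. (\<Prod>j<m + n. a j) * (1 / (1 + norm y) ^ m))"
        by (intro integrable_mult_right integrable_inverse_weight) (simp add: m_def)
      have "norm y ^ n * norm (T y) \<le> (\<Prod>j<m + n. a j) * (1 / (1 + norm y) ^ m)" for y
      proof -
        have "norm y ^ n * norm (T y) * (1 + norm y) ^ m \<le> (1 + norm y) ^ n * norm (T y) * (1 + norm y) ^ m"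
          by (intro mult_right_mono power_mono) auto
        also have "\<dots> \<le> (\<Prod>j<m + n. a j)"
          using T_decay[of y "m + n"] by (simp add: power_add mult_ac)
        finally show ?thesis
          by (simp add: field_simps add_pos_nonneg)
      qed
      then show "AE y in lborel. norm (norm y ^ n * norm (T y)) \<le> norm ((\<Prod>j<m + n. a j) * (1 / (1 + norm y) ^ m))"
        using a_prod by (intro AE_I2) (auto simp: abs_mult)
    qed measurable
  qed

  have inv: "complex_of_real (\<phi>s (n + m) x) = fourier (\<Theta> (n + m)) (- x)" for n x
  proof -
    obtain B where B: "\<And>x. norm (\<phi>s (n + m) x) \<le> B"
      using bump_bounded[OF \<phi>s(1)] by blast
    have "complex_of_real (\<phi>s (n + m) x) = fourier (fourier (\<lambda>x. complex_of_real (\<phi>s (n + m) x))) (- x)"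
    proof (rule fourier_inversion)
      show "integrable lborel (\<lambda>x. complex_of_real (\<phi>s (n + m) x))"
        using bump_integrable[OF \<phi>s(1)] by simp
      show "continuous_on UNIV (\<lambda>x. complex_of_real (\<phi>s (n + m) x))"
        using \<phi>s(1)[of "n + m"] by (auto simp: bump_def intro!: continuous_intros)
      show "norm (complex_of_real (\<phi>s (n + m) x)) \<le> B" for x
        using B by simp
      show "integrable lborel (fourier (\<lambda>x. complex_of_real (\<phi>s (n + m) x)))"
        using \<Theta>_int[of n] \<phi>s(2)[of "n + m"] by (simp add: cfourier_def)
    qed
    then show ?thesis
      using \<phi>s(2)[of "n + m"] by (simp add: cfourier_def)
  qed
  have lim: "(\<lambda>n. complex_of_real (\<phi>s (n + m) x)) \<longlonglongrightarrow> fourier T (- x)" for x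
    unfolding inv fourier_def
    by (rule integral_dominated_convergence[where w=W])
      (auto simp: norm_mult W_int le_W intro!: tendsto_intros LIMSEQ_ignore_initial_segment[OF \<Theta>_lim])
  \<comment> \<open>The limit of the real functions \<open>\<phi>s\<close> is real, so taking the
    real part loses nothing.\<close>
  define \<phi> where "\<phi> x = Re (fourier T (- x))" for x
  have lim_\<phi>: "(\<lambda>n. \<phi>s (n + m) x) \<longlonglongrightarrow> \<phi> x" for x
    using tendsto_Re[OF lim[of x]] by (simp add: \<phi>_def)
  have \<phi>_eq: "complex_of_real (\<phi> x) = fourier T (- x)" for x
    by (rule LIMSEQ_unique[OF tendsto_of_real[OF lim_\<phi>] lim])
  have \<phi>_eq': "(\<lambda>x. complex_of_real (\<phi> x)) = fourier (\<lambda>y. T (- y))"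
    by (simp add: fun_eq_iff \<phi>_eq fourier_minus)
  have Ck_\<phi>: "Ck n (\<lambda>x. complex_of_real (\<phi> x))" for n
    unfolding \<phi>_eq' by (intro Ck_fourier rapid_minus T_rapid)
  have supp: "\<phi> x = 0" if "norm x > \<delta>" for x
    using that \<phi>s(1) lim_\<phi>[of x] by (simp add: bump_def LIMSEQ_const_iff)
  have bump_\<phi>: "bump \<delta> \<phi>"
    unfolding bump_def
  proof (intro conjI allI impI supp)
    show "continuous_on UNIV \<phi>"
      using Ck_\<phi>[of 0] by simp
    show "0 \<le> \<phi> x" for x
      using \<phi>s(1) by (intro LIMSEQ_le_const[OF lim_\<phi>]) (auto simp: bump_def)
  qed

  \<comment> \<open>So far \<open>T\<close> is just a limit of transforms. It is the transform of
    the limit function by dominated convergence, with a common bound \<open>B\<close> on the common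
    support \<open>cball 0 \<delta>\<close>.\<close>
  have "(\<lambda>n. cfourier (\<phi>s (n + m)) \<xi>) \<longlonglongrightarrow> cfourier \<phi> \<xi>" for \<xi>
    unfolding cfourier_def fourier_def
  proof (rule integral_dominated_convergence)
    define B where "B = (\<integral>\<xi>. W \<xi> \<partial>lborel)"
    have B: "norm (\<phi>s (n + m) x) \<le> B" for n x
    proof -
      have "norm (\<phi>s (n + m) x) = norm (fourier (\<Theta> (n + m)) (- x))"
        by (simp flip: inv)
      also have "\<dots> \<le> (\<integral>\<xi>. norm (\<Theta> (n + m) \<xi>) \<partial>lborel)"
        by (intro norm_fourier_le \<Theta>_int)
      also have "\<dots> \<le> B"
        unfolding B_def by (intro integral_mono integrable_norm \<Theta>_int W_int le_W)
      finally show ?thesis .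
    qed
    show "integrable lborel (\<lambda>x. B * indicator (cball (0::'a) \<delta>) x)"
      by (intro integrable_mult_right integrable_real_indicator emeasure_lborel_cball_finite) auto
    show "AE x in lborel. norm (complex_of_real (\<phi>s (n + m) x) * cis (- 2 * pi * (x \<bullet> \<xi>))) \<le> B * indicator (cball 0 \<delta>) x" for n
      using B[of n] \<phi>s(1)[of "n + m"] by (intro AE_I2) (auto simp: norm_mult indicator_def bump_def)
    show "AE x in lborel. (\<lambda>n. complex_of_real (\<phi>s (n + m) x) * cis (- 2 * pi * (x \<bullet> \<xi>))) \<longlonglongrightarrow>
        complex_of_real (\<phi> x) * cis (- 2 * pi * (x \<bullet> \<xi>))"
      by (intro AE_I2 tendsto_intros lim_\<phi>)
    show "(\<lambda>x. complex_of_real (\<phi> x) * cis (- 2 * pi * (x \<bullet> \<xi>))) \<in> borel_measurable lborel"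
      using bump_measurable[OF bump_\<phi>] by measurable
    show "(\<lambda>x. complex_of_real (\<phi>s (n + m) x) * cis (- 2 * pi * (x \<bullet> \<xi>))) \<in> borel_measurable lborel" for n
      using bump_measurable[OF \<phi>s(1)] by measurable
  qed
  then have "cfourier \<phi> \<xi> = T \<xi>" for \<xi>
    unfolding \<phi>s(2) using LIMSEQ_ignore_initial_segment[OF \<Theta>_lim] LIMSEQ_unique by blast
  then have T: "cfourier \<phi> = T"
    by auto

  show ?thesis
  proof (rule that[OF bump_\<phi>])
    show "smooth_compact_support (\<lambda>x. complex_of_real (\<phi> x))"
      unfolding smooth_compact_support_def
    proof (intro conjI allI Ck_\<phi>)
      have "{x. complex_of_real (\<phi> x) \<noteq> 0} \<subseteq> cball 0 \<delta>"
        using supp by (force simp: not_less[symmetric])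
      then show "compact (closure {x. complex_of_real (\<phi> x) \<noteq> 0})"
        unfolding compact_closure using bounded_subset[OF bounded_cball] by blast
    qed
    have "P n 0 = 1" for n
      by (simp add: P_def f_def)
    then have "Pinf 0 = 1"
      using Pinf[of 0] by (simp add: LIMSEQ_const_iff)
    then have "T 0 = 1"
      by (simp add: T_def cfourier_0 \<phi>0(2))
    then show "(\<integral>x. \<phi> x \<partial>lborel) = 1"
      using cfourier_0[of \<phi>] T by (metis of_real_1 of_real_eq_iff)
    show "complex_of_real (\<phi> x) = fourier (cfourier \<phi>) (- x)" for x
      unfolding T by (rule \<phi>_eq)
    show "\<exists>C. \<forall>\<xi>. norm (cfourier \<phi> \<xi>) * (1 + norm \<xi>) ^ M \<le> C" for M
      unfolding T using T_decay by blast
    show "\<exists>C. \<forall>\<xi> j. norm (cfourier \<phi> \<xi>) * (1 + norm \<xi>) ^ M * (w j * norm \<xi>) ^ k j \<le> C" for M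
    proof -
      define b where "b j = w j ^ k j * (\<Prod>i<M + k j. a i)" for j
      have b: "b j \<ge> 0" for j
        using w[of j] a_prod by (simp add: b_def)
      have "norm (T \<xi>) * (1 + norm \<xi>) ^ M * (w j * norm \<xi>) ^ k j \<le> (\<Prod>i<M. a i) + (\<Sum>j<J. b j)" for \<xi> j
      proof (cases "j < J")
        case True
        have "norm (T \<xi>) * (1 + norm \<xi>) ^ M * (w j * norm \<xi>) ^ k j \<le>
            norm (T \<xi>) * (1 + norm \<xi>) ^ M * (w j * (1 + norm \<xi>)) ^ k j"
          using w[of j] by (intro mult_left_mono power_mono) auto
        also have "\<dots> = w j ^ k j * (norm (T \<xi>) * (1 + norm \<xi>) ^ (M + k j))"
          by (simp add: power_mult_distrib power_add mult_ac)
        also have "\<dots> \<le> b j"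
          unfolding b_def using w[of j] by (intro mult_left_mono T_decay) auto
        also have "\<dots> \<le> (\<Sum>j<J. b j)"
          using True b by (intro member_le_sum) auto
        finally show ?thesis
          using a_prod[of M] by simp
      next
        case False
        then have "norm (T \<xi>) * (1 + norm \<xi>) ^ M * (w j * norm \<xi>) ^ k j \<le> (\<Prod>i<M. a i)"
          using T_decay_w[of \<xi> M "j - J"] by simp
        then show ?thesis
          using sum_nonneg[of "{..<J}" b] b by simp
      qed
      then show ?thesis
        unfolding T by blast
    qed
  qed
qed

section \<open>The case of a finite integral\<close>

definition unit_vec :: "'a::euclidean_space" where
  "unit_vec = (SOME b. b \<in> Basis)"

lemma norm_unit_vec [simp]: "norm (unit_vec :: 'a::euclidean_space) = 1"
  using SOME_Basis by (simp add: unit_vec_def)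

text \<open>The truncation \<open>max 0 r\<close> extends the profile to a monotone function on the
  whole line, which yields measurability.\<close>

definition profile :: "('a::euclidean_space \<Rightarrow> real) \<Rightarrow> real \<Rightarrow> real" where
  "profile \<psi> r = \<psi> (max 0 r *\<^sub>R unit_vec)"

lemma
  assumes "radially_increasing \<psi>"
  shows profile_norm: "\<psi> \<xi> = profile \<psi> (norm \<xi>)"
    and profile_mono: "r \<le> s \<Longrightarrow> profile \<psi> r \<le> profile \<psi> s"
proof -
  have "norm (max 0 (norm \<xi>) *\<^sub>R (unit_vec :: 'a)) = norm \<xi>"
    by simp
  then show "\<psi> \<xi> = profile \<psi> (norm \<xi>)"
    using assms unfolding radially_increasing_def profile_def by metis
  show "r \<le> s \<Longrightarrow> profile \<psi> r \<le> profile \<psi> s"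
    using assms by (auto simp: radially_increasing_def profile_def)
qed

lemma radially_increasing_measurable:
  assumes "radially_increasing \<psi>"
  shows "(\<psi> :: 'a::euclidean_space \<Rightarrow> real) \<in> borel_measurable borel"
proof -
  have [measurable]: "profile \<psi> \<in> borel_measurable borel"
    by (intro borel_measurable_mono monoI profile_mono[OF assms])
  have "(\<lambda>\<xi>::'a. profile \<psi> (norm \<xi>)) \<in> borel_measurable borel"
    by measurable
  also have "(\<lambda>\<xi>. profile \<psi> (norm \<xi>)) = \<psi>"
    using profile_norm[OF assms] by auto
  finally show ?thesis .
qed

lemma dyadic_between:
  assumes "1 \<le> (x::real)"
  obtains n where "2 ^ n \<le> x" "x < 2 ^ Suc n"
proof -
  obtain m where m: "x < 2 ^ Suc m"
    using real_arch_pow[of 2 x] by (metis le_less_trans less_exp lessI less_imp_le one_less_numeral_iff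
      power_strict_increasing_iff semiring_norm(76) order.strict_trans)
  define n where "n = (LEAST n. x < 2 ^ Suc n)"
  have 1: "x < 2 ^ Suc n"
    unfolding n_def by (rule LeastI[of _ m]) (rule m)
  have "2 ^ n \<le> x"
  proof (cases n)
    case (Suc n')
    then have "\<not> x < 2 ^ Suc n'"
      unfolding n_def by (metis not_less_Least lessI)
    then show ?thesis
      using Suc by simp
  qed (use assms in simp)
  then show ?thesis
    using 1 that by blast
qed

definition shell :: "nat \<Rightarrow> 'a::euclidean_space set" where
  "shell n = {\<xi>. 2 ^ n \<le> norm \<xi> \<and> norm \<xi> < 2 ^ Suc n}"

lemma shell_measurable [measurable]: "shell n \<in> sets borel"
  unfolding shell_def by measurable

lemma disjoint_shell: "disjoint_family (shell :: nat \<Rightarrow> 'a::euclidean_space set)"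
proof -
  have "shell m \<inter> shell n = ({} :: 'a set)" if "m < n" for m n
  proof -
    have "(2::real) ^ Suc m \<le> 2 ^ n"
      using that by (intro power_increasing) auto
    then show ?thesis
      by (force simp: shell_def)
  qed
  then show ?thesis
    unfolding disjoint_family_on_def by (metis Int_commute neqE)
qed

text \<open>A shell is a difference of concentric balls; the lower bound rests on 2^d - 1 \<ge>
  1.\<close>

lemma
  defines "V \<equiv> unit_ball_vol (real DIM('a::euclidean_space))"
  shows emeasure_shell_le: "emeasure lborel (shell n :: 'a set) \<le> ennreal (V * (2 ^ Suc n) ^ DIM('a))"
    and emeasure_shell_ge: "ennreal (V * (2 ^ n) ^ DIM('a)) \<le> emeasure lborel (shell n :: 'a set)"
proof -
  have shell: "shell n = ball (0::'a) (2 ^ Suc n) - ball 0 (2 ^ n)"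
    by (auto simp: shell_def)
  have "emeasure lborel (shell n :: 'a set) \<le> emeasure lborel (ball (0::'a) (2 ^ Suc n))"
    unfolding shell by (intro emeasure_mono) auto
  then show "emeasure lborel (shell n :: 'a set) \<le> ennreal (V * (2 ^ Suc n) ^ DIM('a))"
    by (simp add: emeasure_ball V_def)
  have sub: "ball (0::'a) (2 ^ n) \<subseteq> ball 0 (2 ^ Suc n)"
    by (intro subset_ball) simp
  have "V * (2 ^ n) ^ DIM('a) \<le> V * (2 ^ Suc n) ^ DIM('a) - V * (2 ^ n) ^ DIM('a)"
  proof -
    have "(2::real) ^ 1 \<le> 2 ^ DIM('a)"
      by (intro power_increasing) (auto simp: Suc_le_eq)
    then have "2 * (V * (2 ^ n) ^ DIM('a)) \<le> 2 ^ DIM('a) * (V * (2 ^ n) ^ DIM('a))"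
      by (intro mult_right_mono) (auto simp: V_def)
    then show ?thesis
      by (simp add: power_mult_distrib mult_ac)
  qed
  then have "ennreal (V * (2 ^ n) ^ DIM('a)) \<le> ennreal (V * (2 ^ Suc n) ^ DIM('a) - V * (2 ^ n) ^ DIM('a))"
    by (rule ennreal_leI)
  also have "\<dots> = emeasure lborel (ball (0::'a) (2 ^ Suc n)) - emeasure lborel (ball (0::'a) (2 ^ n))"
    by (simp add: emeasure_ball V_def ennreal_minus)
  also have "\<dots> = emeasure lborel (shell n :: 'a set)"
    unfolding shell using sub by (subst emeasure_Diff) (auto simp: emeasure_ball)
  finally show "ennreal (V * (2 ^ n) ^ DIM('a)) \<le> emeasure lborel (shell n :: 'a set)" .
qed

text \<open>On shell n the integrand lies between profile(2^n) / 2^((n+1)(d+1)) and profile(2^(n+1))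
  / 2^(n(d+1)), and the shell has measure comparable to 2^(nd). Up to constants the integral is thus
  squeezed between the dyadic series and its shift by one index.\<close>

lemma I_int_finite_iff:
  fixes \<psi> :: "'a::euclidean_space \<Rightarrow> real"
  assumes nonneg: "\<And>\<xi>. \<psi> \<xi> \<ge> 0" and rad: "radially_increasing \<psi>"
  shows "I_int \<psi> < \<infinity> \<longleftrightarrow> summable (\<lambda>n. profile \<psi> (2 ^ n) / 2 ^ n)"
proof
  define d where "d = DIM('a)"
  define V where "V = unit_ball_vol (real DIM('a))"
  have V: "V > 0" by (simp add: V_def)
  note [measurable] = radially_increasing_measurable[OF rad]
  define h where "h \<xi> = \<psi> \<xi> / norm \<xi> ^ (d + 1)" for \<xi>
  have h [measurable]: "h \<in> borel_measurable borel"
    unfolding h_def[abs_def] by measurable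
  have p_nonneg: "profile \<psi> r \<ge> 0" for r
    by (simp add: profile_def nonneg)
  have I: "I_int \<psi> = (\<integral>\<^sup>+ \<xi>. indicator {\<xi>. norm \<xi> \<ge> 1} \<xi> * ennreal (h \<xi>) \<partial>lborel)"
    by (simp add: I_int_def h_def d_def)
  {
    assume fin: "I_int \<psi> < \<infinity>"
    define c where "c = V / 2 ^ (d + 1)"
    have c: "c > 0" using V by (simp add: c_def)
    have shell_ge: "ennreal (c * (profile \<psi> (2 ^ n) / 2 ^ n)) \<le> (\<integral>\<^sup>+ \<xi>. ennreal (h \<xi>) * indicator (shell n) \<xi> \<partial>lborel)" for n
    proof -
      define l where "l = profile \<psi> (2 ^ n) / (2 ^ Suc n) ^ (d + 1)"
      have l: "l \<ge> 0" by (simp add: l_def p_nonneg)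
      have "c * (profile \<psi> (2 ^ n) / 2 ^ n) = l * (V * (2 ^ n) ^ d)"
        by (simp add: c_def l_def power_mult_distrib mult_ac)
      then have "ennreal (c * (profile \<psi> (2 ^ n) / 2 ^ n)) \<le> ennreal l * emeasure lborel (shell n :: 'a set)"
        using emeasure_shell_ge[where 'a='a, of n] l V
        by (simp add: ennreal_mult d_def V_def mult_left_mono)
      also have "\<dots> = (\<integral>\<^sup>+ \<xi>. ennreal l * indicator (shell n) (\<xi>::'a) \<partial>lborel)"
        by (simp add: nn_integral_cmult_indicator)
      also have "\<dots> \<le> (\<integral>\<^sup>+ \<xi>. ennreal (h \<xi>) * indicator (shell n) \<xi> \<partial>lborel)"
      proof (rule nn_integral_mono)
        fix \<xi> :: 'a
        show "ennreal l * indicator (shell n) \<xi> \<le> ennreal (h \<xi>) * indicator (shell n) \<xi>"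
        proof (cases "\<xi> \<in> shell n")
          case True
          then have "2 ^ n \<le> norm \<xi>" "norm \<xi> \<le> 2 ^ Suc n"
            by (auto simp: shell_def)
          moreover have "0 < norm \<xi>"
            using \<open>2 ^ n \<le> norm \<xi>\<close> by (smt (verit) zero_less_power)
          ultimately have "l \<le> h \<xi>"
            unfolding l_def h_def profile_norm[OF rad, of \<xi>]
            by (intro frac_le profile_mono[OF rad] p_nonneg power_mono zero_less_power) auto
          then show ?thesis
            by (intro mult_right_mono ennreal_leI) auto
        qed simp
      qed
      finally show ?thesis .
    qed
    have bound: "ennreal (\<Sum>n<N. c * (profile \<psi> (2 ^ n) / 2 ^ n)) \<le> I_int \<psi>" for N
    proof -
      have "ennreal (\<Sum>n<N. c * (profile \<psi> (2 ^ n) / 2 ^ n)) = (\<Sum>n<N. ennreal (c * (profile \<psi> (2 ^ n) / 2 ^ n)))"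
        using c p_nonneg by (intro sum_ennreal[symmetric]) auto
      also have "\<dots> \<le> (\<Sum>n<N. \<integral>\<^sup>+ \<xi>. ennreal (h \<xi>) * indicator (shell n) \<xi> \<partial>lborel)"
        by (intro sum_mono shell_ge)
      also have "\<dots> = (\<integral>\<^sup>+ \<xi>. (\<Sum>n<N. ennreal (h \<xi>) * indicator (shell n) \<xi>) \<partial>lborel)"
        by (intro nn_integral_sum[symmetric]) measurable
      also have "\<dots> \<le> I_int \<psi>"
        unfolding I
      proof (rule nn_integral_mono)
        fix \<xi> :: 'a
        have "(\<Sum>n<N. ennreal (h \<xi>) * indicator (shell n) \<xi>) = ennreal (h \<xi>) * indicator (\<Union>n\<in>{..<N}. shell n) \<xi>"
          using disjoint_shell[where 'a='a]
          by (simp add: sum_distrib_left[symmetric] indicator_UN_disjoint disjoint_family_on_def)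
        also have "\<dots> \<le> ennreal (h \<xi>) * indicator {\<xi>. norm \<xi> \<ge> 1} \<xi>"
        proof (intro mult_left_mono)
          have "(\<Union>n\<in>{..<N}. shell n) \<subseteq> {\<xi>::'a. norm \<xi> \<ge> 1}"
            by (auto simp: shell_def intro: order_trans[OF one_le_power[of 2]])
          then show "indicator (\<Union>n\<in>{..<N}. shell n) \<xi> \<le> (indicator {\<xi>. norm \<xi> \<ge> 1} \<xi> :: ennreal)"
            by (auto simp: indicator_def)
        qed simp
        finally show "(\<Sum>n<N. ennreal (h \<xi>) * indicator (shell n) \<xi>) \<le> indicator {\<xi>. norm \<xi> \<ge> 1} \<xi> * ennreal (h \<xi>)"
          by (simp add: mult.commute)
      qed
      finally show ?thesis .
    qed
    have "(\<Sum>n<N. c * (profile \<psi> (2 ^ n) / 2 ^ n)) \<le> enn2real (I_int \<psi>)" for N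
      using enn2real_mono[OF bound[of N]] fin c p_nonneg by (simp add: sum_nonneg)
    then have "summable (\<lambda>n. c * (profile \<psi> (2 ^ n) / 2 ^ n))"
      using c p_nonneg by (intro summableI_nonneg_bounded) auto
    then show "summable (\<lambda>n. profile \<psi> (2 ^ n) / 2 ^ n)"
      by (rule summable_mult_D) (use c in simp)
  next
    assume sum: "summable (\<lambda>n. profile \<psi> (2 ^ n) / 2 ^ n)"
    define c where "c = V * 2 ^ (d + 1)"
    have c: "c > 0" using V by (simp add: c_def)
    have shell_le: "(\<integral>\<^sup>+ \<xi>. ennreal (h \<xi>) * indicator (shell n) \<xi> \<partial>lborel) \<le> ennreal (c * (profile \<psi> (2 ^ Suc n) / 2 ^ Suc n))" for n
    proof -
      define l where "l = profile \<psi> (2 ^ Suc n) / (2 ^ n) ^ (d + 1)"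
      have l: "l \<ge> 0" by (simp add: l_def p_nonneg)
      have "(\<integral>\<^sup>+ \<xi>. ennreal (h \<xi>) * indicator (shell n) \<xi> \<partial>lborel) \<le> (\<integral>\<^sup>+ \<xi>. ennreal l * indicator (shell n) (\<xi>::'a) \<partial>lborel)"
      proof (rule nn_integral_mono)
        fix \<xi> :: 'a
        show "ennreal (h \<xi>) * indicator (shell n) \<xi> \<le> ennreal l * indicator (shell n) \<xi>"
        proof (cases "\<xi> \<in> shell n")
          case True
          then have "2 ^ n \<le> norm \<xi>" "norm \<xi> \<le> 2 ^ Suc n"
            by (auto simp: shell_def)
          then have "h \<xi> \<le> l"
            unfolding l_def h_def profile_norm[OF rad, of \<xi>]
            by (intro frac_le profile_mono[OF rad] p_nonneg power_mono zero_less_power) auto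
          then show ?thesis
            by (intro mult_right_mono ennreal_leI) auto
        qed simp
      qed
      also have "\<dots> = ennreal l * emeasure lborel (shell n :: 'a set)"
        by (simp add: nn_integral_cmult_indicator)
      also have "\<dots> \<le> ennreal l * ennreal (V * (2 ^ Suc n) ^ d)"
        using emeasure_shell_le[where 'a='a, of n] by (intro mult_left_mono) (auto simp: V_def d_def)
      also have "\<dots> = ennreal (l * (V * (2 ^ Suc n) ^ d))"
        using l V by (simp add: ennreal_mult)
      also have "l * (V * (2 ^ Suc n) ^ d) = c * (profile \<psi> (2 ^ Suc n) / 2 ^ Suc n)"
        by (simp add: c_def l_def power_mult_distrib mult_ac)
      finally show ?thesis .
    qed
    have "I_int \<psi> \<le> (\<integral>\<^sup>+ \<xi>. (\<Sum>n. ennreal (h \<xi>) * indicator (shell n) \<xi>) \<partial>lborel)"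
      unfolding I
    proof (rule nn_integral_mono)
      fix \<xi> :: 'a
      show "indicator {\<xi>. norm \<xi> \<ge> 1} \<xi> * ennreal (h \<xi>) \<le> (\<Sum>n. ennreal (h \<xi>) * indicator (shell n) \<xi>)"
      proof (cases "norm \<xi> \<ge> 1")
        case True
        then obtain n where "2 ^ n \<le> norm \<xi>" "norm \<xi> < 2 ^ Suc n"
          by (rule dyadic_between)
        then have "\<xi> \<in> shell n"
          by (simp add: shell_def)
        then show ?thesis
          using suminf_cmult_indicator[OF disjoint_shell, of \<xi> n "\<lambda>_. ennreal (h \<xi>)"] True by simp
      qed simp
    qed
    also have "\<dots> = (\<Sum>n. \<integral>\<^sup>+ \<xi>. ennreal (h \<xi>) * indicator (shell n) \<xi> \<partial>lborel)"
      by (intro nn_integral_suminf) measurable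
    also have "\<dots> \<le> (\<Sum>n. ennreal (c * (profile \<psi> (2 ^ Suc n) / 2 ^ Suc n)))"
      by (intro suminf_le shell_le) auto
    also have "\<dots> = ennreal (\<Sum>n. c * (profile \<psi> (2 ^ Suc n) / 2 ^ Suc n))"
    proof (rule suminf_ennreal2)
      have "summable (\<lambda>n. profile \<psi> (2 ^ Suc n) / 2 ^ Suc n)"
        using sum by (subst summable_Suc_iff)
      then show "summable (\<lambda>n. c * (profile \<psi> (2 ^ Suc n) / 2 ^ Suc n))"
        by (rule summable_mult)
    qed (use c p_nonneg in auto)
    also have "\<dots> < \<infinity>"
      by simp
    finally show "I_int \<psi> < \<infinity>" .
  }
qed

text \<open>On shell n one has w n |\<xi>| \<ge> e and \<psi>(\<xi>) \<le> k n, so (w n |\<xi>|)^(k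
  n), which the transform of the mollifier can absorb, dominates exp \<psi>. The additional power M,
  arbitrary for one and the same function, leaves room for integrability.\<close>

lemma exists_weighted_bump:
  fixes \<psi> :: "'a::euclidean_space \<Rightarrow> real"
  assumes nonneg: "\<And>\<xi>. \<psi> \<xi> \<ge> 0" and rad: "radially_increasing \<psi>" and fin: "I_int \<psi> < \<infinity>"
  obtains f :: "'a \<Rightarrow> complex" where "smooth_compact_support f" "\<exists>x. f x \<noteq> 0"
    "fourier f \<in> borel_measurable borel"
    "\<And>M. \<exists>C. \<forall>\<xi>. norm (fourier f \<xi>) * (1 + norm \<xi>) ^ M * exp (\<psi> \<xi>) \<le> C"
proof -
  define k where "k n = nat \<lceil>profile \<psi> (2 ^ Suc n)\<rceil>" for n
  define w :: "nat \<Rightarrow> real" where "w n = exp 1 / 2 ^ n" for n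
  have p_nonneg: "profile \<psi> r \<ge> 0" for r
    by (simp add: profile_def nonneg)
  have w: "w n > 0" for n
    by (simp add: w_def)
  have "summable (\<lambda>n. profile \<psi> (2 ^ Suc n) / 2 ^ Suc n)"
    using fin I_int_finite_iff[OF nonneg rad] by (subst summable_Suc_iff) simp
  moreover have "summable (\<lambda>n. (1 / 2) ^ n :: real)"
    by (simp add: summable_geometric)
  ultimately have "summable (\<lambda>n. (2 * exp 1) * (profile \<psi> (2 ^ Suc n) / 2 ^ Suc n) + exp 1 * (1 / 2) ^ n)"
    by (intro summable_add summable_mult)
  then have sum: "summable (\<lambda>n. real (k n) * w n)"
  proof (rule summable_comparison_test')
    fix n
    have "real (k n) \<le> profile \<psi> (2 ^ Suc n) + 1"
      unfolding k_def using p_nonneg by (simp add: of_nat_nat ceiling_le_iff)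
    then have "real (k n) * w n \<le> (profile \<psi> (2 ^ Suc n) + 1) * w n"
      using w[of n] by (intro mult_right_mono) auto
    then show "norm (real (k n) * w n) \<le> (2 * exp 1) * (profile \<psi> (2 ^ Suc n) / 2 ^ Suc n) + exp 1 * (1 / 2) ^ n"
      using w[of n] by (simp add: w_def field_simps)
  qed
  obtain \<phi> :: "'a \<Rightarrow> real" where \<phi>: "bump 1 \<phi>" "smooth_compact_support (\<lambda>x. complex_of_real (\<phi> x))"
    "(\<integral>x. \<phi> x \<partial>lborel) = 1"
    and decay: "\<And>M. \<exists>C. \<forall>\<xi>. norm (cfourier \<phi> \<xi>) * (1 + norm \<xi>) ^ M \<le> C"
    "\<And>M. \<exists>C. \<forall>\<xi> j. norm (cfourier \<phi> \<xi>) * (1 + norm \<xi>) ^ M * (w j * norm \<xi>) ^ k j \<le> C"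
    using mollifier[OF w sum zero_less_one] by metis
  show ?thesis
  proof (rule that[OF \<phi>(2)])
    show "\<exists>x. complex_of_real (\<phi> x) \<noteq> 0"
      using \<phi>(3) by (rule contrapos_pp) simp
    show "fourier (\<lambda>x. complex_of_real (\<phi> x)) \<in> borel_measurable borel"
      using cfourier_measurable[OF \<phi>(1)] by (simp add: cfourier_def)
    fix M
    obtain C1 where C1: "\<And>\<xi>. norm (cfourier \<phi> \<xi>) * (1 + norm \<xi>) ^ M \<le> C1"
      using decay(1) by blast
    obtain C2 where C2: "\<And>\<xi> j. norm (cfourier \<phi> \<xi>) * (1 + norm \<xi>) ^ M * (w j * norm \<xi>) ^ k j \<le> C2"
      using decay(2) by blast
    have "norm (cfourier \<phi> \<xi>) * (1 + norm \<xi>) ^ M * exp (\<psi> \<xi>) \<le> max (C1 * exp (profile \<psi> 1)) C2" for \<xi>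
    proof (cases "norm \<xi> \<ge> 1")
      case True
      then obtain n where n: "2 ^ n \<le> norm \<xi>" "norm \<xi> < 2 ^ Suc n"
        by (rule dyadic_between)
      have "profile \<psi> (2 ^ Suc n) \<le> real (k n)"
        unfolding k_def using p_nonneg by (simp add: of_nat_nat)
      then have "\<psi> \<xi> \<le> real (k n)"
        unfolding profile_norm[OF rad, of \<xi>] using profile_mono[OF rad, of "norm \<xi>" "2 ^ Suc n"] n by linarith
      then have "exp (\<psi> \<xi>) \<le> exp 1 ^ k n"
        by (simp flip: exp_of_nat_mult)
      also have "\<dots> \<le> (w n * norm \<xi>) ^ k n"
        using n by (intro power_mono) (simp_all add: w_def field_simps)
      finally have "norm (cfourier \<phi> \<xi>) * (1 + norm \<xi>) ^ M * exp (\<psi> \<xi>) \<le>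
          norm (cfourier \<phi> \<xi>) * (1 + norm \<xi>) ^ M * (w n * norm \<xi>) ^ k n"
        by (intro mult_left_mono) auto
      then show ?thesis
        using C2[of \<xi> n] by linarith
    next
      case False
      then have "\<psi> \<xi> \<le> profile \<psi> 1"
        unfolding profile_norm[OF rad, of \<xi>] by (intro profile_mono[OF rad]) auto
      then have "norm (cfourier \<phi> \<xi>) * (1 + norm \<xi>) ^ M * exp (\<psi> \<xi>) \<le> C1 * exp (profile \<psi> 1)"
        using order_trans[OF _ C1[of \<xi>], of 0] by (intro mult_mono C1) auto
      then show ?thesis
        by linarith
    qed
    then show "\<exists>C. \<forall>\<xi>. norm (fourier (\<lambda>x. complex_of_real (\<phi> x)) \<xi>) * (1 + norm \<xi>) ^ M * exp (\<psi> \<xi>) \<le> C"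
      unfolding cfourier_def by blast
  qed
qed

text \<open>With t = (1 + |\<xi>|)^(-2 d) the assumption reads |g| exp \<psi> \<le> C t; as t \<le>
  1 and q \<ge> 1, the power t^q is at most t and hence integrable.\<close>

lemma weighted_cond_of_decay:
  fixes \<psi> :: "'a::euclidean_space \<Rightarrow> real"
  assumes "1 \<le> q" "0 \<le> N"
    and C: "\<And>\<xi>. norm (g \<xi>) * (1 + norm \<xi>) ^ (2 * DIM('a)) * exp (\<psi> \<xi>) \<le> C"
  shows "weighted_cond q N \<psi> g"
proof -
  have C_nonneg: "0 \<le> C"
    using order_trans[OF _ C[of 0], of 0] by simp
  have "norm (g \<xi>) powr q * exp (q * \<psi> \<xi>) / (1 + norm \<xi>) powr N \<le> C powr q * (1 / (1 + norm \<xi>) ^ (2 * DIM('a)))" for \<xi>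
  proof -
    define t where "t = 1 / (1 + norm \<xi>) ^ (2 * DIM('a))"
    have t: "0 < t" "t \<le> 1"
      by (auto simp: t_def add_pos_nonneg divide_le_eq_1 intro!: one_le_power)
    have "norm (g \<xi>) powr q * exp (q * \<psi> \<xi>) / (1 + norm \<xi>) powr N \<le> norm (g \<xi>) powr q * exp (q * \<psi> \<xi>) / 1"
      using assms by (intro divide_left_mono ge_one_powr_ge_zero) (auto simp: add_pos_nonneg add_nonneg_eq_0_iff)
    also have "\<dots> = (norm (g \<xi>) * exp (\<psi> \<xi>)) powr q"
      by (simp add: powr_def ln_mult distrib_left flip: exp_add)
    also have "\<dots> \<le> (C * t) powr q"
      using assms(1) C[of \<xi>] by (intro powr_mono2) (auto simp: t_def field_simps add_pos_nonneg)
    also have "\<dots> = C powr q * t powr q"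
      using C_nonneg t by (simp add: powr_mult)
    also have "\<dots> \<le> C powr q * t powr 1"
      using assms(1) t by (intro mult_left_mono powr_mono') auto
    finally show ?thesis
      using t by (simp add: t_def)
  qed
  then have "(\<integral>\<^sup>+ \<xi>. ennreal (norm (g \<xi>) powr q * exp (q * \<psi> \<xi>) / (1 + norm \<xi>) powr N) \<partial>lborel) \<le>
      (\<integral>\<^sup>+ \<xi>. ennreal (C powr q * (1 / (1 + norm (\<xi>::'a)) ^ (2 * DIM('a)))) \<partial>lborel)"
    by (intro nn_integral_mono ennreal_leI)
  also have "\<dots> < \<infinity>"
    using integrable_mult_right[OF integrable_inverse_weight[where 'a='a, OF order_refl], of "C powr q"]
    by (subst nn_integral_eq_integral) auto
  finally show ?thesis
    by (simp add: weighted_cond_def)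
qed

section \<open>The multiplication formula\<close>

text \<open>Evaluation at -x makes the left side an inverse transform, so this is the convolution
  theorem with the reflected \<open>fourier \<Theta>\<close> as kernel. It takes an exchange of
  integrals and no inversion.\<close>

lemma fourier_mult_L1:
  fixes f \<Theta> :: "'a::euclidean_space \<Rightarrow> complex"
  assumes f: "integrable lborel f" and \<Theta>: "integrable lborel \<Theta>"
  shows "fourier (\<lambda>\<xi>. fourier f \<xi> * \<Theta> \<xi>) (- x) = (\<integral>y. f y * fourier \<Theta> (y - x) \<partial>lborel)"
proof -
  have "integrable lborel (\<lambda>\<xi>. \<Theta> \<xi> * cis (2 * pi * (\<xi> \<bullet> x)))"
    by (intro integrable_mult_cis \<Theta>) measurable
  then have "(\<integral>\<xi>. (\<Theta> \<xi> * cis (2 * pi * (\<xi> \<bullet> x))) * (\<integral>y. f y * cis (- 2 * pi * (y \<bullet> \<xi>)) \<partial>lborel) \<partial>lborel) =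
      (\<integral>y. f y * (\<integral>\<xi>. (\<Theta> \<xi> * cis (2 * pi * (\<xi> \<bullet> x))) * cis (- 2 * pi * (y \<bullet> \<xi>)) \<partial>lborel) \<partial>lborel)"
    by (rule fubini_mult[OF _ f, where B=1]) auto
  also have "(\<lambda>y. \<integral>\<xi>. (\<Theta> \<xi> * cis (2 * pi * (\<xi> \<bullet> x))) * cis (- 2 * pi * (y \<bullet> \<xi>)) \<partial>lborel) = (\<lambda>y. fourier \<Theta> (y - x))"
    by (simp add: fourier_def fun_eq_iff mult.assoc cis_mult inner_diff_right inner_commute algebra_simps)
  finally show ?thesis
    unfolding fourier_def[of "\<lambda>\<xi>. fourier f \<xi> * \<Theta> \<xi>"]
    unfolding fourier_def[of f] by (simp add: mult_ac)
qed

lemma in_Lp_locally_integrable: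
  assumes "1 \<le> p" and f: "in_Lp p (f :: 'a::euclidean_space \<Rightarrow> complex)"
  shows "integrable lborel (\<lambda>x. indicator (ball 0 R) x * f x)"
proof (rule Bochner_Integration.integrable_bound)
  have [measurable]: "f \<in> borel_measurable lborel" "ball (0::'a) R \<in> sets lborel"
    using f by (auto simp: in_Lp_def)
  show "(\<lambda>x. indicator (ball 0 R) x * f x) \<in> borel_measurable lborel"
    by measurable
  show "integrable lborel (\<lambda>x. indicator (ball 0 R) x + norm (f x) powr p)"
    using f by (intro Bochner_Integration.integrable_add integrable_real_indicator emeasure_lborel_ball_finite)
      (auto simp: in_Lp_def)
  have "norm (f x) \<le> 1 + norm (f x) powr p" for x
    using powr_mono[OF assms(1), of "norm (f x)"] by (cases "norm (f x) \<le> 1") (auto simp: add_increasing2)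
  then show "AE x in lborel. norm (indicator (ball 0 R) x * f x) \<le> norm (indicator (ball 0 R) x + norm (f x) powr p)"
    by (intro AE_I2) (auto simp: indicator_def)
qed

text \<open>A substitute for Hoelder's inequality when one factor is both bounded and integrable.\<close>

lemma mult_le_scaled_powr:
  fixes a b B \<epsilon> P :: real
  assumes "0 \<le> a" "0 \<le> b" "b \<le> B" "0 < \<epsilon>" "1 \<le> P"
  shows "a * b \<le> \<epsilon> * b + B * \<epsilon> powr (1 - P) * a powr P"
proof (cases "a \<le> \<epsilon>")
  case True
  then have "a * b \<le> \<epsilon> * b"
    using assms by (intro mult_right_mono) auto
  then show ?thesis
    using assms by (simp add: add_increasing2)
next
  case False
  then have a: "0 < a" "\<epsilon> \<le> a"
    using assms by auto
  have "a = a powr (1 - P) * a powr P"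
    using a by (simp flip: powr_add)
  also have "\<dots> \<le> \<epsilon> powr (1 - P) * a powr P"
    using a assms by (intro mult_right_mono powr_mono2') auto
  finally have "a * b \<le> (\<epsilon> powr (1 - P) * a powr P) * B"
    using assms by (intro mult_mono) auto
  then show ?thesis
    using assms by (simp add: mult_ac add_increasing)
qed

text \<open>For p > 1, \<open>g\<close> is given only as an L^(p') limit of transforms of
  truncations. The support condition makes the right side insensitive to truncation at a large
  radius; on the left, boundedness and integrability of \<open>\<Theta>\<close> let the L^(p')
  convergence pass to the integrals.\<close>

theorem fourier_mult_Lp:
  fixes f g \<Theta> :: "'a::euclidean_space \<Rightarrow> complex"
  assumes p: "1 \<le> p" and f: "in_Lp p f" and g: "is_fourier_transform p f g"
    and \<Theta>: "integrable lborel \<Theta>" and B: "\<And>\<xi>. norm (\<Theta> \<xi>) \<le> B"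
    and g\<Theta>: "integrable lborel (\<lambda>\<xi>. g \<xi> * \<Theta> \<xi>)"
    and supp: "\<And>z. norm z > \<delta> \<Longrightarrow> fourier \<Theta> z = 0"
  shows "fourier (\<lambda>\<xi>. g \<xi> * \<Theta> \<xi>) (- x) = (\<integral>y. f y * fourier \<Theta> (y - x) \<partial>lborel)"
proof (cases "p = 1")
  case True
  have "integrable lborel f"
    using f integrable_norm_iff[of f lborel] unfolding in_Lp_def True by simp
  moreover have "g = fourier f"
    using g True by (auto simp: is_fourier_transform_def)
  ultimately show ?thesis
    using fourier_mult_L1[OF _ \<Theta>] by simp
next
  case False
  define P where "P = p / (p - 1)"
  have P: "1 \<le> P"
    using p False by (simp add: P_def)
  define fn where "fn n x = indicator (ball 0 (real n)) x * f x" for n x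
  define A where "A n = (\<integral>\<^sup>+ \<xi>. ennreal (norm (fourier (fn n) \<xi> - g \<xi>) powr P) \<partial>lborel)" for n
  have A: "A \<longlonglongrightarrow> 0"
    using g False unfolding is_fourier_transform_def A_def fn_def P_def by simp
  have [measurable]: "g \<in> borel_measurable borel" "\<Theta> \<in> borel_measurable borel" "f \<in> borel_measurable borel"
    using g False f borel_measurable_integrable[OF \<Theta>] by (auto simp: is_fourier_transform_def in_Lp_def)
  have fn_int: "integrable lborel (fn n)" for n
    unfolding fn_def by (rule in_Lp_locally_integrable[OF p f])
  have [measurable]: "fn n \<in> borel_measurable borel" for n
    using borel_measurable_integrable[OF fn_int] by simp
  define R where "R = (\<integral>y. f y * fourier \<Theta> (y - x) \<partial>lborel)"
  define L where "L = fourier (\<lambda>\<xi>. g \<xi> * \<Theta> \<xi>) (- x)"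
  have R: "R = fourier (\<lambda>\<xi>. fourier (fn n) \<xi> * \<Theta> \<xi>) (- x)" if n: "norm x + \<delta> < real n" for n
  proof -
    have eq: "fn n y * fourier \<Theta> (y - x) = f y * fourier \<Theta> (y - x)" for y
    proof (cases "norm y < real n")
      case False
      then have "norm (y - x) > \<delta>"
        using n norm_triangle_ineq2[of y x] by linarith
      then show ?thesis
        by (simp add: supp)
    qed (simp add: fn_def)
    show ?thesis
      unfolding fourier_mult_L1[OF fn_int \<Theta>] R_def eq ..
  qed
  have fn_\<Theta>_int: "integrable lborel (\<lambda>\<xi>. fourier (fn n) \<xi> * \<Theta> \<xi>)" for n
  proof (rule Bochner_Integration.integrable_bound)
    define b where "b = (\<integral>x. norm (fn n x) \<partial>lborel)"
    show "integrable lborel (\<lambda>\<xi>. b * norm (\<Theta> \<xi>))"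
      by (intro integrable_mult_right integrable_norm \<Theta>)
    show "AE \<xi> in lborel. norm (fourier (fn n) \<xi> * \<Theta> \<xi>) \<le> norm (b * norm (\<Theta> \<xi>))"
      unfolding b_def using norm_fourier_le[OF fn_int[of n]]
      by (intro AE_I2) (simp add: norm_mult abs_mult mult_right_mono)
  qed measurable
  have est: "ennreal (norm (R - L)) \<le> ennreal (\<epsilon> * (\<integral>\<xi>. norm (\<Theta> \<xi>) \<partial>lborel)) + ennreal (B * \<epsilon> powr (1 - P)) * A n"
    if n: "norm x + \<delta> < real n" and \<epsilon>: "\<epsilon> > 0" for n \<epsilon>
  proof -
    have i1: "integrable lborel (\<lambda>\<xi>. fourier (fn n) \<xi> * \<Theta> \<xi> * cis (- 2 * pi * (\<xi> \<bullet> - x)))"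
      by (intro integrable_mult_cis fn_\<Theta>_int) measurable
    have i2: "integrable lborel (\<lambda>\<xi>. g \<xi> * \<Theta> \<xi> * cis (- 2 * pi * (\<xi> \<bullet> - x)))"
      by (intro integrable_mult_cis g\<Theta>) measurable
    have "R - L = (\<integral>\<xi>. (fourier (fn n) \<xi> - g \<xi>) * \<Theta> \<xi> * cis (- 2 * pi * (\<xi> \<bullet> - x)) \<partial>lborel)"
      unfolding R[OF n] L_def fourier_def[of _ "- x"] left_diff_distrib Bochner_Integration.integral_diff[OF i1 i2] ..
    also have "ennreal (norm \<dots>) \<le> (\<integral>\<^sup>+ \<xi>. ennreal (norm ((fourier (fn n) \<xi> - g \<xi>) * \<Theta> \<xi> * cis (- 2 * pi * (\<xi> \<bullet> - x)))) \<partial>lborel)"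
    proof (rule integral_norm_bound_ennreal)
      show "integrable lborel (\<lambda>\<xi>. (fourier (fn n) \<xi> - g \<xi>) * \<Theta> \<xi> * cis (- 2 * pi * (\<xi> \<bullet> - x)))"
        unfolding left_diff_distrib by (rule Bochner_Integration.integrable_diff[OF i1 i2])
    qed
    also have "\<dots> \<le> (\<integral>\<^sup>+ \<xi>. ennreal (\<epsilon> * norm (\<Theta> \<xi>)) + ennreal (B * \<epsilon> powr (1 - P)) * ennreal (norm (fourier (fn n) \<xi> - g \<xi>) powr P) \<partial>lborel)"
    proof (rule nn_integral_mono)
      fix \<xi>
      have "norm (fourier (fn n) \<xi> - g \<xi>) * norm (\<Theta> \<xi>) \<le>
          \<epsilon> * norm (\<Theta> \<xi>) + B * \<epsilon> powr (1 - P) * norm (fourier (fn n) \<xi> - g \<xi>) powr P"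
        using \<epsilon> P B by (intro mult_le_scaled_powr) auto
      moreover have "0 \<le> B"
        using order_trans[OF norm_ge_zero B] .
      ultimately show "ennreal (norm ((fourier (fn n) \<xi> - g \<xi>) * \<Theta> \<xi> * cis (- 2 * pi * (\<xi> \<bullet> - x)))) \<le>
          ennreal (\<epsilon> * norm (\<Theta> \<xi>)) + ennreal (B * \<epsilon> powr (1 - P)) * ennreal (norm (fourier (fn n) \<xi> - g \<xi>) powr P)"
        using \<epsilon> by (simp add: norm_mult ennreal_leI flip: ennreal_mult ennreal_plus)
    qed
    also have "\<dots> = (\<integral>\<^sup>+ \<xi>. ennreal (\<epsilon> * norm (\<Theta> \<xi>)) \<partial>lborel) + ennreal (B * \<epsilon> powr (1 - P)) * A n"
      unfolding A_def by (subst nn_integral_add) (auto simp: nn_integral_cmult)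
    also have "(\<integral>\<^sup>+ \<xi>. ennreal (\<epsilon> * norm (\<Theta> \<xi>)) \<partial>lborel) = ennreal (\<epsilon> * (\<integral>\<xi>. norm (\<Theta> \<xi>) \<partial>lborel))"
      using \<epsilon> \<Theta> by (subst nn_integral_eq_integral) auto
    finally show ?thesis .
  qed
  \<comment> \<open>At fixed \<epsilon> the limit in n removes the term with \<open>A n\<close>;
    only afterwards does \<epsilon> tend to 0.\<close>
  have le_eps: "norm (R - L) \<le> \<epsilon> * (\<integral>\<xi>. norm (\<Theta> \<xi>) \<partial>lborel)" if \<epsilon>: "\<epsilon> > 0" for \<epsilon>
  proof -
    have "(\<lambda>n. ennreal (B * \<epsilon> powr (1 - P)) * A n) \<longlonglongrightarrow> ennreal (B * \<epsilon> powr (1 - P)) * 0"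
      by (intro ennreal_tendsto_cmult A) auto
    then have "(\<lambda>n. ennreal (\<epsilon> * (\<integral>\<xi>. norm (\<Theta> \<xi>) \<partial>lborel)) + ennreal (B * \<epsilon> powr (1 - P)) * A n) \<longlonglongrightarrow>
        ennreal (\<epsilon> * (\<integral>\<xi>. norm (\<Theta> \<xi>) \<partial>lborel)) + ennreal (B * \<epsilon> powr (1 - P)) * 0"
      by (intro tendsto_add tendsto_const)
    moreover obtain N where "norm x + \<delta> < real N"
      using reals_Archimedean2 by blast
    then have "eventually (\<lambda>n. ennreal (norm (R - L)) \<le> ennreal (\<epsilon> * (\<integral>\<xi>. norm (\<Theta> \<xi>) \<partial>lborel)) +
        ennreal (B * \<epsilon> powr (1 - P)) * A n) sequentially"
      using \<epsilon> by (intro eventually_sequentiallyI[of N] est) auto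
    ultimately have "ennreal (norm (R - L)) \<le> ennreal (\<epsilon> * (\<integral>\<xi>. norm (\<Theta> \<xi>) \<partial>lborel)) + ennreal (B * \<epsilon> powr (1 - P)) * 0"
      by (intro tendsto_lowerbound) auto
    then show ?thesis
      using \<epsilon> by simp
  qed
  have "((\<lambda>\<epsilon>. \<epsilon> * (\<integral>\<xi>. norm (\<Theta> \<xi>) \<partial>lborel)) \<longlongrightarrow> 0 * (\<integral>\<xi>. norm (\<Theta> \<xi>) \<partial>lborel)) (at_right 0)"
    by (intro tendsto_intros)
  then have "norm (R - L) \<le> 0 * (\<integral>\<xi>. norm (\<Theta> \<xi>) \<partial>lborel)"
    by (rule tendsto_lowerbound) (auto simp: eventually_at_right_field intro!: exI[of _ 1] le_eps)
  then show ?thesis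
    by (simp add: R_def L_def)
qed

section \<open>Unique continuation\<close>

text \<open>On the line from z0 (at t = 0) through z (at t = 1) the k-th derivative of the transform
  is \<open>u k\<close>, the transform of \<open>Gk k\<close>, and the moments bound it uniformly in
  t. The conclusion is read off at t = 1; the summands 1 in \<open>B\<close> and
  \<open>\<eta>\<close> cover the case z = z0.\<close>

theorem fourier_eq_0_of_vanishing_on_ball:
  fixes G :: "'a::euclidean_space \<Rightarrow> complex"
  assumes G: "rapid G" and C: "0 \<le> C"
    and moments: "\<And>n k. k \<le> K n \<Longrightarrow> (\<integral>\<xi>. norm \<xi> ^ k * norm (G \<xi>) \<partial>lborel) \<le> C * (2 ^ n) ^ k"
    and div: "\<not> summable (\<lambda>n. real (K n) / 2 ^ n)"
    and \<rho>: "\<rho> > 0" and zero: "\<And>z. dist z z0 < \<rho> \<Longrightarrow> fourier G z = 0"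
  shows "fourier G z = 0"
proof -
  define v where "v = z - z0"
  define c :: complex where "c = - 2 * pi * \<i>"
  define Gk where "Gk k \<xi> = G \<xi> * (c * of_real (\<xi> \<bullet> v)) ^ k" for k \<xi>
  have Gk_Suc: "Gk (Suc k) = (\<lambda>\<xi>. Gk k \<xi> * (c * of_real (\<xi> \<bullet> v)))" for k
    by (simp add: Gk_def fun_eq_iff mult_ac)
  have rapid_Gk: "rapid (Gk k)" for k
  proof (induction k)
    case 0
    then show ?case
      using G by (simp add: Gk_def[abs_def])
  next
    case (Suc k)
    then show ?case
      unfolding Gk_Suc by (rule rapid_mult_inner)
  qed
  define u where "u k t = fourier (Gk k) (z0 + t *\<^sub>R v)" for k t
  have der: "(u k has_vector_derivative u (Suc k) t) (at t)" for k t
  proof -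
    have "((\<lambda>t. z0 + t *\<^sub>R v) has_derivative (\<lambda>s. s *\<^sub>R v)) (at t)"
      by (auto intro!: derivative_eq_intros)
    from has_derivative_compose[OF this rapid_fourier_has_derivative[OF rapid_Gk]]
    have "(u k has_derivative (\<lambda>s. fourier (\<lambda>y. Gk k y * (- 2 * pi * \<i> * (y \<bullet> (s *\<^sub>R v)))) (z0 + t *\<^sub>R v))) (at t)"
      by (simp add: u_def[abs_def])
    also have "(\<lambda>s. fourier (\<lambda>y. Gk k y * (- 2 * pi * \<i> * (y \<bullet> (s *\<^sub>R v)))) (z0 + t *\<^sub>R v)) = (\<lambda>s. s *\<^sub>R u (Suc k) t)"
    proof
      fix s :: real
      have "fourier (\<lambda>y. Gk k y * (- 2 * pi * \<i> * (y \<bullet> (s *\<^sub>R v)))) (z0 + t *\<^sub>R v) = fourier (\<lambda>y. s *\<^sub>R Gk (Suc k) y) (z0 + t *\<^sub>R v)"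
        unfolding Gk_Suc by (intro arg_cong2[where f=fourier] ext) (simp_all add: c_def scaleR_conv_of_real mult_ac)
      then show "fourier (\<lambda>y. Gk k y * (- 2 * pi * \<i> * (y \<bullet> (s *\<^sub>R v)))) (z0 + t *\<^sub>R v) = s *\<^sub>R u (Suc k) t"
        by (simp add: u_def fourier_def)
    qed
    finally show ?thesis
      by (simp add: has_vector_derivative_def)
  qed
  define B where "B = 2 * pi * norm v + 1"
  have B: "B > 0"
    by (simp add: B_def add_nonneg_pos)
  have bound: "norm (u k t) \<le> C * (B * 2 ^ n) ^ k" if "k \<le> K n" for n k t
  proof -
    have norm_Gk: "norm (Gk k \<xi>) \<le> B ^ k * (norm \<xi> ^ k * norm (G \<xi>))" for \<xi>
    proof -
      have "2 * pi * \<bar>\<xi> \<bullet> v\<bar> \<le> 2 * pi * (norm \<xi> * norm v)"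
        by (intro mult_left_mono Cauchy_Schwarz_ineq2) simp
      also have "\<dots> \<le> B * norm \<xi>"
        by (simp add: B_def algebra_simps)
      finally have "(2 * pi * \<bar>\<xi> \<bullet> v\<bar>) ^ k \<le> (B * norm \<xi>) ^ k"
        by (intro power_mono) auto
      then have "norm (G \<xi>) * (2 * pi * \<bar>\<xi> \<bullet> v\<bar>) ^ k \<le> norm (G \<xi>) * (B * norm \<xi>) ^ k"
        by (intro mult_left_mono) auto
      then show ?thesis
        by (simp add: Gk_def c_def norm_mult norm_power power_mult_distrib mult_ac)
    qed
    have int_Gk: "integrable lborel (Gk k)"
      by (rule rapid_integrable[OF rapid_Gk])
    have "norm (u k t) \<le> (\<integral>\<xi>. norm (Gk k \<xi>) \<partial>lborel)"
      unfolding u_def by (rule norm_fourier_le[OF int_Gk])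
    also have "\<dots> \<le> (\<integral>\<xi>. B ^ k * (norm \<xi> ^ k * norm (G \<xi>)) \<partial>lborel)"
      using G by (intro integral_mono norm_Gk integrable_norm int_Gk integrable_mult_right) (auto simp: rapid_def)
    also have "\<dots> = B ^ k * (\<integral>\<xi>. norm \<xi> ^ k * norm (G \<xi>) \<partial>lborel)"
      by simp
    also have "\<dots> \<le> B ^ k * (C * (2 ^ n) ^ k)"
      using B by (intro mult_left_mono moments that) auto
    finally show ?thesis
      by (simp add: power_mult_distrib mult_ac)
  qed
  define \<eta> where "\<eta> = \<rho> / (norm v + 1)"
  have \<eta>: "\<eta> > 0"
    using \<rho> by (simp add: \<eta>_def add_nonneg_pos)
  \<comment> \<open>The induction proves vanishing on a whole interval, since the next derivative at
    a point depends on a neighbourhood of it.\<close>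
  have "\<forall>t\<in>{-\<eta><..<\<eta>}. u k t = 0" for k
  proof (induction k)
    case 0
    show ?case
    proof
      fix t assume t: "t \<in> {-\<eta><..<\<eta>}"
      then have "\<bar>t\<bar> * norm v \<le> \<bar>t\<bar> * (norm v + 1)"
        by (intro mult_left_mono) auto
      also have "\<dots> < \<eta> * (norm v + 1)"
        using t by (intro mult_strict_right_mono) (auto simp: add_nonneg_pos)
      also have "\<dots> = \<rho>"
        by (simp add: \<eta>_def add_nonneg_eq_0_iff)
      finally have "fourier G (z0 + t *\<^sub>R v) = 0"
        by (intro zero) (simp add: dist_norm)
      then show "u 0 t = 0"
        by (simp add: u_def Gk_def[abs_def])
    qed
  next
    case (Suc k)
    show ?case
    proof
      fix t assume t: "t \<in> {-\<eta><..<\<eta>}"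
      have "(u k has_vector_derivative 0) (at t)"
        by (rule has_vector_derivative_transform_within_open[where f="\<lambda>_. 0" and S="{-\<eta><..<\<eta>}"])
          (use t Suc in auto)
      from vector_derivative_unique_at[OF der this] show "u (Suc k) t = 0" .
    qed
  qed
  then have "u k 0 = 0" for k
    using \<eta> by auto
  then have "u 0 1 = 0"
    by (intro quasi_analytic[OF der C B bound _ div]) auto
  then show ?thesis
    by (simp add: u_def Gk_def[abs_def] v_def)
qed

text \<open>Open boxes form an intersection-stable generator of the Borel sets, and the sets over
  which \<open>f\<close> integrates to 0 form a Dynkin class. A function all of whose integrals over
  measurable sets are 0 vanishes almost everywhere.\<close>

lemma AE_eq_0_if_box_integrals_0:
  fixes f :: "'a::euclidean_space \<Rightarrow> 'b::{banach, second_countable_topology}"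
  assumes f: "integrable lborel f"
    and box: "\<And>a b. (\<integral>x. indicator (box a b) x *\<^sub>R f x \<partial>lborel) = 0"
  shows "AE x in lborel. f x = 0"
proof (rule sigma_finite_measure.density_zero[OF lborel.sigma_finite_measure_axioms f])
  fix A :: "'a set" assume A: "A \<in> sets lborel"
  let ?E = "range (\<lambda>(a, b). box a b :: 'a set)"
  have int: "integrable lborel (\<lambda>x. indicator A x *\<^sub>R f x)" if "A \<in> sets borel" for A
    by (rule integrable_mult_indicator[OF _ f]) (use that in simp)
  have "Int_stable ?E" "?E \<subseteq> Pow UNIV"
    by (auto simp: Int_stable_def box_Int_box)
  moreover have "A \<in> sigma_sets UNIV ?E"
    using A by (simp add: borel_eq_box)
  ultimately have "A \<in> sets borel \<and> (\<integral>x. indicator A x *\<^sub>R f x \<partial>lborel) = 0"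
  proof (induction rule: sigma_sets_induct_disjoint)
    case (basic A)
    then show ?case
      using box by auto
  next
    case empty
    then show ?case
      by simp
  next
    case (compl A)
    have "(\<integral>x. indicator (UNIV - A) x *\<^sub>R f x \<partial>lborel) = (\<integral>x. f x - indicator A x *\<^sub>R f x \<partial>lborel)"
      by (intro Bochner_Integration.integral_cong) (auto simp: indicator_def)
    also have "\<dots> = (\<integral>x. f x \<partial>lborel)"
      using compl f int by simp
    \<comment> \<open>Complements require the integral over the whole space, which is reached by
      exhausting it with cubes.\<close>
    also have "\<dots> = 0"
    proof -
      have "(\<lambda>n. \<integral>x. indicator (box (- (real n *\<^sub>R One)) (real n *\<^sub>R One)) x *\<^sub>R f x \<partial>lborel) \<longlonglongrightarrow> (\<integral>x. f x \<partial>lborel)"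
      proof (rule integral_dominated_convergence[where w="\<lambda>x. norm (f x)"])
        show "AE x in lborel. (\<lambda>n. indicator (box (- (real n *\<^sub>R One)) (real n *\<^sub>R One)) x *\<^sub>R f x) \<longlonglongrightarrow> f x"
        proof (intro AE_I2 tendsto_eventually)
          fix x :: 'a
          obtain N where N: "norm x < real N"
            using reals_Archimedean2 by blast
          show "eventually (\<lambda>n. indicator (box (- (real n *\<^sub>R One)) (real n *\<^sub>R One)) x *\<^sub>R f x = f x) sequentially"
          proof (rule eventually_sequentiallyI[of N])
            fix n assume "N \<le> n"
            then have "\<bar>x \<bullet> b\<bar> < real n" if "b \<in> Basis" for b
              using N Basis_le_norm[OF that, of x] by linarith
            then have "x \<in> box (- (real n *\<^sub>R One)) (real n *\<^sub>R One)"
              by (auto simp: mem_box abs_less_iff minus_less_iff)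
            then show "indicator (box (- (real n *\<^sub>R One)) (real n *\<^sub>R One)) x *\<^sub>R f x = f x"
              by simp
          qed
        qed
      qed (use f in \<open>auto simp: indicator_def\<close>)
      then show ?thesis
        by (simp add: box LIMSEQ_const_iff)
    qed
    finally show ?case
      using compl by (auto intro: borel_comp)
  next
    case (union A)
    then have A: "range A \<subseteq> sets borel" and z: "\<And>i. (\<integral>x. indicator (A i) x *\<^sub>R f x \<partial>lborel) = 0"
      by auto
    have "set_lebesgue_integral lborel (\<Union>i. A i) f = (\<Sum>i. set_lebesgue_integral lborel (A i) f)"
      using A union.hyps(1) f
      by (intro lebesgue_integral_countable_add) (auto simp: disjoint_family_on_def set_integrable_def intro!: int sets.countable_UN)
    then show ?case
      using A z by (simp add: set_lebesgue_integral_def)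
  qed
  then show "set_lebesgue_integral lborel A f = 0"
    by (simp add: set_lebesgue_integral_def)
qed

lemma AE_lborel_not_box_boundary:
  "AE x in lborel. x \<in> box a b \<or> x \<notin> cbox a (b::'a::euclidean_space)"
proof -
  have "cbox a b - box a b \<in> null_sets lebesgue"
    using negligible_frontier_interval negligible_iff_null_sets by blast
  then have "AE x in lebesgue. x \<notin> cbox a b - box a b"
    by (rule AE_not_in)
  then have "AE x in lborel. x \<notin> cbox a b - box a b"
    unfolding AE_completion_iff .
  then show ?thesis
    by eventually_elim auto
qed

text \<open>Integrating the convolution over a box and exchanging integrals tests f against the
  mollified indicator \<open>c n\<close>, which is bounded by 1 and converges to the indicator off
  the boundary, a null set. So f has integral 0 over every box.\<close>

theorem AE_eq_0_if_bump_convolutions_0: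
  fixes f :: "'a::euclidean_space \<Rightarrow> complex"
  assumes f: "\<And>R. integrable lborel (\<lambda>x. indicator (ball 0 R) x * f x)"
    and conv: "\<And>\<delta>. \<delta> > 0 \<Longrightarrow> \<exists>\<phi>. bump \<delta> \<phi> \<and> (\<integral>x. \<phi> x \<partial>lborel) = 1 \<and>
      (\<forall>x. (\<integral>y. f y * complex_of_real (\<phi> (x - y)) \<partial>lborel) = 0)"
  shows "AE x in lborel. f x = 0"
proof -
  have "(\<integral>x. indicator (box a b) x *\<^sub>R f x \<partial>lborel) = 0" for a b
  proof -
    obtain R where R: "cbox a b \<subseteq> ball 0 R" "R > 0"
      using bounded_cbox[of a b] bounded_subset_ballD by blast
    \<comment> \<open>For x in the box a bump of radius at most 1 sees f only within distance R + 1
      of the origin, so the integrable \<open>F\<close> can replace f.\<close>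
    define F where "F x = indicator (ball 0 (R + 1)) x * f x" for x
    have F: "integrable lborel F"
      unfolding F_def by (rule f)
    define r where "r n = inverse (real (Suc n))" for n
    have r: "r n > 0" "r n \<le> 1" for n
      by (auto simp: r_def inverse_le_1_iff)
    have r_lim: "r \<longlonglongrightarrow> 0"
      unfolding r_def by (rule LIMSEQ_inverse_real_of_nat)
    have "\<exists>\<phi>. \<forall>n. bump (r n) (\<phi> n) \<and> (\<integral>x. \<phi> n x \<partial>lborel) = 1 \<and>
        (\<forall>x. (\<integral>y. f y * complex_of_real (\<phi> n (x - y)) \<partial>lborel) = 0)"
      by (intro choice allI conv r(1))
    then obtain \<phi> where \<phi>: "\<And>n. bump (r n) (\<phi> n)" "\<And>n. (\<integral>x. \<phi> n x \<partial>lborel) = 1"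
      and \<phi>_conv: "\<And>n x. (\<integral>y. f y * complex_of_real (\<phi> n (x - y)) \<partial>lborel) = 0"
      by blast
    have \<phi>_meas [measurable]: "\<phi> n \<in> borel_measurable borel" for n
      using bump_measurable[OF \<phi>(1)] .
    define c where "c n y = (\<integral>x. indicator (box a b) x * complex_of_real (\<phi> n (x - y)) \<partial>lborel)" for n y
    have int_shift: "integrable lborel (\<lambda>x. \<phi> n (x - y))" "(\<integral>x. \<phi> n (x - y) \<partial>lborel) = 1" for n y
      using integrable_lborel_affine[of "\<phi> n" 1 "- y"] integral_lborel_affine[of "\<phi> n" 1 "- y"]
        bump_integrable[OF \<phi>(1)] \<phi>(2) by auto
    have zero: "(\<integral>y. F y * c n y \<partial>lborel) = 0" for n
    proof -
      obtain B where B: "\<And>x. norm (\<phi> n x) \<le> B"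
        using bump_bounded[OF \<phi>(1)] by blast
      have "(\<integral>y. F y * c n y \<partial>lborel) = (\<integral>x. indicator (box a b) x * (\<integral>y. F y * complex_of_real (\<phi> n (x - y)) \<partial>lborel) \<partial>lborel)"
        unfolding c_def
      proof (rule fubini_mult[OF F])
        show "integrable lborel (\<lambda>x. indicator (box a b) x :: complex)"
          using integrable_of_real[OF integrable_real_indicator[of "box a b" lborel]] emeasure_lborel_box_finite[of a b]
          by (simp add: of_real_indicator)
        show "norm (complex_of_real (\<phi> n (x - y))) \<le> B" for x y
          using B by simp
        show "(\<lambda>(y, x). complex_of_real (\<phi> n (x - y))) \<in> borel_measurable (borel \<Otimes>\<^sub>M borel)"
          by measurable
      qed
      also have "\<dots> = (\<integral>x. 0 \<partial>(lborel :: 'a measure))"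
      proof (rule Bochner_Integration.integral_cong)
        fix x
        show "indicator (box a b) x * (\<integral>y. F y * complex_of_real (\<phi> n (x - y)) \<partial>lborel) = 0"
        proof (cases "x \<in> box a b")
          case True
          then have "norm x < R"
            using R(1) box_subset_cbox[of a b] by (auto simp: subset_eq)
          have eq: "F y * complex_of_real (\<phi> n (x - y)) = f y * complex_of_real (\<phi> n (x - y))" for y
          proof (cases "norm y < R + 1")
            case False
            then have "norm (x - y) > r n"
              using \<open>norm x < R\<close> r(2)[of n] norm_triangle_ineq2[of y x] by (simp add: norm_minus_commute)
            then show ?thesis
              using \<phi>(1)[of n] by (simp add: bump_def)
          qed (simp add: F_def)
          show ?thesis
            unfolding eq \<phi>_conv by simp
        qed simp
      qed simp
      finally show ?thesis
        by simp
    qed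
    have c_meas [measurable]: "c n \<in> borel_measurable borel" for n
      unfolding c_def[abs_def] by measurable
    have c_le: "norm (c n y) \<le> 1" for n y
    proof -
      have "norm (c n y) \<le> (\<integral>x. \<phi> n (x - y) \<partial>lborel)"
        unfolding c_def
      proof (rule norm_integral_le_integral[OF _ int_shift(1)])
        show "integrable lborel (\<lambda>x. indicator (box a b) x * complex_of_real (\<phi> n (x - y)))"
          by (rule Bochner_Integration.integrable_bound[OF int_shift(1)[of n y]]) (auto simp: indicator_def)
        show "norm (indicator (box a b) x * complex_of_real (\<phi> n (x - y))) \<le> \<phi> n (x - y)" for x
          using \<phi>(1)[of n] by (auto simp: indicator_def bump_def)
      qed
      then show ?thesis
        using int_shift(2) by simp
    qed
    have "(\<lambda>n. \<integral>y. F y * c n y \<partial>lborel) \<longlonglongrightarrow> (\<integral>y. F y * indicator (box a b) y \<partial>lborel)"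
    proof (rule integral_dominated_convergence[where w="\<lambda>y. norm (F y)"])
      show "AE y in lborel. (\<lambda>n. F y * c n y) \<longlonglongrightarrow> F y * indicator (box a b) y"
        using AE_lborel_not_box_boundary[of a b]
      proof eventually_elim
        case (elim y)
        \<comment> \<open>Once the bump is narrower than the distance from y to the boundary,
          \<open>c n y\<close> equals the indicator exactly.\<close>
        then obtain e where e: "e > 0" "ball y e \<subseteq> box a b \<or> ball y e \<subseteq> - cbox a b"
          using open_contains_ball[of "box a b"] open_contains_ball[of "- cbox a b"]
          by (metis ComplI open_box closed_cbox open_Compl)
        have "eventually (\<lambda>n. r n < e) sequentially"
          by (rule order_tendstoD(2)[OF r_lim e(1)])
        then have "eventually (\<lambda>n. c n y = indicator (box a b) y) sequentially"
        proof eventually_elim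
          case (elim n)
          have eq: "indicator (box a b) x * complex_of_real (\<phi> n (x - y)) =
              indicator (box a b) y * complex_of_real (\<phi> n (x - y))" for x
          proof (cases "dist y x < e")
            case True
            then have "x \<in> ball y e" "y \<in> ball y e"
              using e(1) by auto
            then have "x \<in> box a b \<longleftrightarrow> y \<in> box a b"
              using e(2) box_subset_cbox[of a b] by blast
            then show ?thesis
              by (simp add: indicator_def)
          next
            case False
            then have "norm (x - y) > r n"
              using elim by (simp add: dist_norm norm_minus_commute)
            then show ?thesis
              using \<phi>(1)[of n] by (simp add: bump_def)
          qed
          show ?case
            unfolding c_def eq by (simp add: int_shift)
        qed
        then show ?case
          by (intro tendsto_mult tendsto_const tendsto_eventually)
      qed
      show "AE y in lborel. norm (F y * c n y) \<le> norm (F y)" for n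
        using c_le by (intro AE_I2) (simp add: norm_mult mult_left_le)
    qed (use F borel_measurable_integrable[OF F] in auto)
    then have "(\<integral>y. F y * indicator (box a b) y \<partial>lborel) = 0"
      by (simp add: zero LIMSEQ_const_iff)
    also have "(\<lambda>y. F y * indicator (box a b) y) = (\<lambda>y. indicator (box a b) y *\<^sub>R f y)"
    proof
      fix y
      show "F y * indicator (box a b) y = indicator (box a b) y *\<^sub>R f y"
        using R(1) box_subset_cbox[of a b] by (cases "y \<in> box a b") (force simp: F_def)+
    qed
    finally show ?thesis .
  qed
  note box0 = this
  have "AE x in lborel. \<forall>n::nat. indicator (box (- (real n *\<^sub>R One)) (real n *\<^sub>R One)) x *\<^sub>R f x = 0"
    unfolding AE_all_countable
  proof
    fix n :: nat
    let ?b = "box (- (real n *\<^sub>R One)) (real n *\<^sub>R One) :: 'a set"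
    show "AE x in lborel. indicator ?b x *\<^sub>R f x = 0"
    proof (rule AE_eq_0_if_box_integrals_0)
      obtain R where R: "?b \<subseteq> ball 0 R"
        using bounded_subset_ballD[OF bounded_box] by blast
      have "integrable lborel (\<lambda>x. indicator ?b x *\<^sub>R (indicator (ball 0 R) x * f x))"
        by (intro integrable_mult_indicator f) auto
      also have "(\<lambda>x. indicator ?b x *\<^sub>R (indicator (ball 0 R) x * f x)) = (\<lambda>x. indicator ?b x *\<^sub>R f x)"
        using R by (auto simp: fun_eq_iff indicator_def)
      finally show "integrable lborel (\<lambda>x. indicator ?b x *\<^sub>R f x)" .
      fix a b :: 'a
      show "(\<integral>x. indicator (box a b) x *\<^sub>R indicator ?b x *\<^sub>R f x \<partial>lborel) = 0"
        using box0 by (simp add: box_Int_box flip: indicator_inter_arith)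
    qed
  qed
  then show ?thesis
  proof eventually_elim
    case (elim x)
    have "x \<in> (\<Union>n::nat. box (- (real n *\<^sub>R One)) (real n *\<^sub>R One))"
      using UN_box_eq_UNIV by auto
    then obtain n :: nat where "x \<in> box (- (real n *\<^sub>R One)) (real n *\<^sub>R One)"
      by blast
    then show ?case
      using elim[rule_format, of n] by simp
  qed
qed

section \<open>The case of an infinite integral\<close>

lemma real_polynomial_function_growth:
  assumes "real_polynomial_function (f :: 'a::real_normed_vector \<Rightarrow> real)"
  shows "\<exists>C j. \<forall>x. \<bar>f x\<bar> \<le> C * (1 + norm x) ^ j"
  using assms
proof (induction rule: real_polynomial_function.induct)
  case (linear f)
  then obtain K where K: "\<And>x. \<bar>f x\<bar> \<le> norm x * K" "K \<ge> 0"
    using bounded_linear.nonneg_bounded[of f] by (auto simp: mult.commute)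
  have "\<bar>f x\<bar> \<le> K * (1 + norm x) ^ 1" for x
    using K(1)[of x] K(2) by (simp add: algebra_simps)
  then show ?case
    by blast
next
  case (const c)
  show ?case
    by (intro exI[of _ "\<bar>c\<bar>"] exI[of _ 0]) simp
next
  case (add f g)
  then obtain C i D j where fg: "\<And>x. \<bar>f x\<bar> \<le> C * (1 + norm x) ^ i" "\<And>x. \<bar>g x\<bar> \<le> D * (1 + norm x) ^ j"
    by blast
  have "0 \<le> C" "0 \<le> D"
    using fg(1)[of 0] fg(2)[of 0] by auto
  have "\<bar>f x + g x\<bar> \<le> (C + D) * (1 + norm x) ^ (i + j)" for x
  proof -
    have "C * (1 + norm x) ^ i \<le> C * (1 + norm x) ^ (i + j)" "D * (1 + norm x) ^ j \<le> D * (1 + norm x) ^ (i + j)"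
      using \<open>0 \<le> C\<close> \<open>0 \<le> D\<close> by (intro mult_left_mono power_increasing; simp)+
    then show ?thesis
      using fg(1)[of x] fg(2)[of x] by (simp add: distrib_right)
  qed
  then show ?case
    by blast
next
  case (mult f g)
  then obtain C i D j where fg: "\<And>x. \<bar>f x\<bar> \<le> C * (1 + norm x) ^ i" "\<And>x. \<bar>g x\<bar> \<le> D * (1 + norm x) ^ j"
    by blast
  have "\<bar>f x * g x\<bar> \<le> (C * D) * (1 + norm x) ^ (i + j)" for x
  proof -
    have "\<bar>f x\<bar> * \<bar>g x\<bar> \<le> (C * (1 + norm x) ^ i) * (D * (1 + norm x) ^ j)"
      using fg order_trans[OF abs_ge_zero fg(1)] by (intro mult_mono) auto
    then show ?thesis
      by (simp add: abs_mult power_add mult_ac)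
  qed
  then show ?case
    by blast
qed

lemma polynomial_function_growth:
  assumes "polynomial_function (P :: 'a::real_normed_vector \<Rightarrow> complex)"
  obtains C j where "\<And>x. norm (P x) \<le> C * (1 + norm x) ^ j"
proof -
  have "real_polynomial_function (Re \<circ> P)" "real_polynomial_function (Im \<circ> P)"
    using assms bounded_linear_Re bounded_linear_Im unfolding polynomial_function_def by blast+
  then obtain C i D j where RI: "\<And>x. \<bar>Re (P x)\<bar> \<le> C * (1 + norm x) ^ i" "\<And>x. \<bar>Im (P x)\<bar> \<le> D * (1 + norm x) ^ j"
    using real_polynomial_function_growth[of "Re \<circ> P"] real_polynomial_function_growth[of "Im \<circ> P"] by auto
  have "0 \<le> C" "0 \<le> D"
    using RI(1)[of 0] RI(2)[of 0] by auto
  have "norm (P x) \<le> (C + D) * (1 + norm x) ^ (i + j)" for x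
  proof -
    have "C * (1 + norm x) ^ i \<le> C * (1 + norm x) ^ (i + j)" "D * (1 + norm x) ^ j \<le> D * (1 + norm x) ^ (i + j)"
      using \<open>0 \<le> C\<close> \<open>0 \<le> D\<close> by (intro mult_left_mono power_increasing; simp)+
    then show ?thesis
      using RI(1)[of x] RI(2)[of x] cmod_le[of "P x"] by (simp add: distrib_right)
  qed
  then show ?thesis
    by (rule that)
qed

text \<open>The inequality t \<le> 1 + t^q stands in for Hoelder's inequality and reduces every q to
  q = 1; the summand 1 is paid for by 2 d further powers of 1 + |\<xi>|.\<close>

lemma integrable_of_weighted_cond:
  fixes \<psi> :: "'a::euclidean_space \<Rightarrow> real"
  assumes [measurable]: "\<psi> \<in> borel_measurable borel" "g \<in> borel_measurable borel"
    and q: "1 \<le> q" and cond: "weighted_cond q N \<psi> g"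
  shows "integrable lborel (\<lambda>\<xi>. norm (g \<xi>) * exp (\<psi> \<xi>) / (1 + norm \<xi>) ^ (nat \<lceil>N\<rceil> + 2 * DIM('a)))"
proof (rule Bochner_Integration.integrable_bound)
  define m where "m = nat \<lceil>N\<rceil> + 2 * DIM('a)"
  let ?h = "\<lambda>\<xi>. norm (g \<xi>) powr q * exp (q * \<psi> \<xi>) / (1 + norm \<xi>) powr N"
  have "integrable lborel ?h"
    using cond unfolding weighted_cond_def by (intro integrableI_nonneg) auto
  then show "integrable lborel (\<lambda>\<xi>. 1 / (1 + norm \<xi>) ^ (2 * DIM('a)) + ?h \<xi>)"
    by (intro Bochner_Integration.integrable_add integrable_inverse_weight) auto
  have "norm (g \<xi>) * exp (\<psi> \<xi>) / (1 + norm \<xi>) ^ m \<le> 1 / (1 + norm \<xi>) ^ (2 * DIM('a)) + ?h \<xi>" for \<xi>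
  proof -
    define t where "t = norm (g \<xi>) * exp (\<psi> \<xi>)"
    have t: "t \<ge> 0"
      by (simp add: t_def)
    have pos: "(1 + norm \<xi>) powr N > 0"
      by (simp add: add_nonneg_eq_0_iff)
    have "t \<le> 1 + t powr q"
      using powr_mono[OF q, of t] t by (cases "t \<le> 1") (auto simp: add_increasing2)
    then have "t / (1 + norm \<xi>) ^ m \<le> 1 / (1 + norm \<xi>) ^ m + t powr q / (1 + norm \<xi>) ^ m"
      by (simp add: divide_right_mono flip: add_divide_distrib)
    also have "\<dots> \<le> 1 / (1 + norm \<xi>) ^ (2 * DIM('a)) + t powr q / (1 + norm \<xi>) powr N"
    proof (intro add_mono divide_left_mono)
      show "(1 + norm \<xi>) ^ (2 * DIM('a)) \<le> (1 + norm \<xi>) ^ m"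
        by (intro power_increasing) (auto simp: m_def)
      have "N \<le> real m"
        using real_nat_ceiling_ge[of N] by (simp add: m_def)
      then have "(1 + norm \<xi>) powr N \<le> (1 + norm \<xi>) powr real m"
        by (intro powr_mono) auto
      then show "(1 + norm \<xi>) powr N \<le> (1 + norm \<xi>) ^ m"
        by (simp add: powr_realpow add_pos_nonneg)
    qed (use pos in \<open>auto simp: add_pos_nonneg\<close>)
    also have "t powr q = norm (g \<xi>) powr q * exp (q * \<psi> \<xi>)"
      by (simp add: t_def powr_def ln_mult distrib_left exp_add)
    finally show ?thesis
      by (simp add: t_def)
  qed
  then show "AE \<xi> in lborel. norm (norm (g \<xi>) * exp (\<psi> \<xi>) / (1 + norm \<xi>) ^ (nat \<lceil>N\<rceil> + 2 * DIM('a))) \<le>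
      norm (1 / (1 + norm \<xi>) ^ (2 * DIM('a)) + ?h \<xi>)"
    unfolding m_def by (intro AE_I2) (auto intro: order_trans)
qed measurable

text \<open>The polynomial is absorbed into a power of 1 + |\<xi>|, and 2 d further powers make the
  rest integrable.\<close>

lemma integrable_of_poly_bound:
  fixes \<psi> :: "'a::euclidean_space \<Rightarrow> real"
  assumes [measurable]: "\<psi> \<in> borel_measurable borel" "g \<in> borel_measurable borel"
    and C: "C \<ge> 0" and pb: "poly_bound C P \<psi> g"
  obtains m where "integrable lborel (\<lambda>\<xi>. norm (g \<xi>) * exp (\<psi> \<xi>) / (1 + norm \<xi>) ^ m)"
proof -
  obtain D j where P: "\<And>x. norm (P x) \<le> D * (1 + norm x) ^ j"
    using pb polynomial_function_growth unfolding poly_bound_def by blast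
  have "integrable lborel (\<lambda>\<xi>. norm (g \<xi>) * exp (\<psi> \<xi>) / (1 + norm \<xi>) ^ (j + 2 * DIM('a)))"
  proof (rule Bochner_Integration.integrable_bound)
    show "integrable lborel (\<lambda>\<xi>. (C * D) * (1 / (1 + norm (\<xi>::'a)) ^ (2 * DIM('a))))"
      by (intro integrable_mult_right integrable_inverse_weight) simp
    have "AE \<xi> in lborel. norm (g \<xi>) \<le> C * norm (P \<xi>) * exp (- \<psi> \<xi>)"
      using pb by (simp add: poly_bound_def)
    then show "AE \<xi> in lborel. norm (norm (g \<xi>) * exp (\<psi> \<xi>) / (1 + norm \<xi>) ^ (j + 2 * DIM('a))) \<le>
        norm ((C * D) * (1 / (1 + norm \<xi>) ^ (2 * DIM('a))))"
    proof eventually_elim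
      case (elim \<xi>)
      have "norm (g \<xi>) * exp (\<psi> \<xi>) \<le> (C * norm (P \<xi>) * exp (- \<psi> \<xi>)) * exp (\<psi> \<xi>)"
        by (intro mult_right_mono elim) simp
      also have "\<dots> = C * norm (P \<xi>)"
        by (simp add: mult.assoc flip: exp_add)
      also have "\<dots> \<le> C * (D * (1 + norm \<xi>) ^ j)"
        by (intro mult_left_mono P C)
      finally have "norm (g \<xi>) * exp (\<psi> \<xi>) / (1 + norm \<xi>) ^ (j + 2 * DIM('a)) \<le>
          C * (D * (1 + norm \<xi>) ^ j) / (1 + norm \<xi>) ^ (j + 2 * DIM('a))"
        by (intro divide_right_mono) auto
      also have "\<dots> = (C * D) * (1 / (1 + norm \<xi>) ^ (2 * DIM('a)))"
        by (simp add: power_add add_nonneg_eq_0_iff)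
      finally have le: "norm (g \<xi>) * exp (\<psi> \<xi>) / (1 + norm \<xi>) ^ (j + 2 * DIM('a)) \<le>
          (C * D) * (1 / (1 + norm \<xi>) ^ (2 * DIM('a)))" .
      have ge: "0 \<le> norm (g \<xi>) * exp (\<psi> \<xi>) / (1 + norm \<xi>) ^ (j + 2 * DIM('a))"
        by simp
      show ?case
        unfolding real_norm_def abs_of_nonneg[OF ge] by (rule order_trans[OF le abs_ge_self])
    qed
  qed measurable
  then show ?thesis
    by (rule that)
qed

text \<open>The exponents \<open>a\<^sub>n = 1 + S\<^sub>n\<close> balance two requirements: \<open>\<Sum> s\<^sub>n / a\<^sub>n\<close> must still diverge, while
  the total width \<open>\<Sum> s\<^sub>n exp (- a\<^sub>n) / a\<^sub>n\<close> of the mollifier must be finite.\<close>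

lemma divergent_scales:
  fixes p :: "nat \<Rightarrow> real"
  assumes nonneg: "\<And>n. p n \<ge> 0" and div: "\<not> summable (\<lambda>n. p n / 2 ^ n)"
  obtains w :: "nat \<Rightarrow> real" and K :: "nat \<Rightarrow> nat"
  where "\<And>n. w n > 0" "summable (\<lambda>n. real (K n) * w n)" "\<not> summable (\<lambda>n. real (K n) / 2 ^ n)"
    "\<And>n. 1 \<le> (2 ^ n * w n) ^ K n * exp (p n)"
proof -
  define s where "s n = min 1 (p n / 2 ^ n)" for n
  have s_nonneg: "s n \<ge> 0" for n
    using nonneg by (simp add: s_def)
  \<comment> \<open>If the truncated series converged, its terms would eventually be below 1, where
    truncation changes nothing.\<close>
  have s_div: "\<not> summable s"
  proof
    assume s: "summable s"
    then have "eventually (\<lambda>n. s n < 1) sequentially"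
      by (intro order_tendstoD(2)[OF summable_LIMSEQ_zero]) auto
    then have "eventually (\<lambda>n. s n = p n / 2 ^ n) sequentially"
      by eventually_elim (auto simp: s_def min_def split: if_splits)
    from summable_cong[OF this] show False
      using s div by simp
  qed
  define a where "a n = 1 + (\<Sum>i\<le>n. s i)" for n
  have a: "a n \<ge> 1" for n
    using s_nonneg by (simp add: a_def sum_nonneg)
  have "\<not> summable (\<lambda>n. s n / a n)" "summable (\<lambda>n. s n * exp (- (\<Sum>i\<le>n. s i)))"
    using abel_dini[OF s_nonneg s_div] by (simp_all add: a_def)
  note ad = this
  \<comment> \<open>Rounding down changes K n / 2^n by at most 1 / 2^n, a summable error that cannot
    destroy divergence.\<close>
  define K where "K n = nat \<lfloor>s n * 2 ^ n / a n\<rfloor>" for n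
  have K_le: "real (K n) \<le> s n * 2 ^ n / a n" and K_ge: "s n * 2 ^ n / a n \<le> real (K n) + 1" for n
  proof -
    have "0 \<le> s n * 2 ^ n / a n"
      using s_nonneg[of n] a[of n] by simp
    then show "real (K n) \<le> s n * 2 ^ n / a n" "s n * 2 ^ n / a n \<le> real (K n) + 1"
      unfolding K_def by linarith+
  qed
  \<comment> \<open>With this width (2^n w n)^(K n) is exp (- a n K n), and exp (p n) compensates it
    because a n K n \<le> s n 2^n \<le> p n.\<close>
  define w where "w n = exp (- a n) / 2 ^ n" for n
  show ?thesis
  proof (rule that)
    show "w n > 0" for n
      by (simp add: w_def)
    show "summable (\<lambda>n. real (K n) * w n)"
    proof (rule summable_comparison_test'[OF ad(2)])
      fix n
      have "real (K n) * w n \<le> (s n * 2 ^ n / a n) * w n"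
        by (intro mult_right_mono K_le) (simp add: w_def)
      also have "\<dots> = s n * exp (- a n) / a n"
        by (simp add: w_def)
      also have "\<dots> \<le> s n * exp (- a n) / 1"
        using a[of n] s_nonneg[of n] by (intro divide_left_mono) auto
      also have "\<dots> \<le> s n * exp (- (\<Sum>i\<le>n. s i)) / 1"
        using s_nonneg[of n] by (intro divide_right_mono mult_left_mono) (auto simp: a_def)
      finally show "norm (real (K n) * w n) \<le> s n * exp (- (\<Sum>i\<le>n. s i))"
        by (simp add: w_def)
    qed
    show "\<not> summable (\<lambda>n. real (K n) / 2 ^ n)"
    proof
      assume "summable (\<lambda>n. real (K n) / 2 ^ n)"
      moreover have "summable (\<lambda>n. (1 / 2) ^ n :: real)"
        by (simp add: summable_geometric)
      ultimately have "summable (\<lambda>n. real (K n) / 2 ^ n + (1 / 2) ^ n)"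
        by (rule summable_add)
      then have "summable (\<lambda>n. s n / a n)"
      proof (rule summable_comparison_test')
        fix n
        have "s n / a n = (s n * 2 ^ n / a n) / 2 ^ n"
          by simp
        also have "\<dots> \<le> (real (K n) + 1) / 2 ^ n"
          by (intro divide_right_mono K_ge) auto
        finally show "norm (s n / a n) \<le> real (K n) / 2 ^ n + (1 / 2) ^ n"
          using s_nonneg[of n] a[of n] by (simp add: add_divide_distrib power_divide)
      qed
      then show False
        using ad(1) by simp
    qed
    show "1 \<le> (2 ^ n * w n) ^ K n * exp (p n)" for n
    proof -
      have "real (K n) * a n \<le> s n * 2 ^ n"
        using K_le[of n] a[of n] by (simp add: field_simps)
      also have "\<dots> \<le> p n"
        by (simp add: s_def min_def field_simps)
      finally have "0 \<le> real (K n) * (- a n) + p n"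
        by simp
      then have "1 \<le> exp (real (K n) * (- a n) + p n)"
        by simp
      also have "\<dots> = (2 ^ n * w n) ^ K n * exp (p n)"
        unfolding exp_add exp_of_nat_mult by (simp add: w_def)
      finally show ?thesis .
    qed
  qed
qed

text \<open>The size condition enters only through \<open>int\<close>. For each radius
  \<open>\<delta>0\<close> a mollifier of at most that radius is built, and the inverse transform of
  \<open>G\<close> is the convolution of f with it; it remains to show that this convolution
  vanishes.\<close>

theorem AE_eq_0_if_divergent:
  fixes \<psi> :: "'a::euclidean_space \<Rightarrow> real" and f g :: "'a \<Rightarrow> complex"
  assumes nonneg: "\<And>\<xi>. \<psi> \<xi> \<ge> 0" and rad: "radially_increasing \<psi>" and I: "I_int \<psi> = \<infinity>"
    and p: "1 \<le> p" and f: "in_Lp p f" and g: "is_fourier_transform p f g"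
    and g_meas: "g \<in> borel_measurable borel"
    and int: "integrable lborel (\<lambda>\<xi>. norm (g \<xi>) * exp (\<psi> \<xi>) / (1 + norm \<xi>) ^ m)"
    and U: "open U" "U \<noteq> {}" "AE x in lborel. x \<in> U \<longrightarrow> f x = 0"
  shows "AE x in lborel. f x = 0"
proof (rule AE_eq_0_if_bump_convolutions_0)
  show "integrable lborel (\<lambda>x. indicator (ball 0 R) x * f x)" for R
    by (rule in_Lp_locally_integrable[OF p f])
next
  note [measurable] = g_meas
  obtain x0 \<rho> where \<rho>: "\<rho> > 0" "ball x0 \<rho> \<subseteq> U"
    using U(1,2) open_contains_ball[of U] by blast
  define P where "P n = profile \<psi> (2 ^ n)" for n :: nat
  have P_div: "\<not> summable (\<lambda>n. P n / 2 ^ n)"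
    using I_int_finite_iff[OF nonneg rad] I by (simp add: P_def)
  have P_nonneg: "P n \<ge> 0" for n
    by (simp add: P_def profile_def nonneg)
  obtain w K where w: "\<And>n. w n > 0" and Kw: "summable (\<lambda>n. real (K n) * w n)"
    and K_div: "\<not> summable (\<lambda>n. real (K n) / 2 ^ n)" and wP: "\<And>n. 1 \<le> (2 ^ n * w n) ^ K n * exp (P n)"
    by (rule divergent_scales[OF P_nonneg P_div]) (rule that)
  define H where "H \<xi> = norm (g \<xi>) * exp (\<psi> \<xi>) / (1 + norm \<xi>) ^ m" for \<xi>
  have H_int: "integrable lborel H" and H_nonneg: "H \<xi> \<ge> 0" for \<xi>
    using int by (auto simp: H_def[abs_def])

  fix \<delta>0 :: real assume "\<delta>0 > 0"
  \<comment> \<open>The other half of \<rho> remains as the radius of the ball around x0 on which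
    the convolution vanishes.\<close>
  define \<delta> where "\<delta> = min \<delta>0 (\<rho> / 2)"
  have \<delta>: "\<delta> > 0" "\<delta> \<le> \<delta>0" "\<delta> \<le> \<rho> / 2"
    using \<rho> \<open>\<delta>0 > 0\<close> by (auto simp: \<delta>_def)
  obtain \<phi> :: "'a \<Rightarrow> real" where \<phi>: "bump \<delta> \<phi>" "smooth_compact_support (\<lambda>x. complex_of_real (\<phi> x))"
      "(\<integral>x. \<phi> x \<partial>lborel) = 1"
    and inv: "\<And>x. complex_of_real (\<phi> x) = fourier (cfourier \<phi>) (- x)"
    and decay: "\<And>M. \<exists>C. \<forall>\<xi>. norm (cfourier \<phi> \<xi>) * (1 + norm \<xi>) ^ M \<le> C"
      "\<And>M. \<exists>C. \<forall>\<xi> j. norm (cfourier \<phi> \<xi>) * (1 + norm \<xi>) ^ M * (w j * norm \<xi>) ^ K j \<le> C"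
    by (rule mollifier[OF w Kw \<delta>(1)]) (rule that)
  note [measurable] = cfourier_measurable[OF \<phi>(1)]
  define G where "G \<xi> = g \<xi> * cfourier \<phi> \<xi>" for \<xi>
  \<comment> \<open>\<open>H\<close> carries the integrability of \<open>g\<close> against the
    weight, so any bound for \<open>G\<close> reduces to a pointwise inequality between the
    transform of the mollifier and exp \<psi>.\<close>
  have norm_G: "a * norm (G \<xi>) \<le> b * H \<xi>"
    if "norm (cfourier \<phi> \<xi>) * (1 + norm \<xi>) ^ m * a \<le> b * exp (\<psi> \<xi>)" for a b \<xi>
  proof -
    have "a * norm (G \<xi>) = (norm (cfourier \<phi> \<xi>) * (1 + norm \<xi>) ^ m * a) * (norm (g \<xi>) / (1 + norm \<xi>) ^ m)"
      by (simp add: G_def norm_mult add_nonneg_eq_0_iff)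
    also have "\<dots> \<le> (b * exp (\<psi> \<xi>)) * (norm (g \<xi>) / (1 + norm \<xi>) ^ m)"
      by (intro mult_right_mono that) auto
    finally show ?thesis
      by (simp add: H_def mult_ac)
  qed
  have exp_ge_1: "1 \<le> exp (\<psi> \<xi>)" for \<xi>
    using nonneg by simp

  have rapid_G: "rapid G"
    unfolding rapid_def
  proof (intro conjI allI)
    show "G \<in> borel_measurable borel"
      unfolding G_def[abs_def] by measurable
    fix k
    obtain C where C: "\<And>\<xi>. norm (cfourier \<phi> \<xi>) * (1 + norm \<xi>) ^ (m + k) \<le> C"
      using decay(1) by blast
    show "integrable lborel (\<lambda>\<xi>. norm \<xi> ^ k * norm (G \<xi>))"
    proof (rule Bochner_Integration.integrable_bound)
      show "integrable lborel (\<lambda>\<xi>. C * H \<xi>)"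
        by (intro integrable_mult_right H_int)
      have "norm \<xi> ^ k * norm (G \<xi>) \<le> C * H \<xi>" for \<xi>
      proof (rule norm_G)
        have "norm (cfourier \<phi> \<xi>) * (1 + norm \<xi>) ^ m * norm \<xi> ^ k \<le>
            norm (cfourier \<phi> \<xi>) * (1 + norm \<xi>) ^ m * (1 + norm \<xi>) ^ k"
          by (intro mult_left_mono power_mono) auto
        also have "\<dots> \<le> C"
          using C[of \<xi>] by (simp add: power_add mult_ac)
        also have "\<dots> \<le> C * exp (\<psi> \<xi>)"
          using order_trans[OF _ C[of \<xi>], of 0] exp_ge_1[of \<xi>] by (simp add: mult_le_cancel_left1)
        finally show "norm (cfourier \<phi> \<xi>) * (1 + norm \<xi>) ^ m * norm \<xi> ^ k \<le> C * exp (\<psi> \<xi>)" .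
      qed
      then show "AE \<xi> in lborel. norm (norm \<xi> ^ k * norm (G \<xi>)) \<le> norm (C * H \<xi>)"
        by (intro AE_I2) (auto intro: order_trans[OF _ abs_ge_self])
    qed (simp add: G_def)
  qed

  obtain C1 where C1: "\<And>\<xi>. norm (cfourier \<phi> \<xi>) * (1 + norm \<xi>) ^ m \<le> C1"
    using decay(1) by blast
  obtain C2 where C2: "\<And>\<xi> j. norm (cfourier \<phi> \<xi>) * (1 + norm \<xi>) ^ m * (w j * norm \<xi>) ^ K j \<le> C2"
    using decay(2) by blast
  define C where "C = max C1 C2"
  have C: "norm (cfourier \<phi> \<xi>) * (1 + norm \<xi>) ^ m \<le> C"
    "norm (cfourier \<phi> \<xi>) * (1 + norm \<xi>) ^ m * (w j * norm \<xi>) ^ K j \<le> C" for \<xi> j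
    using C1[of \<xi>] C2[of \<xi> j] by (auto simp: C_def)
  have C_nonneg: "C \<ge> 0"
    using order_trans[OF _ C(1)[of 0], of 0] by simp
  have moments: "(\<integral>\<xi>. norm \<xi> ^ k * norm (G \<xi>) \<partial>lborel) \<le> C * (\<integral>\<xi>. H \<xi> \<partial>lborel) * (2 ^ n) ^ k" if k: "k \<le> K n" for n k
  proof -
    have "norm \<xi> ^ k * norm (G \<xi>) \<le> (C * (2 ^ n) ^ k) * H \<xi>" for \<xi>
    proof (rule norm_G)
      let ?c = "norm (cfourier \<phi> \<xi>) * (1 + norm \<xi>) ^ m"
      show "?c * norm \<xi> ^ k \<le> (C * (2 ^ n) ^ k) * exp (\<psi> \<xi>)"
      proof (cases "norm \<xi> \<le> 2 ^ n")
        case True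
        then have "?c * norm \<xi> ^ k \<le> C * (2 ^ n) ^ k"
          using C_nonneg by (intro mult_mono C(1) power_mono) auto
        also have "\<dots> \<le> (C * (2 ^ n) ^ k) * exp (\<psi> \<xi>)"
          using mult_left_mono[OF exp_ge_1[of \<xi>], of "C * (2 ^ n) ^ k"] C_nonneg by simp
        finally show ?thesis .
      next
        \<comment> \<open>As r \<ge> 1, the exponent k may be raised to \<open>K n\<close>. Then
          \<open>wP\<close> trades r^(K n) for the power (w n |\<xi>|)^(K n) that the mollifier
          controls times exp (P n), and P n \<le> \<psi>(\<xi>) by monotonicity.\<close>
        case False
        define r where "r = norm \<xi> / 2 ^ n"
        have r: "1 \<le> r" "norm \<xi> = r * 2 ^ n"
          using False by (auto simp: r_def)
        have "r ^ k \<le> r ^ K n * 1"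
          using r k by (simp add: power_increasing)
        also have "\<dots> \<le> r ^ K n * ((2 ^ n * w n) ^ K n * exp (P n))"
          using r by (intro mult_left_mono wP) auto
        also have "\<dots> = (w n * norm \<xi>) ^ K n * exp (P n)"
          by (simp add: r(2) power_mult_distrib mult_ac)
        also have "\<dots> \<le> (w n * norm \<xi>) ^ K n * exp (\<psi> \<xi>)"
          unfolding P_def profile_norm[OF rad, of \<xi>] using False w[of n]
          by (intro mult_left_mono) (auto intro: profile_mono[OF rad])
        finally have "?c * r ^ k \<le> ?c * ((w n * norm \<xi>) ^ K n * exp (\<psi> \<xi>))"
          by (intro mult_left_mono) auto
        also have "\<dots> = (?c * (w n * norm \<xi>) ^ K n) * exp (\<psi> \<xi>)"
          by (simp only: mult_ac)
        also have "\<dots> \<le> C * exp (\<psi> \<xi>)"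
          by (intro mult_right_mono C(2)) simp
        finally have "(?c * r ^ k) * (2 ^ n) ^ k \<le> (C * exp (\<psi> \<xi>)) * (2 ^ n) ^ k"
          by (intro mult_right_mono) auto
        then show ?thesis
          by (simp add: r(2) power_mult_distrib mult_ac)
      qed
    qed
    then have "(\<integral>\<xi>. norm \<xi> ^ k * norm (G \<xi>) \<partial>lborel) \<le> (\<integral>\<xi>. (C * (2 ^ n) ^ k) * H \<xi> \<partial>lborel)"
      using rapid_G by (intro integral_mono integrable_mult_right H_int) (auto simp: rapid_def)
    then show ?thesis
      by (simp add: mult_ac)
  qed

  obtain D where D: "\<And>\<xi>. norm (cfourier \<phi> \<xi>) * (1 + norm \<xi>) ^ (2 * DIM('a)) \<le> D"
    using decay(1) by blast
  have int_\<phi>: "integrable lborel (cfourier \<phi>)"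
  proof (rule Bochner_Integration.integrable_bound)
    show "integrable lborel (\<lambda>\<xi>. D * (1 / (1 + norm (\<xi>::'a)) ^ (2 * DIM('a))))"
      by (intro integrable_mult_right integrable_inverse_weight) simp
    have "norm (cfourier \<phi> \<xi>) \<le> D * (1 / (1 + norm \<xi>) ^ (2 * DIM('a)))" for \<xi>
      using D[of \<xi>] by (simp add: pos_le_divide_eq add_pos_nonneg)
    then show "AE \<xi> in lborel. norm (cfourier \<phi> \<xi>) \<le> norm (D * (1 / (1 + norm \<xi>) ^ (2 * DIM('a))))"
      unfolding real_norm_def by (intro AE_I2 order_trans[OF _ abs_ge_self])
  qed measurable
  have f\<phi>: "fourier (cfourier \<phi>) z = complex_of_real (\<phi> (- z))" for z
    using inv[of "- z"] by simp
  have conv: "fourier G (- x) = (\<integral>y. f y * complex_of_real (\<phi> (x - y)) \<partial>lborel)" for x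
  proof -
    have "fourier (\<lambda>\<xi>. g \<xi> * cfourier \<phi> \<xi>) (- x) = (\<integral>y. f y * fourier (cfourier \<phi>) (y - x) \<partial>lborel)"
    proof (rule fourier_mult_Lp[OF p f g int_\<phi>])
      show "norm (cfourier \<phi> \<xi>) \<le> 1" for \<xi>
        using norm_cfourier_le[OF \<phi>(1), of \<xi>] \<phi>(3) by simp
      show "integrable lborel (\<lambda>\<xi>. g \<xi> * cfourier \<phi> \<xi>)"
        using rapid_integrable[OF rapid_G] by (simp add: G_def[abs_def])
      show "fourier (cfourier \<phi>) z = 0" if "norm z > \<delta>" for z
        using that \<phi>(1) by (simp add: f\<phi> bump_def)
    qed
    then show ?thesis
      by (simp add: f\<phi> G_def[abs_def])
  qed
  \<comment> \<open>The centre is -x0 because \<open>fourier G\<close> at -x is the value of the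
    convolution at x.\<close>
  have vanish: "fourier G z = 0" if z: "dist z (- x0) < \<rho> / 2" for z
  proof -
    have "dist z (- x0) = norm (- z - x0)"
      unfolding dist_norm by (metis add_uminus_conv_diff minus_add_distrib minus_minus norm_minus_cancel)
    then have x: "norm (- z - x0) < \<rho> / 2"
      using z by simp
    have "AE y in lborel. f y * complex_of_real (\<phi> (- z - y)) = 0"
      using U(3)
    proof eventually_elim
      case (elim y)
      show ?case
      proof (cases "norm (- z - y) \<le> \<delta>")
        case True
        then have "norm (x0 - y) < \<rho>"
          using norm_triangle_ineq4[of "- z - y" "- z - x0"] x \<delta>(3) by simp
        then show ?thesis
          using elim \<rho>(2) by (auto simp: dist_norm subset_eq)
      next
        case False
        then show ?thesis
          using \<phi>(1) by (simp add: bump_def)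
      qed
    qed
    then have "(\<integral>y. f y * complex_of_real (\<phi> (- z - y)) \<partial>lborel) = 0"
      by (rule integral_eq_zero_AE)
    then show ?thesis
      using conv[of "- z"] by simp
  qed
  have "fourier G z = 0" for z
  proof (rule fourier_eq_0_of_vanishing_on_ball[OF rapid_G _ moments K_div _ vanish])
    show "0 \<le> C * (\<integral>\<xi>. H \<xi> \<partial>lborel)"
      using C_nonneg H_nonneg by (intro mult_nonneg_nonneg integral_nonneg_AE) auto
    show "0 < \<rho> / 2"
      using \<rho> by simp
  qed
  then have "(\<integral>y. f y * complex_of_real (\<phi> (x - y)) \<partial>lborel) = 0" for x
    using conv[of x] by simp
  moreover have "bump \<delta>0 \<phi>"
    using \<phi>(1) \<delta>(2) by (auto simp: bump_def)
  ultimately show "\<exists>\<phi>. bump \<delta>0 \<phi> \<and> (\<integral>x. \<phi> x \<partial>lborel) = 1 \<and>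
      (\<forall>x. (\<integral>y. f y * complex_of_real (\<phi> (x - y)) \<partial>lborel) = 0)"
    using \<phi>(3) by blast
qed

theorem theorem2p2:
  fixes \<psi> :: "'a::euclidean_space \<Rightarrow> real"
  assumes nonneg: "\<And>\<xi>. \<psi> \<xi> \<ge> 0"
    and rad: "radially_increasing \<psi>"
  shows
    "(\<forall>(f :: 'a \<Rightarrow> complex) g p.
        1 \<le> p \<and> p \<le> 2 \<and> in_Lp p f \<and> is_fourier_transform p f g \<and>
        ((\<exists>q N. 1 \<le> q \<and> 0 \<le> N \<and> weighted_cond q N \<psi> g) \<or>
         (\<exists>C P. C > 0 \<and> poly_bound C P \<psi> g)) \<and>
        (\<exists>U. open U \<and> U \<noteq> {} \<and> (AE x in lborel. x \<in> U \<longrightarrow> f x = 0)) \<and>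
        I_int \<psi> = \<infinity>
        \<longrightarrow> (AE x in lborel. f x = 0))
     \<and>
     (I_int \<psi> < \<infinity> \<longrightarrow>
        (\<forall>q N. 1 \<le> q \<and> 0 \<le> N \<longrightarrow>
           (\<exists>f :: 'a \<Rightarrow> complex. smooth_compact_support f \<and> (\<exists>x. f x \<noteq> 0) \<and>
               weighted_cond q N \<psi> (fourier f)))
        \<and> (\<exists>(f :: 'a \<Rightarrow> complex) C P. smooth_compact_support f \<and> (\<exists>x. f x \<noteq> 0) \<and>
               poly_bound C P \<psi> (fourier f)))"
proof (intro conjI impI allI; (elim conjE exE)?)
  fix f g :: "'a \<Rightarrow> complex" and p :: real and U
  assume p: "1 \<le> p" and f: "in_Lp p f" and g: "is_fourier_transform p f g"
    and cond: "(\<exists>q N. 1 \<le> q \<and> 0 \<le> N \<and> weighted_cond q N \<psi> g) \<or> (\<exists>C P. C > 0 \<and> poly_bound C P \<psi> g)"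
    and I: "I_int \<psi> = \<infinity>" and U: "open U" "U \<noteq> {}" "AE x in lborel. x \<in> U \<longrightarrow> f x = 0"
  have \<psi>: "\<psi> \<in> borel_measurable borel"
    by (rule radially_increasing_measurable[OF rad])
  have g_meas: "g \<in> borel_measurable borel"
  proof (cases "p = 1")
    case True
    then have "g = fourier f"
      using g by (auto simp: is_fourier_transform_def)
    then show ?thesis
      using f by (simp add: in_Lp_def fourier_measurable)
  next
    case False
    then show ?thesis
      using g by (simp add: is_fourier_transform_def)
  qed
  have "\<exists>m. integrable lborel (\<lambda>\<xi>. norm (g \<xi>) * exp (\<psi> \<xi>) / (1 + norm \<xi>) ^ m)"
    using cond
  proof (elim disjE exE conjE)
    fix q N assume "1 \<le> q" "weighted_cond q N \<psi> g"
    from integrable_of_weighted_cond[OF \<psi> g_meas this] show ?thesis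
      by blast
  next
    fix C P assume "C > 0" "poly_bound C P \<psi> g"
    from integrable_of_poly_bound[OF \<psi> g_meas less_imp_le[OF this(1)] this(2)] show ?thesis
      by blast
  qed
  then obtain m where "integrable lborel (\<lambda>\<xi>. norm (g \<xi>) * exp (\<psi> \<xi>) / (1 + norm \<xi>) ^ m)"
    by blast
  then show "AE x in lborel. f x = 0"
    by (rule AE_eq_0_if_divergent[OF nonneg rad I p f g g_meas _ U])
next
  assume fin: "I_int \<psi> < \<infinity>"
  obtain f :: "'a \<Rightarrow> complex" where f: "smooth_compact_support f" "\<exists>x. f x \<noteq> 0"
    and decay: "\<And>M. \<exists>C. \<forall>\<xi>. norm (fourier f \<xi>) * (1 + norm \<xi>) ^ M * exp (\<psi> \<xi>) \<le> C"
    using exists_weighted_bump[OF nonneg rad fin] by metis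
  show "\<exists>f :: 'a \<Rightarrow> complex. smooth_compact_support f \<and> (\<exists>x. f x \<noteq> 0) \<and> weighted_cond q N \<psi> (fourier f)"
    if "1 \<le> q" "0 \<le> N" for q N
    using f decay[of "2 * DIM('a)"] weighted_cond_of_decay[OF that] by blast
  obtain C where C: "\<And>\<xi>. norm (fourier f \<xi>) * exp (\<psi> \<xi>) \<le> C"
    using decay[of 0] by auto
  have "norm (fourier f \<xi>) \<le> C * norm (1 :: complex) * exp (- \<psi> \<xi>)" for \<xi>
    using C[of \<xi>] by (simp add: exp_minus field_simps)
  \<comment> \<open>The constant polynomial 1 suffices as witness, since the decay of the transform
    dominates exp \<psi> outright.\<close>
  then have "poly_bound C (\<lambda>_. 1) \<psi> (fourier f)"
    by (simp add: poly_bound_def)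
  then show "\<exists>(f :: 'a \<Rightarrow> complex) C P. smooth_compact_support f \<and> (\<exists>x. f x \<noteq> 0) \<and> poly_bound C P \<psi> (fourier f)"
    using f by blast
qed

end
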